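(* Let $m\ge2$, $\alpha>0$, $\epsilon\ge0$, $\eta>m-1+\epsilon$, and consider the $m$ walks on the star graph with occupation process $X$ described in the context. (1) If $\epsilon=0$, then $\mathbb P(\mathfrak L(X)\subset\mathcal S_1)=1$, where $\mathfrak L(X)=\bigcap_{n\ge0}\overline{\bigcup_{k\ge n}\{X(k)\}}$ and $$\mathcal S_1=\{p\in\mathcal D:\ p_1^i\in[0,1]\text{ for some }i\in[m]\text{ and }p_1^j=0\text{ for all }j\ne i\}.$$ (2) If $\epsilon\in(0,\tfrac12)$, then $X(n)$ converges almost surely to one of the points of $$\mathcal S_2=\Big\{p\in\mathcal D:\ \exists\,K,\ \varnothing\ne K\subsetneq[m],\ p_1^i=\tfrac{\epsilon}{|K|+2\epsilon-1}\text{ for }i\in K,\ p_1^j=0\text{ for }j\in[m]\setminus K\Big\}.$$ (3) If $\epsilon\in(\tfrac12,1)$, then $X(n)$ converges almost surely to the point $p\in\mathcal D$ with $p_1^i=\frac{\epsilon}{m+2\epsilon-1}$ and $p_{i+1}^i=1-\frac{\epsilon}{m+2\epsilon-1}$ for all $i\in[m]$.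
   Context: The star graph has vertices $V=\{1,\dots,m+1\}$, centre $1$; walk $i\in[m]=\{1,\dots,m\}$ lives on $V^i=\{1,i+1\}$. $\mathcal D$ is the set of $x=(x_1^i,x_{i+1}^i)_{i\in[m]}$ with nonnegative entries and $x_1^i+x_{i+1}^i=1$ for each $i$. Set $$H_1^i(x)=\Big(\eta-\epsilon x_1^i-\sum_{j\ne i}x_1^j\Big)^\alpha,\quad H_{i+1}^i(x)=(\eta-\epsilon x_{i+1}^i)^\alpha,\quad \pi_v^i(x)=\frac{x_v^iH_v^i(x)}{x_1^iH_1^i(x)+x_{i+1}^iH_{i+1}^i(x)}\ (v\in V^i).$$ The walks $W^i(n)\in V^i$, $n\ge1$, satisfy: with $X_v^i(0)=1/2$, $X_v^i(n)=\frac1{2+n}\big(1+\sum_{k=1}^n\mathbf 1\{W^i(k)=v\}\big)$, $X(n)=(X_v^i(n))_{i\in[m],v\in V^i}\in\mathcal D$ and $\mathcal F_n=\sigma(W^i(k):i\in[m],1\le k\le n)$ ($\mathcal F_0$ trivial), $\mathbb P(W^i(n+1)=v\mid\mathcal F_n)=\pi_v^i(X(n))$ for all $n\ge0$, and $W^1(n+1),\dots,W^m(n+1)$ are conditionally independent given $\mathcal F_n$. *)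

theory Defs
  imports "HOL-Probability.Probability"
begin

definition star_vertices :: "nat \<Rightarrow> nat set" where
  "star_vertices i = {1, i + 1}"

(* A point x = (x i v) with i in {1..m} and v in star_vertices i is encoded as a function that
   is zero at all other indices. The library's topology on functions is the product topology,
   so on such functions it is the Euclidean topology of the 2m relevant coordinates. *)
definition star_domain :: "nat \<Rightarrow> (nat \<Rightarrow> nat \<Rightarrow> real) set" where
  "star_domain m = {x. (\<forall>i\<in>{1..m}. (\<forall>v\<in>star_vertices i. 0 \<le> x i v) \<and> x i 1 + x i (i + 1) = 1) \<and>
     (\<forall>i v. \<not> (i \<in> {1..m} \<and> v \<in> star_vertices i) \<longrightarrow> x i v = 0)}"

(* Used only for v in star_vertices i, so the else branch is the case v = i + 1. *)
definition star_H :: "nat \<Rightarrow> real \<Rightarrow> real \<Rightarrow> real \<Rightarrow> (nat \<Rightarrow> nat \<Rightarrow> real) \<Rightarrow> nat \<Rightarrow> nat \<Rightarrow> real" where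
  "star_H m \<alpha> \<epsilon> \<eta> x i v =
     (if v = 1 then (\<eta> - \<epsilon> * x i 1 - (\<Sum>j\<in>{1..m} - {i}. x j 1)) powr \<alpha>
      else (\<eta> - \<epsilon> * x i (i + 1)) powr \<alpha>)"

definition star_pi :: "nat \<Rightarrow> real \<Rightarrow> real \<Rightarrow> real \<Rightarrow> (nat \<Rightarrow> nat \<Rightarrow> real) \<Rightarrow> nat \<Rightarrow> nat \<Rightarrow> real" where
  "star_pi m \<alpha> \<epsilon> \<eta> x i v = x i v * star_H m \<alpha> \<epsilon> \<eta> x i v /
     (x i 1 * star_H m \<alpha> \<epsilon> \<eta> x i 1 + x i (i + 1) * star_H m \<alpha> \<epsilon> \<eta> x i (i + 1))"

(* W i k w is the position of walk i at time k \<ge> 1; W i 0 is never used.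
   At n = 0 the formula gives the initial value 1/2. *)
definition star_occupation ::
    "nat \<Rightarrow> (nat \<Rightarrow> nat \<Rightarrow> 'a \<Rightarrow> nat) \<Rightarrow> nat \<Rightarrow> 'a \<Rightarrow> nat \<Rightarrow> nat \<Rightarrow> real" where
  "star_occupation m W n \<omega> i v =
     (if i \<in> {1..m} \<and> v \<in> star_vertices i
      then 1 / (2 + real n) * (1 + (\<Sum>k = 1..n. of_bool (W i k \<omega> = v))) else 0)"

definition star_history ::
    "'a measure \<Rightarrow> nat \<Rightarrow> (nat \<Rightarrow> nat \<Rightarrow> 'a \<Rightarrow> nat) \<Rightarrow> nat \<Rightarrow> 'a measure" where
  "star_history M m W n =
     sigma (space M) {W i k -` A \<inter> space M | i k A. i \<in> {1..m} \<and> k \<in> {1..n} \<and> A \<subseteq> star_vertices i}"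

(* Conditional counterpart of the library's indep_vars. *)
definition cond_indep_vars ::
    "'a measure \<Rightarrow> 'a measure \<Rightarrow> ('i \<Rightarrow> 'b measure) \<Rightarrow> ('i \<Rightarrow> 'a \<Rightarrow> 'b) \<Rightarrow> 'i set \<Rightarrow> bool" where
  "cond_indep_vars M F N Y I \<longleftrightarrow>
     (\<forall>i\<in>I. Y i \<in> measurable M (N i)) \<and>
     (\<forall>J A. J \<subseteq> I \<longrightarrow> finite J \<longrightarrow> J \<noteq> {} \<longrightarrow> (\<forall>j\<in>J. A j \<in> sets (N j)) \<longrightarrow>
        (AE \<omega> in M. real_cond_exp M F (indicator (\<Inter>j\<in>J. Y j -` A j \<inter> space M)) \<omega> =
           (\<Prod>j\<in>J. real_cond_exp M F (indicator (Y j -` A j \<inter> space M)) \<omega>)))"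

locale star_walks = prob_space M
  for M :: "'a measure" and m :: nat and \<alpha> \<epsilon> \<eta> :: real and W :: "nat \<Rightarrow> nat \<Rightarrow> 'a \<Rightarrow> nat" +
  assumes walk_measurable:
      "\<And>i n. i \<in> {1..m} \<Longrightarrow> 1 \<le> n \<Longrightarrow> W i n \<in> measurable M (count_space (star_vertices i))"
    and walk_transition:
      "\<And>n i v. i \<in> {1..m} \<Longrightarrow> v \<in> star_vertices i \<Longrightarrow>
         AE \<omega> in M. real_cond_exp M (star_history M m W n)
             (indicator {\<omega> \<in> space M. W i (n + 1) \<omega> = v}) \<omega> =
           star_pi m \<alpha> \<epsilon> \<eta> (star_occupation m W n \<omega>) i v"
    and walk_cond_indep:
      "\<And>n. cond_indep_vars M (star_history M m W n)
         (\<lambda>i. count_space (star_vertices i)) (\<lambda>i. W i (n + 1)) {1..m}"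

definition limit_set :: "(nat \<Rightarrow> 'b::topological_space) \<Rightarrow> 'b set" where
  "limit_set x = (\<Inter>n. closure (\<Union>k\<in>{n..}. {x k}))"

definition star_S1 :: "nat \<Rightarrow> (nat \<Rightarrow> nat \<Rightarrow> real) set" where
  "star_S1 m = {p \<in> star_domain m.
     \<exists>i\<in>{1..m}. p i 1 \<in> {0..1} \<and> (\<forall>j\<in>{1..m}. j \<noteq> i \<longrightarrow> p j 1 = 0)}"

definition star_S2 :: "nat \<Rightarrow> real \<Rightarrow> (nat \<Rightarrow> nat \<Rightarrow> real) set" where
  "star_S2 m \<epsilon> = {p \<in> star_domain m. \<exists>K. K \<noteq> {} \<and> K \<subset> {1..m} \<and>
     (\<forall>i\<in>K. p i 1 = \<epsilon> / (real (card K) + 2 * \<epsilon> - 1)) \<and> (\<forall>j\<in>{1..m} - K. p j 1 = 0)}"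

lemma star_occupation_0:
  "i \<in> {1..m} \<Longrightarrow> v \<in> star_vertices i \<Longrightarrow> star_occupation m W 0 \<omega> i v = 1 / 2"
  by (simp add: star_occupation_def)

context star_walks
begin

lemma star_occupation_in_domain:
  assumes "\<omega> \<in> space M"
  shows "star_occupation m W n \<omega> \<in> star_domain m"
proof -
  have "star_occupation m W n \<omega> i 1 + star_occupation m W n \<omega> i (i + 1) = 1"
    if i: "i \<in> {1..m}" for i
  proof -
    have "of_bool (W i k \<omega> = 1) + of_bool (W i k \<omega> = i + 1) = (1::real)" if "k \<in> {1..n}" for k
      using measurable_space[OF walk_measurable assms, of i k] that i
      by (auto simp: star_vertices_def)
    then have "(\<Sum>k = 1..n. of_bool (W i k \<omega> = 1) + of_bool (W i k \<omega> = i + 1)) = real n"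
      by (simp del: One_nat_def)
    then have "(\<Sum>k = 1..n. of_bool (W i k \<omega> = 1)) + (\<Sum>k = 1..n. of_bool (W i k \<omega> = i + 1)) = real n"
      by (simp only: sum.distrib)
    then show ?thesis
      using i unfolding star_occupation_def
      by (simp add: star_vertices_def add_divide_distrib[symmetric])
  qed
  then show ?thesis
    by (auto simp: star_domain_def star_occupation_def intro!: sum_nonneg add_nonneg_nonneg)
qed

lemma subalgebra_star_history: "subalgebra M (star_history M m W n)"
proof -
  have "{W i k -` A \<inter> space M | i k A. i \<in> {1..m} \<and> k \<in> {1..n} \<and> A \<subseteq> star_vertices i} \<subseteq> sets M"
    by (auto intro!: measurable_sets[OF walk_measurable])
  then show ?thesis
    unfolding subalgebra_def star_history_def
    by (simp add: space_measure_of_conv sets_measure_of_conv sets.sigma_sets_subset)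
qed

end

end

theory Submission
  imports Defs
begin

text \<open>Write p i for the frequency with which walk i sits at the centre, s for the sum of all p j, and
  G i = \<epsilon> - s + (1 - 2 \<epsilon>) p i. The transition probability exceeds p i exactly when G i > 0, and G is
  the gradient of the quadratic function L = \<epsilon> s - s^2 / 2 + (1/2 - \<epsilon>) \<Sum> (p j)^2. Summing the expected increments of
  L shows that the series of p i (1 - p i) (G i)^2 / n converges almost surely; as the process moves by
  at most 1 / n in step n, the quantities p i (1 - p i) (G i)^2 tend to 0, so all limit points are equilibria.
  A boundary equilibrium with p i = 0 < G i or p i = 1, G i < 0 is excluded by the supermartingale n / Z, Z counting
  the rare visits. For \<epsilon> < 1/2 the equilibrium with all p i positive is excluded through the difference
  p 1 - p 2: its drift has the form \<lambda> (p 1 - p 2) with \<lambda> \<ge> 0 nearby, and its noise is nondegenerate because the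
  walks are conditionally independent.\<close>

text \<open>The set of equilibria depends delicately on \<epsilon>. For \<epsilon> in (0,1) other
  than 1/2, all coordinates strictly between 0 and 1 satisfy G = 0 and hence coincide, so each
  coordinate has finitely many possible limits and slow motion forces convergence. For \<epsilon> =
  0 there are whole segments of equilibria, and only the products p i p j are shown to vanish.

  The rate comes from an exact identity: the drift of walk i is p i (1 - p i) (a^\<alpha> -
  b^\<alpha>) / N with a - b = G i and N > 0, so the sign of G i decides for every \<alpha> > 0.

  At an equilibrium with support K, a walk outside K has G = \<epsilon> (2 \<epsilon> - 1) / (|K| +
  2 \<epsilon> - 1). For \<epsilon> > 1/2 this is positive and every proper support is repelled at
  the boundary. For \<epsilon> < 1/2 proper supports are admissible limits and only the full support
  must be excluded, for which one fixed pair of walks suffices. Both walks see the same s, so the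
  difference of their drifts is governed by the derivative of the transition probability in p alone,
  which exceeds 1 at the symmetric point because 1 - 2 \<epsilon> > 0.\<close>

section \<open>Slowly varying real sequences\<close>

text \<open>The squares have increments of at most
  \<open>(2 * f n + C / (real n + 3)) * (C / (real n + 3))\<close>, which are summable. So the
  squares, and with them f, converge; a positive limit would make the harmonic series
  converge.\<close>

lemma summable_slow_imp_tendsto_0:
  fixes f :: "nat \<Rightarrow> real"
  assumes nonneg: "\<And>n. 0 \<le> f n"
    and slow: "\<And>n. \<bar>f (Suc n) - f n\<bar> \<le> C / (real n + 3)"
    and summ: "summable (\<lambda>n. f n / (real n + 3))"
  shows "f \<longlonglongrightarrow> 0"
proof -
  have C: "0 \<le> C"
    using order_trans[OF abs_ge_zero[of "f (Suc 0) - f 0"] slow[of 0]] by simp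
  have sq: "summable (\<lambda>n. 1 / (real n + 3)\<^sup>2)"
  proof (rule summable_comparison_test'[where N = 0])
    show "summable (\<lambda>n. 1 / real (Suc n) ^ 2)"
      using inverse_squares_sums[THEN sums_summable] by (simp add: add.commute)
    show "norm (1 / (real n + 3)\<^sup>2) \<le> 1 / real (Suc n) ^ 2" for n
      by (auto intro!: divide_left_mono power_mono)
  qed
  have summ2: "summable (\<lambda>n. C * (2 * (f n / (real n + 3)) + C * (1 / (real n + 3)\<^sup>2)))"
    by (intro summable_mult summable_add summ sq)
  have "summable (\<lambda>n. norm ((f (Suc n))\<^sup>2 - (f n)\<^sup>2))"
  proof (rule summable_comparison_test'[OF summ2, where N = 0])
    fix n
    have le: "f (Suc n) \<le> f n + C / (real n + 3)"
      using slow[of n] by linarith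
    have "\<bar>(f (Suc n))\<^sup>2 - (f n)\<^sup>2\<bar> = (f (Suc n) + f n) * \<bar>f (Suc n) - f n\<bar>"
      using nonneg[of n] nonneg[of "Suc n"]
      by (simp add: power2_eq_square square_diff_square_factored abs_mult)
    also have "\<dots> \<le> (2 * f n + C / (real n + 3)) * (C / (real n + 3))"
      using le slow[of n] nonneg[of n] nonneg[of "Suc n"] C by (intro mult_mono) auto
    also have "\<dots> = C * (2 * (f n / (real n + 3)) + C * (1 / (real n + 3)\<^sup>2))"
    proof -
      have "(2 * a + C / x) * (C / x) = C * (2 * (a / x) + C * (1 / x\<^sup>2))" if "x \<noteq> 0" for a x
        using that by (simp add: field_simps power2_eq_square)
      then show ?thesis by simp
    qed
    finally show "norm (norm ((f (Suc n))\<^sup>2 - (f n)\<^sup>2)) \<le> \<dots>" by simp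
  qed
  then have "summable (\<lambda>n. (f (Suc n))\<^sup>2 - (f n)\<^sup>2)"
    by (rule summable_norm_cancel)
  then have "convergent (\<lambda>n. \<Sum>i<n. (f (Suc i))\<^sup>2 - (f i)\<^sup>2)"
    by (simp add: summable_iff_convergent)
  then obtain l where "(\<lambda>n. (f n)\<^sup>2 - (f 0)\<^sup>2) \<longlonglongrightarrow> l"
    using sum_lessThan_telescope[of "\<lambda>n. (f n)\<^sup>2"] by (auto simp: convergent_def)
  from tendsto_add[OF this tendsto_const[of "(f 0)\<^sup>2"]]
  have l: "(\<lambda>n. (f n)\<^sup>2) \<longlonglongrightarrow> l + (f 0)\<^sup>2" by simp
  have "(\<lambda>n. sqrt ((f n)\<^sup>2)) \<longlonglongrightarrow> sqrt (l + (f 0)\<^sup>2)"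
    by (intro tendsto_real_sqrt l)
  then have lim: "f \<longlonglongrightarrow> sqrt (l + (f 0)\<^sup>2)" (is "_ \<longlonglongrightarrow> ?r") by (simp add: nonneg)
  have "?r = 0"
  proof (rule ccontr)
    assume "?r \<noteq> 0"
    moreover have "?r \<ge> 0"
      using lim nonneg by (intro tendsto_lowerbound[OF lim]) auto
    ultimately have r: "?r > 0" by simp
    have "eventually (\<lambda>n. f n > ?r / 2) sequentially"
      using r by (intro order_tendstoD(1)[OF lim]) simp
    then obtain N where N: "\<And>n. n \<ge> N \<Longrightarrow> f n > ?r / 2"
      by (auto simp: eventually_sequentially)
    have "summable (\<lambda>n. (2 / ?r) * (f n / (real n + 3)))"
      by (intro summable_mult summ)
    then have "summable (\<lambda>n. 1 / real (n + 3))"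
    proof (rule summable_comparison_test'[where N = N])
      fix n assume "n \<ge> N"
      then have "1 \<le> (2 / ?r) * f n"
        using N[of n] r by (simp add: field_simps)
      then have "1 / (real n + 3) \<le> (2 / ?r) * f n / (real n + 3)"
        by (intro divide_right_mono) auto
      then show "norm (1 / real (n + 3)) \<le> (2 / ?r) * (f n / (real n + 3))"
        by simp
    qed
    then have "summable (\<lambda>n. inverse (real (n + 3)))"
      by (simp add: inverse_eq_divide)
    then have "summable (\<lambda>n. inverse (real n))"
      by (subst (asm) summable_iff_shift)
    then show False
      using not_summable_harmonic[where 'a = real] by (simp add: inverse_eq_divide)
  qed
  with lim show ?thesis by simp
qed

text \<open>A small product has a small factor, so y is eventually within d of some point of V. Once
  the steps are also below d and the points of V lie 3d apart, y cannot pass from one point to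
  another.\<close>

lemma slow_tendsto_finite:
  fixes y :: "nat \<Rightarrow> real"
  assumes V: "finite V"
    and prod0: "(\<lambda>n. \<Prod>v\<in>V. y n - v) \<longlonglongrightarrow> 0"
    and slow: "(\<lambda>n. y (Suc n) - y n) \<longlonglongrightarrow> 0"
  shows "\<exists>v\<in>V. y \<longlonglongrightarrow> v"
proof -
  have near: "eventually (\<lambda>n. \<exists>v\<in>V. \<bar>y n - v\<bar> < d) sequentially" if d: "d > 0" for d
  proof -
    have "d ^ card V > 0" using d by simp
    then have "eventually (\<lambda>n. \<bar>\<Prod>v\<in>V. y n - v\<bar> < d ^ card V) sequentially"
      using prod0[unfolded tendsto_iff] by (simp add: dist_real_def)
    then show ?thesis
    proof eventually_elim
      case (elim n)
      show ?case
      proof (rule ccontr)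
        assume "\<not> ?thesis"
        then have "(\<Prod>v\<in>V. d) \<le> (\<Prod>v\<in>V. \<bar>y n - v\<bar>)"
          using d by (intro prod_mono) force
        then show False using elim by (simp add: abs_prod)
      qed
    qed
  qed
  obtain d where d: "d > 0" and sep: "\<And>u v. u \<in> V \<Longrightarrow> v \<in> V \<Longrightarrow> u \<noteq> v \<Longrightarrow> 3 * d \<le> \<bar>u - v\<bar>"
  proof -
    \<comment> \<open>The inserted 1 keeps the minimum defined and positive when V has at most one
      point.\<close>
    let ?X = "insert 1 ((\<lambda>(u, v). \<bar>u - v\<bar>) ` (V \<times> V - Id))"
    have fin: "finite ?X" using V by auto
    have pos: "Min ?X > 0" using fin by (subst Min_gr_iff) auto
    show ?thesis
    proof (rule that[of "Min ?X / 3"])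
      show "Min ?X / 3 > 0" using pos by simp
      fix u v assume "u \<in> V" "v \<in> V" "u \<noteq> v"
      then have "\<bar>u - v\<bar> \<in> ?X" by (auto intro!: image_eqI[where x = "(u, v)"])
      then show "3 * (Min ?X / 3) \<le> \<bar>u - v\<bar>" using Min_le[OF fin] by simp
    qed
  qed
  have "eventually (\<lambda>n. \<bar>y (Suc n) - y n\<bar> < d) sequentially"
    using slow[unfolded tendsto_iff] d by (simp add: dist_real_def)
  with near[OF d] have "eventually (\<lambda>n. (\<exists>v\<in>V. \<bar>y n - v\<bar> < d) \<and> \<bar>y (Suc n) - y n\<bar> < d) sequentially"
    by eventually_elim auto
  then obtain N where N: "\<And>n. n \<ge> N \<Longrightarrow> (\<exists>v\<in>V. \<bar>y n - v\<bar> < d) \<and> \<bar>y (Suc n) - y n\<bar> < d"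
    by (auto simp: eventually_sequentially)
  obtain v where v: "v \<in> V" "\<bar>y N - v\<bar> < d" using N[of N] by auto
  have stay: "\<bar>y n - v\<bar> < d" if "n \<ge> N" for n
    using that
  proof (induction n rule: dec_induct)
    case base
    show ?case using v by simp
  next
    case (step n)
    obtain u where u: "u \<in> V" "\<bar>y (Suc n) - u\<bar> < d" using N[of "Suc n"] step.hyps by auto
    have "\<bar>u - v\<bar> < 3 * d" using u step.IH N[of n] step.hyps by linarith
    then have "u = v" using sep[OF u(1) v(1)] by force
    then show ?case using u by simp
  qed
  have "y \<longlonglongrightarrow> v"
    unfolding tendsto_iff dist_real_def
  proof safe
    fix e :: real assume e: "e > 0"
    have "eventually (\<lambda>n. \<exists>v\<in>V. \<bar>y n - v\<bar> < min e d) sequentially" using near[of "min e d"] e d by simp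
    moreover have "eventually (\<lambda>n. n \<ge> N) sequentially" by (rule eventually_ge_at_top)
    ultimately show "eventually (\<lambda>n. \<bar>y n - v\<bar> < e) sequentially"
    proof eventually_elim
      case (elim n)
      then obtain u where u: "u \<in> V" "\<bar>y n - u\<bar> < min e d" by auto
      have "\<bar>u - v\<bar> < 3 * d" using u stay[OF elim(2)] d by linarith
      then have "u = v" using sep[OF u(1) v(1)] by force
      then show ?case using u by simp
    qed
  qed
  with v show ?thesis by blast
qed

text \<open>Bolzano--Weierstrass, one index at a time. It gives joint subsequential limits of all
  coordinates before any convergence is known.\<close>

lemma finite_bounded_imp_convergent_subsequence:
  fixes x :: "'i \<Rightarrow> nat \<Rightarrow> real"
  assumes "finite I" and "\<And>i n. i \<in> I \<Longrightarrow> x i n \<in> {a..b}"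
  shows "\<exists>r. strict_mono r \<and> (\<exists>l. \<forall>i\<in>I. (x i \<circ> r) \<longlonglongrightarrow> l i)"
  using assms
proof (induction I)
  case empty
  show ?case by (auto intro!: exI[of _ id] strict_mono_id)
next
  case (insert j I)
  then obtain r l where r: "strict_mono r" and l: "\<And>i. i \<in> I \<Longrightarrow> (x i \<circ> r) \<longlonglongrightarrow> l i"
    by (meson insertI2)
  have "\<forall>n. (x j \<circ> r) n \<in> {a..b}" using insert.prems by simp
  then obtain s c where s: "strict_mono s" "((x j \<circ> r) \<circ> s) \<longlonglongrightarrow> c"
    using compact_Icc[of a b] unfolding compact_def by metis
  show ?case
  proof (intro exI conjI ballI)
    show "strict_mono (r \<circ> s)" using r s(1) by (rule strict_mono_o)
    show "(x i \<circ> (r \<circ> s)) \<longlonglongrightarrow> (l(j := c)) i" if "i \<in> insert j I" for i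
    proof (cases "i = j")
      case True
      then show ?thesis using s(2) by (simp add: comp_assoc)
    next
      case False
      then have "i \<in> I" using that by simp
      from LIMSEQ_subseq_LIMSEQ[OF l[OF this] s(1)] False show ?thesis
        by (simp add: comp_assoc)
    qed
  qed
qed

section \<open>Integral bounds and a zero law for filtrations\<close>

context prob_space
begin

text \<open>Fatou's lemma: the expected lower limit is at most K, so the lower limit is finite
  almost everywhere. In this form a nonnegative supermartingale enters only through its decreasing
  expectations.\<close>

lemma AE_not_tendsto_at_top:
  fixes f :: "nat \<Rightarrow> 'a \<Rightarrow> real"
  assumes meas [measurable]: "\<And>n. f n \<in> borel_measurable M"
    and nonneg: "\<And>n w. w \<in> space M \<Longrightarrow> 0 \<le> f n w"
    and int: "\<And>n. integrable M (f n)"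
    and bound: "\<And>n. n \<ge> N \<Longrightarrow> (\<integral>w. f n w \<partial>M) \<le> K"
  shows "AE w in M. \<not> filterlim (\<lambda>n. f n w) at_top sequentially"
proof -
  have "(\<integral>\<^sup>+w. liminf (\<lambda>n. ennreal (f n w)) \<partial>M) \<le> liminf (\<lambda>n. \<integral>\<^sup>+w. ennreal (f n w) \<partial>M)"
    by (rule nn_integral_liminf) auto
  also have "\<dots> \<le> ennreal K"
  proof (rule Liminf_le)
    show "\<forall>\<^sub>F n in sequentially. (\<integral>\<^sup>+w. ennreal (f n w) \<partial>M) \<le> ennreal K"
      using eventually_ge_at_top[of N]
    proof eventually_elim
      case (elim n)
      have "(\<integral>\<^sup>+w. ennreal (f n w) \<partial>M) = ennreal (\<integral>w. f n w \<partial>M)"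
        by (rule nn_integral_eq_integral[OF int]) (use nonneg in auto)
      then show ?case using bound[OF elim] by (simp add: ennreal_leI)
    qed
  qed simp
  also have "\<dots> < \<infinity>" by simp
  finally have "AE w in M. liminf (\<lambda>n. ennreal (f n w)) \<noteq> \<infinity>"
    by (intro nn_integral_PInf_AE) (auto simp: less_top[symmetric])
  then show ?thesis
  proof eventually_elim
    case (elim w)
    show ?case
    proof
      assume "filterlim (\<lambda>n. f n w) at_top sequentially"
      then have "(\<lambda>n. ennreal (f n w)) \<longlonglongrightarrow> \<infinity>"
        by (simp add: ennreal_tendsto_top_eq_at_top)
      then show False using elim lim_imp_Liminf[OF sequentially_bot, of "\<lambda>n. ennreal (f n w)" \<infinity>] by simp
    qed
  qed
qed

text \<open>Monotone convergence: the bound on the partial sums makes the expectation of the whole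
  series finite.\<close>

lemma summable_AE_of_integral_bounded:
  fixes f :: "nat \<Rightarrow> 'a \<Rightarrow> real"
  assumes meas [measurable]: "\<And>n. f n \<in> borel_measurable M"
    and nonneg: "\<And>n w. w \<in> space M \<Longrightarrow> 0 \<le> f n w"
    and int: "\<And>n. integrable M (f n)"
    and bound: "\<And>n. (\<Sum>k<n. \<integral>w. f k w \<partial>M) \<le> K"
  shows "AE w in M. summable (\<lambda>n. f n w)"
proof -
  have eq: "(\<integral>\<^sup>+w. ennreal (f n w) \<partial>M) = ennreal (\<integral>w. f n w \<partial>M)" for n
    by (rule nn_integral_eq_integral[OF int]) (use nonneg in auto)
  have nn: "0 \<le> (\<integral>w. f n w \<partial>M)" for n
    by (rule integral_nonneg_AE) (use nonneg in auto)
  have "(\<integral>\<^sup>+w. (\<Sum>n. ennreal (f n w)) \<partial>M) = (\<Sum>n. \<integral>\<^sup>+w. ennreal (f n w) \<partial>M)"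
    by (rule nn_integral_suminf) auto
  also have "\<dots> \<le> ennreal K"
    unfolding eq
  proof (rule suminf_le_const)
    show "summable (\<lambda>n. ennreal (\<integral>w. f n w \<partial>M))" by simp
    show "(\<Sum>k<n. ennreal (\<integral>w. f k w \<partial>M)) \<le> ennreal K" for n
      using bound[of n] nn by (subst sum_ennreal) (auto intro: ennreal_leI)
  qed
  also have "\<dots> < \<infinity>" by simp
  finally have "AE w in M. (\<Sum>n. ennreal (f n w)) \<noteq> \<infinity>"
    by (intro nn_integral_PInf_AE) (auto simp: less_top[symmetric])
  then show ?thesis
    using AE_space
  proof eventually_elim
    case (elim w)
    then show ?case using nonneg by (intro summable_suminf_not_top) auto
  qed
qed

text \<open>Approximation in measure by events of the filtration replaces Levy's zero-one law and thereby
  avoids martingale convergence.\<close>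

lemma filtration_approx:
  fixes F :: "nat \<Rightarrow> 'a measure"
  assumes sub: "\<And>n. subalgebra M (F n)"
    and mono: "\<And>n k. n \<le> k \<Longrightarrow> sets (F n) \<subseteq> sets (F k)"
    and B: "B \<in> sigma_sets (space M) (\<Union>n. sets (F n))"
    and e: "e > 0"
  shows "\<exists>n. \<exists>A\<in>sets (F n). prob (A - B) < e \<and> prob (B - A) < e"
proof -
  let ?G = "\<Union>n. sets (F n)"
  have FM: "sets (F n) \<subseteq> sets M" and sp: "space (F n) = space M" for n
    using sub[of n] by (auto simp: subalgebra_def)
  have GM: "?G \<subseteq> events" using FM by auto
  have SM: "sigma_sets (space M) ?G \<subseteq> events" using GM by (rule sets.sigma_sets_subset)
  have "\<forall>e>0. \<exists>n. \<exists>A\<in>sets (F n). prob (A - B) < e \<and> prob (B - A) < e"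
    using B
  proof (induction rule: sigma_sets.induct)
    case (Basic a)
    then obtain n where "a \<in> sets (F n)" by auto
    then show ?case by (auto intro!: exI[of _ n] bexI[of _ a])
  next
    case Empty
    show ?case by (auto intro!: exI[of _ 0] bexI[of _ "{}"])
  next
    case (Compl a)
    show ?case
    proof safe
      fix e :: real assume "e > 0"
      then obtain n A where A: "A \<in> sets (F n)" "prob (A - a) < e" "prob (a - A) < e"
        using Compl.IH by blast
      have "space M - A - (space M - a) = a - A" "space M - a - (space M - A) = A - a"
        using Compl.hyps SM A(1) FM sets.sets_into_space by blast+
      moreover have "space M - A \<in> sets (F n)"
        using A(1) sets.compl_sets[of A "F n"] by (simp add: sp)
      ultimately show "\<exists>n. \<exists>A\<in>sets (F n). prob (A - (space M - a)) < e \<and> prob (space M - a - A) < e"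
        using A by (intro exI[of _ n] bexI[of _ "space M - A"]) auto
    qed
  next
    case (Union a)
    have aM [measurable]: "a i \<in> events" for i using Union.hyps SM by auto
    show ?case
    proof safe
      fix e :: real assume e: "e > 0"
      have lim: "(\<lambda>n. prob (\<Union>i\<le>n. a i)) \<longlonglongrightarrow> prob (\<Union>n. \<Union>i\<le>n. a i)"
        by (intro finite_Lim_measure_incseq) (auto simp: incseq_def intro: order_trans)
      have eqU: "(\<Union>n. \<Union>i\<le>n. a i) = (\<Union>i. a i)" by auto
      have "eventually (\<lambda>n. prob (\<Union>i\<le>n. a i) > prob (\<Union>i. a i) - e / 2) sequentially"
        using lim e unfolding eqU by (intro order_tendstoD(1)) auto
      then obtain n where n: "prob (\<Union>i\<le>n. a i) > prob (\<Union>i. a i) - e / 2"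
        by (auto simp: eventually_sequentially)
      have "prob ((\<Union>i. a i) - (\<Union>i\<le>n. a i)) = prob (\<Union>i. a i) - prob (\<Union>i\<le>n. a i)"
        by (intro finite_measure_Diff) auto
      then have tail: "prob ((\<Union>i. a i) - (\<Union>i\<le>n. a i)) < e / 2" using n by simp
      \<comment> \<open>Half of e pays for the tail of the union; the other half is shared by the n
        + 1 sets that are kept.\<close>
      define d where "d = e / (2 * (real n + 1))"
      have d: "d > 0" using e by (simp add: d_def)
      have "\<forall>i. \<exists>k A. A \<in> sets (F k) \<and> prob (A - a i) < d \<and> prob (a i - A) < d"
        using Union.IH d by blast
      then obtain k A where A: "\<And>i. A i \<in> sets (F (k i))" "\<And>i. prob (A i - a i) < d"
          "\<And>i. prob (a i - A i) < d"
        by metis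
      have AM [measurable]: "A i \<in> events" for i using A(1) FM by blast
      define K where "K = Max (k ` {..n})"
      let ?A = "\<Union>i\<le>n. A i"
      have "A i \<in> sets (F K)" if "i \<le> n" for i
        using A(1)[of i] mono[of "k i" K] that by (auto simp: K_def)
      then have AK: "?A \<in> sets (F K)" by auto
      have sumd: "(\<Sum>i\<le>n. d) = e / 2" using e by (simp add: d_def field_simps)
      have "prob (?A - (\<Union>i. a i)) \<le> prob (\<Union>i\<le>n. A i - a i)"
        by (intro finite_measure_mono) auto
      also have "\<dots> \<le> (\<Sum>i\<le>n. prob (A i - a i))"
        by (intro finite_measure_subadditive_finite) auto
      also have "\<dots> \<le> (\<Sum>i\<le>n. d)" using A by (intro sum_mono less_imp_le)
      finally have 1: "prob (?A - (\<Union>i. a i)) < e" using e sumd by simp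
      have "prob ((\<Union>i\<le>n. a i) - ?A) \<le> prob (\<Union>i\<le>n. a i - A i)"
        by (intro finite_measure_mono) auto
      also have "\<dots> \<le> (\<Sum>i\<le>n. prob (a i - A i))"
        by (intro finite_measure_subadditive_finite) auto
      also have "\<dots> \<le> (\<Sum>i\<le>n. d)" using A by (intro sum_mono less_imp_le)
      finally have 2: "prob ((\<Union>i\<le>n. a i) - ?A) \<le> e / 2" using sumd by simp
      have "prob ((\<Union>i. a i) - ?A) \<le> prob (((\<Union>i. a i) - (\<Union>i\<le>n. a i)) \<union> ((\<Union>i\<le>n. a i) - ?A))"
        by (intro finite_measure_mono) auto
      also have "\<dots> \<le> prob ((\<Union>i. a i) - (\<Union>i\<le>n. a i)) + prob ((\<Union>i\<le>n. a i) - ?A)"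
        by (intro measure_Un_le) auto
      finally have "prob ((\<Union>i. a i) - ?A) < e" using tail 2 by simp
      with 1 AK show "\<exists>n. \<exists>A\<in>sets (F n). prob (A - (\<Union>i. a i)) < e \<and> prob ((\<Union>i. a i) - A) < e"
        by blast
    qed
  qed
  with e show ?thesis by blast
qed

text \<open>A good approximation A of B from the filtration lies almost inside B, whereas
  \<open>cond\<close> puts at least the fraction d of A outside B. Both are possible only if B is
  null.\<close>

lemma filtration_zero_law:
  fixes F :: "nat \<Rightarrow> 'a measure"
  assumes sub: "\<And>n. subalgebra M (F n)"
    and mono: "\<And>n k. n \<le> k \<Longrightarrow> sets (F n) \<subseteq> sets (F k)"
    and B: "B \<in> sigma_sets (space M) (\<Union>n. sets (F n))"
    and d: "d > 0"
    and cond: "\<And>n A. n \<ge> N \<Longrightarrow> A \<in> sets (F n) \<Longrightarrow> prob (A \<inter> B) \<le> (1 - d) * prob A"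
  shows "prob B = 0"
proof (rule ccontr)
  assume "prob B \<noteq> 0"
  then have p: "prob B > 0" by (simp add: less_le)
  \<comment> \<open>The closing estimate is \<open>d * prob B \<le> 2 * e\<close>; with this e the
    right side is half of the left.\<close>
  define e where "e = d * prob B / 4"
  have e: "e > 0" using p d by (simp add: e_def)
  have FM: "sets (F n) \<subseteq> sets M" for n using sub[of n] by (auto simp: subalgebra_def)
  have "sigma_sets (space M) (\<Union>n. sets (F n)) \<subseteq> events"
    using FM by (intro sets.sigma_sets_subset) auto
  then have BM [measurable]: "B \<in> events" using B by auto
  obtain n A where A: "A \<in> sets (F n)" "prob (A - B) < e" "prob (B - A) < e"
    using filtration_approx[OF sub mono B e] by blast
  \<comment> \<open>The hypothesis \<open>cond\<close> starts only at time N, so A is regarded as an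
    event of a later time.\<close>
  have A': "A \<in> sets (F (max n N))" using subsetD[OF mono[of n "max n N", OF max.cobounded1] A(1)] .
  have AM [measurable]: "A \<in> events" using A(1) FM by auto
  have c: "prob (A \<inter> B) \<le> (1 - d) * prob A" using cond[OF _ A'] by simp
  have "prob A = prob (A \<inter> B) + prob (A - B)"
    by (subst finite_measure_Union[symmetric]) (auto intro: arg_cong[where f = prob])
  moreover have "prob B = prob (A \<inter> B) + prob (B - A)"
    by (subst finite_measure_Union[symmetric]) (auto intro: arg_cong[where f = prob])
  ultimately have AB: "prob A \<ge> prob B - e" and AB2: "prob (A \<inter> B) \<ge> prob A - e"
    using A measure_nonneg[of M "A - B"] by linarith+
  have "d * prob A \<le> e" using c AB2 by (simp add: algebra_simps)
  moreover have "d * (prob B - e) \<le> d * prob A" using AB d by simp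
  \<comment> \<open>Applied to the whole space, \<open>cond\<close> shows that d is a genuine
    fraction; hence \<open>d * e \<le> e\<close>.\<close>
  moreover have "d \<le> 1"
  proof (rule ccontr)
    assume "\<not> d \<le> 1"
    have "0 \<le> prob (space M \<inter> B)" by simp
    also have "\<dots> \<le> (1 - d) * prob (space M)"
      using cond[of N "space M"] sub[of N] sets.top[of "F N"] by (simp add: subalgebra_def)
    finally show False using \<open>\<not> d \<le> 1\<close> by (simp add: prob_space)
  qed
  then have "d * e \<le> e" using e by simp
  ultimately have "d * prob B \<le> 2 * e" by (simp add: algebra_simps)
  then show False using p d by (simp add: e_def)
qed

end

section \<open>Power increments, limit sets and the equilibrium equations\<close>

text \<open>Mean value theorem. The derivative \<open>\<alpha> * z powr (\<alpha> - 1)\<close>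
  increases in z for \<alpha> \<ge> 1 and decreases otherwise, so its least value on the interval is
  at one of the two ends; the minimum covers both cases.\<close>

lemma powr_diff_mult_diff_ge:
  fixes l u a b \<alpha> :: real
  assumes l: "0 < l" and \<alpha>: "0 < \<alpha>" and a: "a \<in> {l..u}" and b: "b \<in> {l..u}"
  shows "\<alpha> * min (l powr (\<alpha> - 1)) (u powr (\<alpha> - 1)) * (a - b)\<^sup>2 \<le> (a powr \<alpha> - b powr \<alpha>) * (a - b)"
proof -
  define \<kappa> where "\<kappa> = min (l powr (\<alpha> - 1)) (u powr (\<alpha> - 1))"
  have main: "\<alpha> * \<kappa> * (a - b)\<^sup>2 \<le> (a powr \<alpha> - b powr \<alpha>) * (a - b)"
    if ab: "b < a" and a: "a \<in> {l..u}" and b: "b \<in> {l..u}" for a b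
  proof -
    have "DERIV (\<lambda>t. t powr \<alpha>) x :> \<alpha> * x powr (\<alpha> - 1)" if "b \<le> x" for x
      using has_real_derivative_powr[of x \<alpha>] that b l by simp
    from MVT2[OF ab this] obtain z where z: "b < z" "z < a"
      and eq: "a powr \<alpha> - b powr \<alpha> = (a - b) * (\<alpha> * z powr (\<alpha> - 1))" by blast
    have "\<kappa> \<le> z powr (\<alpha> - 1)"
    proof (cases "1 \<le> \<alpha>")
      case True
      then have "l powr (\<alpha> - 1) \<le> z powr (\<alpha> - 1)" using z b l by (intro powr_mono2) auto
      then show ?thesis by (simp add: \<kappa>_def)
    next
      case False
      then have "u powr (\<alpha> - 1) \<le> z powr (\<alpha> - 1)" using z a b l by (intro powr_mono2') auto
      then show ?thesis by (simp add: \<kappa>_def)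
    qed
    then have "(a - b)\<^sup>2 * \<alpha> * \<kappa> \<le> (a - b)\<^sup>2 * \<alpha> * z powr (\<alpha> - 1)"
      using \<alpha> by (intro mult_left_mono) auto
    then show ?thesis unfolding eq by (simp add: power2_eq_square mult_ac)
  qed
  consider "b < a" | "a < b" | "a = b" by linarith
  then show ?thesis
  proof cases
    case 1
    then show ?thesis using main a b by (simp add: \<kappa>_def)
  next
    case 2
    have "(b powr \<alpha> - a powr \<alpha>) * (b - a) = (a powr \<alpha> - b powr \<alpha>) * (a - b)" by (simp add: algebra_simps)
    then show ?thesis using main[OF 2 b a] by (simp add: \<kappa>_def power2_commute)
  qed simp
qed

text \<open>The sub-subsequence criterion: a subsequence keeping distance e from c would have no
  further subsequence tending to c.\<close>

lemma LIMSEQ_if_subseq: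
  fixes f :: "nat \<Rightarrow> real"
  assumes "\<And>r :: nat \<Rightarrow> nat. strict_mono r \<Longrightarrow> \<exists>s :: nat \<Rightarrow> nat. strict_mono s \<and> (\<lambda>n. f (r (s n))) \<longlonglongrightarrow> c"
  shows "f \<longlonglongrightarrow> c"
proof (rule ccontr)
  assume "\<not> f \<longlonglongrightarrow> c"
  then obtain e where e: "0 < e" "\<And>N. \<exists>n\<ge>N. e \<le> \<bar>f n - c\<bar>"
    unfolding LIMSEQ_def dist_real_def by (auto simp: not_less)
  then have "infinite {n. e \<le> \<bar>f n - c\<bar>}"
    unfolding infinite_nat_iff_unbounded_le by simp
  then obtain r :: "nat \<Rightarrow> nat" where r: "strict_mono r" "\<And>n. e \<le> \<bar>f (r n) - c\<bar>"
    using infinite_enumerate[of "{n. e \<le> \<bar>f n - c\<bar>}"] by auto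
  obtain s where "(\<lambda>n. f (r (s n))) \<longlonglongrightarrow> c" using assms[OF r(1)] by blast
  from LIMSEQ_D[OF this e(1)] obtain N where "\<bar>f (r (s N)) - c\<bar> < e" by auto
  with r(2)[of "s N"] show False by simp
qed

lemma tendsto_function2_iff:
  fixes x :: "nat \<Rightarrow> nat \<Rightarrow> nat \<Rightarrow> real"
  shows "x \<longlonglongrightarrow> l \<longleftrightarrow> (\<forall>i v. (\<lambda>n. x n i v) \<longlonglongrightarrow> l i v)"
proof -
  have 1: "(y \<longlonglongrightarrow> k) \<longleftrightarrow> (\<forall>i. (\<lambda>n. y n i) \<longlonglongrightarrow> k i)"
    for y :: "nat \<Rightarrow> nat \<Rightarrow> 'b::topological_space" and k
    using limitin_componentwise[of "\<lambda>_. euclidean" UNIV y k sequentially]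
    by (simp add: euclidean_product_topology)
  show ?thesis by (subst 1, subst 1) simp
qed

lemma continuous_on_eval2: "continuous_on UNIV (\<lambda>x :: nat \<Rightarrow> nat \<Rightarrow> real. x i v)"
  by (rule continuous_on_product_then_coordinatewise[OF continuous_on_product_then_coordinatewise[OF continuous_on_id]])

lemma limit_set_subset_closed:
  assumes "closed A" and "eventually (\<lambda>n. x n \<in> A) sequentially"
  shows "limit_set x \<subseteq> A"
proof -
  obtain N where "\<And>n. n \<ge> N \<Longrightarrow> x n \<in> A" using assms(2) by (auto simp: eventually_sequentially)
  then have "closure (\<Union>k\<in>{N..}. {x k}) \<subseteq> A" using assms(1) by (intro closure_minimal) auto
  then show ?thesis unfolding limit_set_def by auto
qed

lemma subseq_limit_in_limit_set:
  assumes r: "strict_mono (r :: nat \<Rightarrow> nat)" and lim: "(\<lambda>n. x (r n)) \<longlonglongrightarrow> l"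
  shows "l \<in> limit_set x"
  unfolding limit_set_def
proof safe
  fix n
  show "l \<in> closure (\<Union>k\<in>{n..}. {x k})"
  proof (rule Lim_in_closed_set[OF closed_closure _ sequentially_bot lim])
    show "\<forall>\<^sub>F k in sequentially. x (r k) \<in> closure (\<Union>k\<in>{n..}. {x k})"
      using eventually_ge_at_top[of n]
    proof eventually_elim
      case (elim k)
      then have "n \<le> r k" using seq_suble[OF r, of k] by simp
      then show ?case using closure_subset[of "\<Union>k\<in>{n..}. {x k}"] by auto
    qed
  qed
qed

lemma closed_star_domain: "closed (star_domain m)"
proof -
  have eq: "star_domain m = {x. (\<forall>i v. i \<in> {1..m} \<and> v \<in> star_vertices i \<longrightarrow> 0 \<le> x i v) \<and>
      (\<forall>i. i \<in> {1..m} \<longrightarrow> x i 1 + x i (i + 1) = 1) \<and>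
      (\<forall>i v. \<not> (i \<in> {1..m} \<and> v \<in> star_vertices i) \<longrightarrow> x i v = 0)}"
    unfolding star_domain_def by blast
  have cl_imp: "closed {x. P \<longrightarrow> Q x}" if "closed {x. Q x}" for P and Q :: "(nat \<Rightarrow> nat \<Rightarrow> real) \<Rightarrow> bool"
    using that by (cases P) auto
  show ?thesis
    unfolding eq
    by (intro closed_Collect_conj closed_Collect_all cl_imp closed_Collect_le closed_Collect_eq
        continuous_on_eval2 continuous_on_const continuous_on_add)
qed

text \<open>\<open>star_S1\<close> is cut out of the domain by the equations p i p j = 0. One
  direction uses closed sublevel sets, the other compactness of the domain. The full equivalence
  identifies the event of claim (1) with one that is visibly measurable.\<close>

lemma limit_set_subset_S1_iff:
  assumes dom: "\<And>n. x n \<in> star_domain m" and m: "1 \<le> m"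
  shows "limit_set x \<subseteq> star_S1 m \<longleftrightarrow>
    (\<forall>i\<in>{1..m}. \<forall>j\<in>{1..m}. i \<noteq> j \<longrightarrow> (\<lambda>n. x n i 1 * x n j 1) \<longlonglongrightarrow> 0)"
proof
  assume lim: "\<forall>i\<in>{1..m}. \<forall>j\<in>{1..m}. i \<noteq> j \<longrightarrow> (\<lambda>n. x n i 1 * x n j 1) \<longlonglongrightarrow> 0"
  show "limit_set x \<subseteq> star_S1 m"
  proof
    fix p assume p: "p \<in> limit_set x"
    have pd: "p \<in> star_domain m"
      using limit_set_subset_closed[OF closed_star_domain always_eventually] dom p by blast
    have range: "0 \<le> p i 1" "p i 1 \<le> 1" if "i \<in> {1..m}" for i
    proof -
      have "0 \<le> p i 1" "0 \<le> p i (i + 1)" "p i 1 + p i (i + 1) = 1"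
        using pd that unfolding star_domain_def star_vertices_def by blast+
      then show "0 \<le> p i 1" "p i 1 \<le> 1" by auto
    qed
    have zero: "p i 1 * p j 1 = 0" if ij: "i \<in> {1..m}" "j \<in> {1..m}" "i \<noteq> j" for i j
    proof -
      \<comment> \<open>A closed set containing a tail of the sequence is required: the sublevel set
        at e > 0 is one, the zero set of the product need not be.\<close>
      have "p i 1 * p j 1 \<le> e" if e: "0 < e" for e
      proof -
        have "closed {x :: nat \<Rightarrow> nat \<Rightarrow> real. x i 1 * x j 1 \<le> e}"
          by (intro closed_Collect_le continuous_on_mult continuous_on_eval2 continuous_on_const)
        moreover have "eventually (\<lambda>n. x n \<in> {x. x i 1 * x j 1 \<le> e}) sequentially"
          using order_tendstoD(2)[OF lim[rule_format, OF ij] e] by eventually_elim simp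
        ultimately show ?thesis using limit_set_subset_closed[of "{x. x i 1 * x j 1 \<le> e}" x] p by blast
      qed
      then have "p i 1 * p j 1 \<le> 0" by (rule field_le_epsilon[where y = 0, simplified])
      moreover have "0 \<le> p i 1 * p j 1" using range ij by simp
      ultimately show ?thesis by simp
    qed
    show "p \<in> star_S1 m"
    proof (cases "\<exists>i\<in>{1..m}. p i 1 \<noteq> 0")
      case True
      then obtain i where i: "i \<in> {1..m}" "p i 1 \<noteq> 0" by blast
      then have "\<forall>j\<in>{1..m}. j \<noteq> i \<longrightarrow> p j 1 = 0" using zero by fastforce
      with i range pd show ?thesis unfolding star_S1_def by auto
    next
      case False
      then show ?thesis using m pd unfolding star_S1_def by (auto intro!: bexI[of _ 1])
    qed
  qed
next
  assume sub: "limit_set x \<subseteq> star_S1 m"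
  have range: "0 \<le> x n i 1" "x n i 1 \<le> 1" "x n i (i + 1) = 1 - x n i 1" if "i \<in> {1..m}" for i n
  proof -
    have "0 \<le> x n i 1" "0 \<le> x n i (i + 1)" "x n i 1 + x n i (i + 1) = 1"
      using dom[of n] that unfolding star_domain_def star_vertices_def by blast+
    then show "0 \<le> x n i 1" "x n i 1 \<le> 1" "x n i (i + 1) = 1 - x n i 1" by auto
  qed
  have other: "x n i v = 0" if "\<not> (i \<in> {1..m} \<and> v \<in> star_vertices i)" for n i v
    using dom[of n] that unfolding star_domain_def by blast
  show "\<forall>i\<in>{1..m}. \<forall>j\<in>{1..m}. i \<noteq> j \<longrightarrow> (\<lambda>n. x n i 1 * x n j 1) \<longlonglongrightarrow> 0"
  proof (intro ballI impI LIMSEQ_if_subseq)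
    fix i j and r :: "nat \<Rightarrow> nat" assume ij: "i \<in> {1..m}" "j \<in> {1..m}" "i \<noteq> j" and r: "strict_mono r"
    have "\<exists>s. strict_mono s \<and> (\<exists>l. \<forall>k\<in>{1..m}. ((\<lambda>n. x (r n) k 1) \<circ> s) \<longlonglongrightarrow> l k)"
      by (rule finite_bounded_imp_convergent_subsequence[where a = 0 and b = 1]) (use range in auto)
    then obtain s l where s: "strict_mono s" and l: "\<forall>k\<in>{1..m}. ((\<lambda>n. x (r n) k 1) \<circ> s) \<longlonglongrightarrow> l k"
      by (elim exE conjE) rule
    have l': "(\<lambda>n. x (r (s n)) k 1) \<longlonglongrightarrow> l k" if "k \<in> {1..m}" for k
      using l that by (simp add: o_def)
    \<comment> \<open>The limit of all 2m coordinates, completed by zero as in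
      \<open>star_domain\<close>.\<close>
    define P where "P k v = (if k \<in> {1..m} \<and> v \<in> star_vertices k then if v = 1 then l k else 1 - l k else 0)" for k v
    have "(\<lambda>n. x (r (s n)) k v) \<longlonglongrightarrow> P k v" for k v
    proof (cases "k \<in> {1..m} \<and> v \<in> star_vertices k")
      case True
      then have k: "k \<in> {1..m}" and v: "v = 1 \<or> v = k + 1" by (auto simp: star_vertices_def)
      show ?thesis
      proof (cases "v = 1")
        case False
        then have "v = k + 1" using v by simp
        then show ?thesis using True False tendsto_diff[OF tendsto_const[of 1] l'[OF k]]
          by (simp add: P_def range(3)[OF k, unfolded Suc_eq_plus1[symmetric]])
      qed (use True l'[OF k] in \<open>simp add: P_def\<close>)
    next
      case False
      then show ?thesis using other[OF False] by (simp only: P_def if_False tendsto_const)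
    qed
    then have "(\<lambda>n. x (r (s n))) \<longlonglongrightarrow> P" by (simp add: tendsto_function2_iff)
    then have "P \<in> limit_set x"
      using subseq_limit_in_limit_set[of "r \<circ> s" x P] strict_mono_o[OF r s] by (simp add: o_def)
    then have "P \<in> star_S1 m" using sub by blast
    then obtain k where "\<forall>j\<in>{1..m}. j \<noteq> k \<longrightarrow> P j 1 = 0" unfolding star_S1_def by blast
    then have "P i 1 = 0 \<or> P j 1 = 0" using ij by metis
    then have "l i * l j = 0" using ij by (auto simp: P_def star_vertices_def)
    then show "\<exists>s. strict_mono s \<and> (\<lambda>n. x (r (s n)) i 1 * x (r (s n)) j 1) \<longlonglongrightarrow> 0"
      using s tendsto_mult[OF l'[OF ij(1)] l'[OF ij(2)]] by auto
  qed
qed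

text \<open>Coordinates in (0,1) solve the same linear equation, and 1 - 2 \<epsilon> \<noteq> 0
  makes them equal. Inserting the sum s, with I the set of these coordinates and O' the set of those
  equal to 1, gives l i (|I| + 2 \<epsilon> - 1) = \<epsilon> - |O'|.\<close>

lemma equilibrium_interior:
  fixes l :: "nat \<Rightarrow> real" and \<epsilon> :: real
  assumes \<epsilon>: "0 < \<epsilon>" "\<epsilon> < 1" "\<epsilon> \<noteq> 1 / 2"
    and l: "\<And>i. i \<in> {1..m} \<Longrightarrow> 0 \<le> l i" "\<And>i. i \<in> {1..m} \<Longrightarrow> l i \<le> 1"
    and eq: "\<And>i. i \<in> {1..m} \<Longrightarrow> l i * (1 - l i) * (\<epsilon> - (\<Sum>j\<in>{1..m}. l j) + (1 - 2 * \<epsilon>) * l i)\<^sup>2 = 0"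
    and i: "i \<in> {1..m}" "0 < l i" "l i < 1"
  defines "K \<equiv> {j \<in> {1..m}. l j \<noteq> 0}"
  shows "\<forall>j\<in>K. l j = \<epsilon> / (real (card K) + 2 * \<epsilon> - 1)" and "0 < real (card K) + 2 * \<epsilon> - 1"
    and "(\<Sum>j\<in>{1..m}. l j) = real (card K) * (\<epsilon> / (real (card K) + 2 * \<epsilon> - 1))"
proof -
  define s where "s = (\<Sum>j\<in>{1..m}. l j)"
  define I O' where "I = {j \<in> {1..m}. 0 < l j \<and> l j < 1}" and "O' = {j \<in> {1..m}. l j = 1}"
  have gi: "\<epsilon> - s + (1 - 2 * \<epsilon>) * l j = 0" if "j \<in> I" for j
    using eq[of j] that by (auto simp: I_def s_def)
  have iI: "i \<in> I" using i by (simp add: I_def)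
  have same: "l j = l i" if "j \<in> I" for j
  proof -
    have "(1 - 2 * \<epsilon>) * (l j - l i) = 0" using gi[OF that] gi[OF iI] by (simp add: algebra_simps)
    then show ?thesis using \<epsilon>(3) by simp
  qed
  have fin: "finite I" "finite O'" by (auto simp: I_def O'_def)
  have disj: "I \<inter> O' = {}" by (auto simp: I_def O'_def)
  have KIO: "K = I \<union> O'"
    using l by (force simp: K_def I_def O'_def)
  have "s = (\<Sum>j\<in>I \<union> O'. l j)"
    unfolding s_def KIO[symmetric] by (rule sum.mono_neutral_right) (auto simp: K_def)
  also have "\<dots> = (\<Sum>j\<in>I. l i) + (\<Sum>j\<in>O'. 1)"
    unfolding sum.union_disjoint[OF fin disj] using same by (intro arg_cong2[where f = "(+)"] sum.cong) (auto simp: O'_def)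
  finally have s: "s = real (card I) * l i + real (card O')" by simp
  have "0 < card I" using iI fin by (auto simp: card_gt_0_iff)
  then have "1 \<le> real (card I)" by linarith
  then have pos: "0 < real (card I) + 2 * \<epsilon> - 1" using \<epsilon> by simp
  have prod: "l i * (real (card I) + 2 * \<epsilon> - 1) = \<epsilon> - real (card O')"
    using gi[OF iI] s by (simp add: algebra_simps)
  \<comment> \<open>The left side of \<open>prod\<close> is positive, so |O'| < \<epsilon> < 1: a
    coordinate equal to 1 cannot coexist with one in (0,1).\<close>
  have "0 < l i * (real (card I) + 2 * \<epsilon> - 1)" using i pos by simp
  then have "card O' = 0" using prod \<epsilon> by simp
  then have O: "O' = {}" using fin by simp
  then have KI: "K = I" using KIO by simp
  show "0 < real (card K) + 2 * \<epsilon> - 1" using pos KI by simp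
  have li: "l i = \<epsilon> / (real (card K) + 2 * \<epsilon> - 1)"
    using prod pos O KI by (simp add: field_simps)
  show "\<forall>j\<in>K. l j = \<epsilon> / (real (card K) + 2 * \<epsilon> - 1)"
    using same li KI by simp
  show "(\<Sum>j\<in>{1..m}. l j) = real (card K) * (\<epsilon> / (real (card K) + 2 * \<epsilon> - 1))"
    using s O KI li by (simp add: s_def)
qed

section \<open>Calculus of bounded measurable functions\<close>

text \<open>One predicate serves two purposes: over F n it marks admissible test functions, over M
  it yields integrability. The bound holds everywhere on the space, so it survives the passage from
  a subalgebra to M, and the rules \<open>bm_intros\<close> prove both uses by syntax.\<close>

definition bounded_measurable :: "'a measure \<Rightarrow> ('a \<Rightarrow> real) \<Rightarrow> bool" where
  "bounded_measurable N g \<longleftrightarrow> g \<in> borel_measurable N \<and> (\<exists>K. \<forall>w\<in>space N. \<bar>g w\<bar> \<le> K)"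

named_theorems bm_intros

lemma bounded_measurableI:
  "g \<in> borel_measurable N \<Longrightarrow> (\<And>w. w \<in> space N \<Longrightarrow> \<bar>g w\<bar> \<le> K) \<Longrightarrow> bounded_measurable N g"
  unfolding bounded_measurable_def by blast

lemma bounded_measurableD: "bounded_measurable N g \<Longrightarrow> g \<in> borel_measurable N"
  by (simp add: bounded_measurable_def)

lemma bounded_measurable_const [bm_intros]: "bounded_measurable N (\<lambda>_. c)"
  by (rule bounded_measurableI) auto

lemma bounded_measurable_add [bm_intros]:
  assumes "bounded_measurable N f" "bounded_measurable N g"
  shows "bounded_measurable N (\<lambda>x. f x + g x)"
proof -
  obtain K L where K: "\<forall>x\<in>space N. \<bar>f x\<bar> \<le> K" and L: "\<forall>x\<in>space N. \<bar>g x\<bar> \<le> L"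
    using assms unfolding bounded_measurable_def by blast
  have "\<bar>f x + g x\<bar> \<le> K + L" if "x \<in> space N" for x
    using K[rule_format, OF that] L[rule_format, OF that] by linarith
  then show ?thesis using assms by (intro bounded_measurableI) (auto simp: bounded_measurable_def)
qed

lemma bounded_measurable_uminus [bm_intros]:
  "bounded_measurable N f \<Longrightarrow> bounded_measurable N (\<lambda>x. - f x)"
  by (auto simp: bounded_measurable_def)

lemma bounded_measurable_diff [bm_intros]:
  assumes "bounded_measurable N f" "bounded_measurable N g"
  shows "bounded_measurable N (\<lambda>x. f x - g x)"
  using bounded_measurable_add[OF assms(1) bounded_measurable_uminus[OF assms(2)]] by simp

lemma bounded_measurable_mult [bm_intros]:
  assumes "bounded_measurable N f" "bounded_measurable N g"
  shows "bounded_measurable N (\<lambda>x. f x * g x)"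
proof -
  obtain K L where K: "\<forall>x\<in>space N. \<bar>f x\<bar> \<le> K" and L: "\<forall>x\<in>space N. \<bar>g x\<bar> \<le> L"
    using assms unfolding bounded_measurable_def by blast
  have "\<bar>f x * g x\<bar> \<le> \<bar>K\<bar> * \<bar>L\<bar>" if "x \<in> space N" for x
    using K[rule_format, OF that] L[rule_format, OF that] by (auto simp: abs_mult intro!: mult_mono)
  then show ?thesis using assms by (intro bounded_measurableI) (auto simp: bounded_measurable_def)
qed

lemma bounded_measurable_divide_const [bm_intros]:
  "bounded_measurable N f \<Longrightarrow> bounded_measurable N (\<lambda>x. f x / c)"
  using bounded_measurable_mult[OF _ bounded_measurable_const[of N "1 / c"]] by simp

lemma bounded_measurable_power [bm_intros]:
  "bounded_measurable N f \<Longrightarrow> bounded_measurable N (\<lambda>x. f x ^ k)"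
  by (induction k) (auto intro: bm_intros)

lemma bounded_measurable_sum [bm_intros]:
  "(\<And>i. i \<in> I \<Longrightarrow> bounded_measurable N (f i)) \<Longrightarrow> bounded_measurable N (\<lambda>x. \<Sum>i\<in>I. f i x)"
  by (induction I rule: infinite_finite_induct) (auto intro: bm_intros)

lemma bounded_measurable_indicator [bm_intros]:
  "A \<in> sets N \<Longrightarrow> bounded_measurable N (indicator A)"
  by (rule bounded_measurableI[where K = 1]) (auto simp: indicator_def)

lemma bounded_measurable_subalgebra:
  "subalgebra N F \<Longrightarrow> bounded_measurable F g \<Longrightarrow> bounded_measurable N g"
  unfolding bounded_measurable_def using measurable_from_subalg by (auto simp: subalgebra_def)

lemma (in finite_measure) bounded_measurable_integrable:
  "bounded_measurable M g \<Longrightarrow> integrable M g"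
  unfolding bounded_measurable_def by (auto intro!: integrable_const_bound AE_I2)

text \<open>Each term is at most \<open>1 / ((real j + 2) * (real j + 3))\<close>, which
  telescopes.\<close>

lemma sum_inverse_squares_le:
  assumes "n \<le> k"
  shows "(\<Sum>j\<in>{n..<k}. 1 / (real j + 3)\<^sup>2) \<le> 1 / (real n + 2) - 1 / (real k + 2)"
  using assms
proof (induction k rule: dec_induct)
  case base
  show ?case by simp
next
  case (step k)
  have "1 / (real k + 3)\<^sup>2 \<le> 1 / ((real k + 2) * (real k + 3))"
    by (intro divide_left_mono) (auto simp: power2_eq_square intro!: mult_right_mono)
  also have "\<dots> = 1 / (real k + 2) - 1 / (real (Suc k) + 2)"
    by (simp add: field_simps)
  finally have "1 / (real k + 3)\<^sup>2 \<le> 1 / (real k + 2) - 1 / (real (Suc k) + 2)" .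
  with step show ?case by (simp add: sum.atLeastLessThan_Suc)
qed

text \<open>All quantifiers on the right range over the naturals, which makes the measurability of
  convergence events automatic.\<close>

lemma tendsto_0_iff_nat:
  fixes x :: "nat \<Rightarrow> real"
  shows "x \<longlonglongrightarrow> 0 \<longleftrightarrow> (\<forall>j::nat. \<exists>n0. \<forall>n\<ge>n0. \<bar>x n\<bar> < 1 / real (Suc j))"
proof
  assume "x \<longlonglongrightarrow> 0"
  then show "\<forall>j::nat. \<exists>n0. \<forall>n\<ge>n0. \<bar>x n\<bar> < 1 / real (Suc j)"
    by (simp add: LIMSEQ_def dist_real_def)
next
  assume *: "\<forall>j::nat. \<exists>n0. \<forall>n\<ge>n0. \<bar>x n\<bar> < 1 / real (Suc j)"
  show "x \<longlonglongrightarrow> 0"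
    unfolding LIMSEQ_def dist_real_def
  proof safe
    fix e :: real assume "e > 0"
    then obtain j where j: "1 / real (Suc j) < e" by (rule nat_approx_posE)
    from * obtain n0 where "\<forall>n\<ge>n0. \<bar>x n\<bar> < 1 / real (Suc j)" by blast
    then show "\<exists>n0. \<forall>n\<ge>n0. \<bar>x n - 0\<bar> < e" using j by fastforce
  qed
qed

subsection \<open>Repulsion from an unstable direction\<close>

text \<open>Dividing the outward-drifting coordinate D by the running product of its growth factors
  turns it into a martingale as long as the process stays in the good region; the square Q of the
  quotient is continued artificially, by its variance proxy r, after the first exit. The tail of the
  martingale has comparable second and fourth moments, so by a Paley--Zygmund argument
  it fails, with probability bounded below, to cancel the current position.\<close>

locale repelling_noise = prob_space M
  for M :: "'a measure" +
  fixes F :: "nat \<Rightarrow> 'a measure" and D lam e :: "nat \<Rightarrow> 'a \<Rightarrow> real" and G :: "nat \<Rightarrow> 'a set"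
    and N :: nat and c \<Lambda> :: real
  assumes F_sub: "\<And>n. subalgebra M (F n)"
    and F_mono: "\<And>n k. n \<le> k \<Longrightarrow> sets (F n) \<subseteq> sets (F k)"
    and D_meas: "\<And>n. D n \<in> borel_measurable (F n)"
    and D_bound: "\<And>n w. w \<in> space M \<Longrightarrow> \<bar>D n w\<bar> \<le> 1"
    and lam_meas: "\<And>n. lam n \<in> borel_measurable (F n)"
    and lam_nonneg: "\<And>n w. w \<in> space M \<Longrightarrow> 0 \<le> lam n w"
    and lam_le: "\<And>n w. w \<in> space M \<Longrightarrow> lam n w \<le> \<Lambda>"
    and e_meas: "\<And>n. e n \<in> borel_measurable M"
    and e_bound: "\<And>n w. w \<in> space M \<Longrightarrow> \<bar>e n w\<bar> \<le> 2"
    and G_meas: "\<And>n. G n \<in> sets (F n)"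
    and step: "\<And>n w. N \<le> n \<Longrightarrow> w \<in> G n \<Longrightarrow>
        D (Suc n) w = D n w * (1 + lam n w / (real n + 3)) + e n w / (real n + 3)"
    and mean: "\<And>n g. N \<le> n \<Longrightarrow> bounded_measurable (F n) g \<Longrightarrow>
        (\<integral>w. g w * indicator (G n) w * e n w \<partial>M) = 0"
    and var: "\<And>n g. N \<le> n \<Longrightarrow> bounded_measurable (F n) g \<Longrightarrow> (\<And>w. w \<in> space M \<Longrightarrow> 0 \<le> g w) \<Longrightarrow>
        c * (\<integral>w. g w * indicator (G n) w \<partial>M) \<le> (\<integral>w. g w * indicator (G n) w * (e n w)\<^sup>2 \<partial>M)"
    and c_pos: "0 < c"
begin

lemma space_F [simp]: "space (F n) = space M"
  using F_sub[of n] by (simp add: subalgebra_def)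

lemma F_subset: "sets (F n) \<subseteq> sets M"
  using F_sub[of n] by (simp add: subalgebra_def)

lemma F_subalg: "n \<le> k \<Longrightarrow> subalgebra (F k) (F n)"
  using F_mono[of n k] by (simp add: subalgebra_def)

lemma bm_M: "bounded_measurable (F n) g \<Longrightarrow> bounded_measurable M g"
  by (rule bounded_measurable_subalgebra[OF F_sub])

lemma bm_F: "n \<le> k \<Longrightarrow> bounded_measurable (F n) g \<Longrightarrow> bounded_measurable (F k) g"
  by (rule bounded_measurable_subalgebra[OF F_subalg])

definition growth :: "nat \<Rightarrow> 'a \<Rightarrow> real" where
  "growth n w = (\<Prod>k<n. 1 + lam k w / (real k + 3))"

text \<open>Before N the range is empty and the set is the whole space. Time n is included, which
  still leaves the set in F n.\<close>

definition stay :: "nat \<Rightarrow> 'a set" where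
  "stay n = {w \<in> space M. \<forall>k\<in>{N..n}. w \<in> G k}"

text \<open>Where \<open>step\<close> applies, the quotient \<open>D / growth\<close> moves by
  \<open>e n w / ((real n + 3) * growth (Suc n) w)\<close>, whose square is
  \<open>(e n w)\<^sup>2 * r n w\<close>.\<close>

definition r :: "nat \<Rightarrow> 'a \<Rightarrow> real" where
  "r n w = 1 / ((real n + 3)\<^sup>2 * (growth (Suc n) w)\<^sup>2)"

text \<open>A stopped square would remain constant after the exit and lose the lower bound on its
  first moment. Letting Q grow by r instead makes the moment bounds valid on the whole space,
  without stopping times.\<close>

fun Q :: "nat \<Rightarrow> 'a \<Rightarrow> real" where
  "Q 0 w = (D 0 w)\<^sup>2"
| "Q (Suc n) w = (if w \<in> stay n then (D (Suc n) w / growth (Suc n) w)\<^sup>2 else Q n w + r n w)"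

lemma growth_ge_1: "w \<in> space M \<Longrightarrow> 1 \<le> growth n w"
  unfolding growth_def using lam_nonneg by (intro prod_ge_1) auto

lemma growth_Suc: "growth (Suc n) w = growth n w * (1 + lam n w / (real n + 3))"
  by (simp add: growth_def)

lemma growth_mono:
  assumes "w \<in> space M" "n \<le> k"
  shows "growth n w \<le> growth k w"
  using assms(2)
proof (induction k rule: dec_induct)
  case (step k)
  have "growth k w * 1 \<le> growth k w * (1 + lam k w / (real k + 3))"
    using growth_ge_1[OF assms(1), of k] lam_nonneg[OF assms(1), of k] by (intro mult_left_mono) auto
  with step show ?case by (simp add: growth_Suc)
qed simp

text \<open>Over a block of n + 3 steps starting at n the growth gains at most the factor exp
  \<Lambda>, so the noise of that block is not damped away.\<close>

lemma growth_upper: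
  assumes "w \<in> space M"
  shows "growth (n + i) w \<le> growth n w * exp (real i * \<Lambda> / (real n + 3))"
proof (induction i)
  case (Suc i)
  have L: "0 \<le> \<Lambda>" using lam_nonneg[OF assms, of 0] lam_le[OF assms, of 0] by simp
  have "lam (n + i) w / (real (n + i) + 3) \<le> \<Lambda> / (real n + 3)"
    using lam_le[OF assms, of "n + i"] L by (intro frac_le) auto
  also have "1 + \<dots> \<le> exp (\<Lambda> / (real n + 3))" by (rule exp_ge_add_one_self)
  finally have le: "1 + lam (n + i) w / (real (n + i) + 3) \<le> exp (\<Lambda> / (real n + 3))" by simp
  have "growth (n + Suc i) w = growth (n + i) w * (1 + lam (n + i) w / (real (n + i) + 3))"
    by (simp add: growth_Suc)
  also have "\<dots> \<le> (growth n w * exp (real i * \<Lambda> / (real n + 3))) * exp (\<Lambda> / (real n + 3))"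
    using Suc.IH le growth_ge_1[OF assms, of n] lam_nonneg[OF assms, of "n + i"]
    by (intro mult_mono) auto
  also have "\<dots> = growth n w * exp (real (Suc i) * \<Lambda> / (real n + 3))"
    by (simp add: exp_add[symmetric] add_divide_distrib[symmetric] algebra_simps)
  finally show ?case .
qed simp

lemma bm_D: "bounded_measurable (F n) (D n)"
  using D_meas D_bound by (intro bounded_measurableI[where K = 1]) auto

lemma bm_lam: "bounded_measurable (F n) (lam n)"
  using lam_meas lam_nonneg lam_le by (intro bounded_measurableI[where K = \<Lambda>]) (auto simp: abs_of_nonneg)

lemma bm_e: "bounded_measurable M (e n)"
  using e_meas e_bound by (intro bounded_measurableI[where K = 2]) auto

text \<open>Previsibility: \<open>growth (Suc n)\<close> involves \<open>lam\<close> only up to time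
  n. Hence it may be part of the test function in \<open>mean\<close> and \<open>var\<close> at time
  n.\<close>

lemma bm_growth: "bounded_measurable (F n) (growth (Suc n))"
proof (induction n)
  case 0
  show ?case unfolding growth_def by (auto intro!: bm_intros bm_lam)
next
  case (Suc n)
  show ?case
    unfolding growth_Suc[of "Suc n", abs_def]
    by (intro bm_intros bm_lam bm_F[OF _ Suc.IH]) simp
qed

lemma bm_growth': "bounded_measurable (F n) (growth n)"
proof (cases n)
  case 0
  then show ?thesis by (simp add: growth_def[abs_def] bm_intros)
next
  case (Suc k)
  then show ?thesis using bm_F[OF _ bm_growth[of k], of n] by simp
qed

lemma bm_inverse_growth: "bounded_measurable (F n) (\<lambda>w. 1 / growth (Suc n) w)"
proof (rule bounded_measurableI[where K = 1])
  show "(\<lambda>w. 1 / growth (Suc n) w) \<in> borel_measurable (F n)"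
    using bounded_measurableD[OF bm_growth] by measurable
  show "\<bar>1 / growth (Suc n) w\<bar> \<le> 1" if "w \<in> space (F n)" for w
    using growth_ge_1[of w "Suc n"] that by (simp add: field_simps)
qed

lemma bm_inverse_growth': "bounded_measurable (F n) (\<lambda>w. 1 / growth n w)"
proof (rule bounded_measurableI[where K = 1])
  show "(\<lambda>w. 1 / growth n w) \<in> borel_measurable (F n)"
    using bounded_measurableD[OF bm_growth'] by measurable
  show "\<bar>1 / growth n w\<bar> \<le> 1" if "w \<in> space (F n)" for w
    using growth_ge_1[of w n] that by (simp add: field_simps)
qed

lemma r_eq: "r n w = (1 / growth (Suc n) w)\<^sup>2 / (real n + 3)\<^sup>2"
  by (simp add: r_def power_divide)

lemma bm_r: "bounded_measurable (F n) (r n)"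
  unfolding r_eq[abs_def] by (intro bm_intros bm_inverse_growth)

lemma r_pos: "w \<in> space M \<Longrightarrow> 0 < r n w"
  using growth_ge_1[of w "Suc n"] by (simp add: r_def)

lemma stay_sets: "stay n \<in> sets (F n)"
proof -
  have "stay n = space (F n) \<inter> (\<Inter>k\<in>{N..n}. G k \<inter> space (F n))"
    by (auto simp: stay_def)
  also have "\<dots> \<in> sets (F n)"
  proof (cases "{N..n} = {}")
    case False
    have "G k \<in> sets (F n)" if "k \<le> n" for k using G_meas F_mono[OF that] by auto
    then show ?thesis using False by (intro sets.Int sets.finite_INT sets.top) auto
  qed (use sets.top[of "F n"] in auto)
  finally show ?thesis .
qed

lemma stay_antimono: "n \<le> k \<Longrightarrow> stay k \<subseteq> stay n"
  by (auto simp: stay_def)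

lemma Q_stay: "w \<in> stay n \<Longrightarrow> Q n w = (D n w / growth n w)\<^sup>2"
proof (cases n)
  case (Suc k)
  assume "w \<in> stay n"
  then have "w \<in> stay k" using stay_antimono[of k n] Suc by auto
  then show ?thesis using Suc by simp
qed (simp add: growth_def)

lemma Q_nonneg: "w \<in> space M \<Longrightarrow> 0 \<le> Q n w"
  using r_pos by (induction n) (auto intro: add_nonneg_nonneg less_imp_le)

lemma bm_Q: "bounded_measurable (F n) (Q n)"
proof (induction n)
  case 0
  show ?case by (auto intro!: bm_intros bm_D)
next
  case (Suc n)
  have eq: "Q (Suc n) w = indicator (stay n) w * (D (Suc n) w * (1 / growth (Suc n) w))\<^sup>2 +
      (1 - indicator (stay n) w) * (Q n w + r n w)" for w
    by (auto simp: indicator_def)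
  have st: "stay n \<in> sets (F (Suc n))" using stay_sets[of n] F_mono[of n "Suc n"] by auto
  show ?case
    unfolding eq[abs_def]
    by (intro bm_intros st bm_D bm_F[OF _ Suc.IH] bm_F[OF _ bm_r] bm_F[OF _ bm_inverse_growth]) auto
qed

text \<open>The factor \<open>1 + lam n w / (real n + 3)\<close> cancels against the growth, so the
  quotient z moves by the pure noise y. The constant 4 is the square of the bound 2 on e.\<close>

lemma Q_step:
  assumes n: "N \<le> n" and w: "w \<in> stay n"
  defines "z \<equiv> D n w / growth n w" and "y \<equiv> e n w * (1 / growth (Suc n) w) / (real n + 3)"
  shows "Q n w = z\<^sup>2" "Q (Suc n) w = (z + y)\<^sup>2" "y\<^sup>2 = (e n w)\<^sup>2 * r n w" "y\<^sup>2 \<le> 4 * r n w"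
proof -
  have sp: "w \<in> space M" and G: "w \<in> G n" using w n by (auto simp: stay_def)
  show "Q n w = z\<^sup>2" using Q_stay[OF w] by (simp add: z_def)
  have l: "1 + lam n w / (real n + 3) > 0"
    using lam_nonneg[OF sp, of n] by (intro add_pos_nonneg) auto
  have g: "growth n w > 0" "growth (Suc n) w > 0"
    using growth_ge_1[OF sp, of n] growth_ge_1[OF sp, of "Suc n"] by linarith+
  have "D (Suc n) w / growth (Suc n) w
      = D n w * (1 + lam n w / (real n + 3)) / growth (Suc n) w + y"
    by (simp add: step[OF n G] add_divide_distrib y_def)
  also have "D n w * (1 + lam n w / (real n + 3)) / growth (Suc n) w = z"
    using l g by (simp add: growth_Suc z_def)
  finally show "Q (Suc n) w = (z + y)\<^sup>2" using w by simp
  show y2: "y\<^sup>2 = (e n w)\<^sup>2 * r n w"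
    by (simp add: y_def r_def power_mult_distrib power_divide)
  have "(e n w)\<^sup>2 \<le> 4" using e_bound[OF sp, of n] abs_le_square_iff[of "e n w" 2] by simp
  then show "y\<^sup>2 \<le> 4 * r n w"
    unfolding y2 using r_pos[OF sp, of n] by (intro mult_right_mono) auto
qed

text \<open>The odd cross terms vanish in expectation: k = 1 occurs in the increment of Q, k = 3 in
  that of its square.\<close>

lemma martingale_part:
  assumes n: "N \<le> n" and g: "bounded_measurable (F n) g"
  shows "(\<integral>w. g w * (indicator (stay n) w * (D n w / growth n w) ^ k *
      (e n w * (1 / growth (Suc n) w) / (real n + 3))) \<partial>M) = 0"
proof -
  have "(\<integral>w. (g w * indicator (stay n) w * (D n w * (1 / growth n w)) ^ k * ((1 / growth (Suc n) w) / (real n + 3)))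
      * indicator (G n) w * e n w \<partial>M) = 0"
    by (intro mean[OF n] bm_intros g bm_D bm_inverse_growth' bm_inverse_growth stay_sets)
  moreover have "(g w * indicator (stay n) w * (D n w * (1 / growth n w)) ^ k * ((1 / growth (Suc n) w) / (real n + 3)))
      * indicator (G n) w * e n w = g w * (indicator (stay n) w * (D n w / growth n w) ^ k *
      (e n w * (1 / growth (Suc n) w) / (real n + 3)))" for w
    using n by (auto simp: indicator_def stay_def)
  ultimately show ?thesis by (simp only:)
qed

section \<open>Moment bounds for the squared martingale\<close>

text \<open>On \<open>stay n\<close> the expected increment of Q is at least c times r by
  \<open>var\<close>; off \<open>stay n\<close> it is exactly r. Hence the factor
  \<open>min c 1\<close>.\<close>

lemma first_moment_lower:
  assumes n: "N \<le> n" and g: "bounded_measurable (F n) g" and g0: "\<And>w. w \<in> space M \<Longrightarrow> 0 \<le> g w"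
  shows "(\<integral>w. g w * Q n w \<partial>M) + min c 1 * (\<integral>w. g w * r n w \<partial>M) \<le> (\<integral>w. g w * Q (Suc n) w \<partial>M)"
proof -
  let ?I = "indicator (stay n) :: 'a \<Rightarrow> real"
  let ?z = "\<lambda>w. D n w / growth n w" and ?y = "\<lambda>w. e n w * (1 / growth (Suc n) w) / (real n + 3)"
  note st = bounded_measurable_indicator[OF stay_sets]
  have gM: "bounded_measurable M g" and rM: "bounded_measurable M (r n)" and QM: "bounded_measurable M (Q n)"
    and IM: "bounded_measurable M ?I"
    using bm_M g bm_r bm_Q st by blast+
  have QSM: "bounded_measurable M (Q (Suc n))" using bm_M bm_Q by blast
  have Q_eq: "Q (Suc n) w = Q n w + 2 * (?I w * ?z w ^ 1 * ?y w) + (?I w * (e n w)\<^sup>2 * r n w + (1 - ?I w) * r n w)"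
    if "w \<in> space M" for w
  proof (cases "w \<in> stay n")
    case True
    show ?thesis
      using Q_step(1,2,3)[OF n True] True by (simp add: power2_sum)
  qed auto
  have int: "bounded_measurable M (\<lambda>w. g w * (?I w * (e n w)\<^sup>2 * r n w))"
    "bounded_measurable M (\<lambda>w. g w * ((1 - ?I w) * r n w))"
    by (intro bm_intros gM IM bm_e rM)+
  \<comment> \<open>Solving for the cross term expresses its vanishing integral through four bounded
    functions.\<close>
  have eq0: "g w * (?I w * ?z w ^ 1 * ?y w) = (g w * Q (Suc n) w - g w * Q n w
      - g w * (?I w * (e n w)\<^sup>2 * r n w) - g w * ((1 - ?I w) * r n w)) / 2"
    if "w \<in> space M" for w
  proof -
    have "x * t = (x * q' - x * q - x * a - x * b) / 2" if "q' = q + 2 * t + (a + b)" for x t q q' a b :: real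
      unfolding that by (simp add: algebra_simps)
    from this[OF Q_eq[OF that]] show ?thesis .
  qed
  have "0 = (\<integral>w. g w * (?I w * ?z w ^ 1 * ?y w) \<partial>M)"
    by (rule martingale_part[OF n g, symmetric])
  also have "\<dots> = (\<integral>w. (g w * Q (Suc n) w - g w * Q n w
      - g w * (?I w * (e n w)\<^sup>2 * r n w) - g w * ((1 - ?I w) * r n w)) / 2 \<partial>M)"
    by (rule Bochner_Integration.integral_cong[OF refl eq0])
  also have "\<dots> = ((\<integral>w. g w * Q (Suc n) w \<partial>M) - (\<integral>w. g w * Q n w \<partial>M)
      - (\<integral>w. g w * (?I w * (e n w)\<^sup>2 * r n w) \<partial>M) - (\<integral>w. g w * ((1 - ?I w) * r n w) \<partial>M)) / 2"
    by (simp add: bounded_measurable_integrable int bm_intros gM QSM QM Bochner_Integration.integral_diff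
        del: Q.simps)
  finally have eq: "(\<integral>w. g w * Q (Suc n) w \<partial>M) = (\<integral>w. g w * Q n w \<partial>M)
      + (\<integral>w. g w * (?I w * (e n w)\<^sup>2 * r n w) \<partial>M) + (\<integral>w. g w * ((1 - ?I w) * r n w) \<partial>M)"
    by simp
  have "c * (\<integral>w. (g w * ?I w * r n w) * indicator (G n) w \<partial>M)
      \<le> (\<integral>w. (g w * ?I w * r n w) * indicator (G n) w * (e n w)\<^sup>2 \<partial>M)"
    using g0 r_pos by (intro var n bm_intros g st bm_r mult_nonneg_nonneg) (auto intro: less_imp_le)
  also have "(\<integral>w. (g w * ?I w * r n w) * indicator (G n) w * (e n w)\<^sup>2 \<partial>M)
      = (\<integral>w. g w * (?I w * (e n w)\<^sup>2 * r n w) \<partial>M)"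
    using n by (intro Bochner_Integration.integral_cong) (auto simp: indicator_def stay_def)
  also have "(\<integral>w. (g w * ?I w * r n w) * indicator (G n) w \<partial>M) = (\<integral>w. g w * ?I w * r n w \<partial>M)"
    using n by (intro Bochner_Integration.integral_cong) (auto simp: indicator_def stay_def)
  finally have v: "c * (\<integral>w. g w * ?I w * r n w \<partial>M) \<le> (\<integral>w. g w * (?I w * (e n w)\<^sup>2 * r n w) \<partial>M)" .
  have nn: "0 \<le> (\<integral>w. g w * ?I w * r n w \<partial>M)" "0 \<le> (\<integral>w. g w * ((1 - ?I w) * r n w) \<partial>M)"
    using g0 r_pos by (auto intro!: integral_nonneg_AE AE_I2 simp: indicator_def less_imp_le)
  have "(\<integral>w. g w * r n w \<partial>M) = (\<integral>w. g w * ?I w * r n w + g w * ((1 - ?I w) * r n w) \<partial>M)"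
    by (intro Bochner_Integration.integral_cong) (auto simp: algebra_simps)
  also have "\<dots> = (\<integral>w. g w * ?I w * r n w \<partial>M) + (\<integral>w. g w * ((1 - ?I w) * r n w) \<partial>M)"
    by (intro Bochner_Integration.integral_add bounded_measurable_integrable bm_intros gM IM rM)
  finally have "min c 1 * (\<integral>w. g w * r n w \<partial>M)
      = min c 1 * (\<integral>w. g w * ?I w * r n w \<partial>M) + min c 1 * (\<integral>w. g w * ((1 - ?I w) * r n w) \<partial>M)"
    by (simp add: distrib_left)
  also have "\<dots> \<le> c * (\<integral>w. g w * ?I w * r n w \<partial>M) + 1 * (\<integral>w. g w * ((1 - ?I w) * r n w) \<partial>M)"
    using nn by (intro add_mono mult_right_mono) auto
  finally show ?thesis using eq v by linarith
qed

lemma moment_upper: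
  assumes n: "N \<le> n" and g: "bounded_measurable (F n) g" and g0: "\<And>w. w \<in> space M \<Longrightarrow> 0 \<le> g w"
  shows "(\<integral>w. g w * Q (Suc n) w \<partial>M) \<le> (\<integral>w. g w * Q n w \<partial>M) + 4 * (\<integral>w. g w * r n w \<partial>M)"
    and "(\<integral>w. g w * (Q (Suc n) w)\<^sup>2 \<partial>M) \<le> (\<integral>w. g w * (Q n w)\<^sup>2 \<partial>M)
        + 32 * (\<integral>w. g w * (Q n w * r n w) \<partial>M) + 48 * (\<integral>w. g w * (r n w)\<^sup>2 \<partial>M)"
proof -
  let ?I = "indicator (stay n) :: 'a \<Rightarrow> real"
  let ?z = "\<lambda>w. D n w / growth n w" and ?y = "\<lambda>w. e n w * (1 / growth (Suc n) w) / (real n + 3)"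
  note st = bounded_measurable_indicator[OF stay_sets]
  have gM: "bounded_measurable M g" and rM: "bounded_measurable M (r n)" and QM: "bounded_measurable M (Q n)"
    using bm_M g bm_r bm_Q by blast+
  have QSM: "bounded_measurable M (Q (Suc n))" using bm_M bm_Q by blast
  have zM: "bounded_measurable M (\<lambda>w. ?I w * ?z w ^ k * ?y w)" for k
  proof -
    have "bounded_measurable M (\<lambda>w. ?I w * (D n w * (1 / growth n w)) ^ k * ?y w)"
      by (intro bm_intros bm_M[OF st] bm_M[OF bm_inverse_growth'] bm_M[OF bm_D] bm_e bm_M[OF bm_inverse_growth])
    then show ?thesis by simp
  qed
  note b = gM rM QM QSM zM
  have p1: "g w * Q (Suc n) w \<le> g w * Q n w + 2 * (g w * (?I w * ?z w ^ 1 * ?y w)) + 4 * (g w * r n w)"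
    if sp: "w \<in> space M" for w
  proof -
    have "Q (Suc n) w \<le> Q n w + 2 * (?I w * ?z w ^ 1 * ?y w) + 4 * r n w"
    proof (cases "w \<in> stay n")
      case True
      show ?thesis
        using Q_step(1,2,4)[OF n True] True by (simp add: power2_sum)
    qed (use r_pos[OF sp, of n] in simp)
    from mult_left_mono[OF this g0[OF sp]] show ?thesis by (simp add: algebra_simps)
  qed
  have "(\<integral>w. g w * Q (Suc n) w \<partial>M) \<le> (\<integral>w. g w * Q n w + 2 * (g w * (?I w * ?z w ^ 1 * ?y w)) + 4 * (g w * r n w) \<partial>M)"
    by (intro integral_mono bounded_measurable_integrable bm_intros b p1)
  also have "\<dots> = (\<integral>w. g w * Q n w \<partial>M) + 2 * (\<integral>w. g w * (?I w * ?z w ^ 1 * ?y w) \<partial>M) + 4 * (\<integral>w. g w * r n w \<partial>M)"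
    by (simp only: Bochner_Integration.integral_add integral_mult_right_zero bounded_measurable_integrable bm_intros b)
  also have "(\<integral>w. g w * (?I w * ?z w ^ 1 * ?y w) \<partial>M) = 0"
    by (rule martingale_part[OF n g])
  finally show "(\<integral>w. g w * Q (Suc n) w \<partial>M) \<le> (\<integral>w. g w * Q n w \<partial>M) + 4 * (\<integral>w. g w * r n w \<partial>M)" by simp
  have p2: "g w * (Q (Suc n) w)\<^sup>2 \<le> g w * (Q n w)\<^sup>2 + 4 * (g w * (?I w * ?z w ^ 3 * ?y w))
      + 32 * (g w * (Q n w * r n w)) + 48 * (g w * (r n w)\<^sup>2)"
    if sp: "w \<in> space M" for w
  proof -
    have "(Q (Suc n) w)\<^sup>2 \<le> (Q n w)\<^sup>2 + 4 * (?I w * ?z w ^ 3 * ?y w) + 32 * (Q n w * r n w) + 48 * (r n w)\<^sup>2"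
    proof (cases "w \<in> stay n")
      case True
      define z y where "z = ?z w" and "y = ?y w"
      have rr: "r n w > 0" using r_pos[OF sp] .
      have y: "y\<^sup>2 \<le> 4 * r n w" and Qz: "Q n w = z\<^sup>2" "Q (Suc n) w = (z + y)\<^sup>2"
        using Q_step[OF n True] by (auto simp: z_def y_def)
      have "2 * (z * y) \<le> z\<^sup>2 + y\<^sup>2" using sum_squares_bound[of z y] by (simp add: mult.assoc)
      then have "2 * (z * y) * (2 * y\<^sup>2) \<le> (z\<^sup>2 + y\<^sup>2) * (2 * y\<^sup>2)" by (intro mult_right_mono) auto
      then have a: "4 * (z * y ^ 3) \<le> 2 * (z\<^sup>2 * y\<^sup>2) + 2 * (y\<^sup>2)\<^sup>2"
        by (simp add: algebra_simps power2_eq_square power3_eq_cube)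
      have "((z + y)\<^sup>2)\<^sup>2 = (z\<^sup>2)\<^sup>2 + 4 * (z ^ 3 * y) + 6 * (z\<^sup>2 * y\<^sup>2) + 4 * (z * y ^ 3) + (y\<^sup>2)\<^sup>2"
        by (simp add: algebra_simps power2_eq_square power3_eq_cube)
      also have "\<dots> \<le> (z\<^sup>2)\<^sup>2 + 4 * (z ^ 3 * y) + 8 * (z\<^sup>2 * y\<^sup>2) + 3 * (y\<^sup>2)\<^sup>2"
        using a by linarith
      also have "z\<^sup>2 * y\<^sup>2 \<le> z\<^sup>2 * (4 * r n w)" using y by (intro mult_left_mono) auto
      also have "(y\<^sup>2)\<^sup>2 \<le> (4 * r n w)\<^sup>2" using y by (intro power_mono) auto
      finally have "((z + y)\<^sup>2)\<^sup>2 \<le> (z\<^sup>2)\<^sup>2 + 4 * (z ^ 3 * y) + 8 * (z\<^sup>2 * (4 * r n w)) + 3 * (4 * r n w)\<^sup>2"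
        by simp
      then show ?thesis using True Qz unfolding z_def[symmetric] y_def[symmetric]
        by (simp add: power_mult_distrib del: Q.simps)
    next
      case False
      then show ?thesis using r_pos[OF sp, of n] Q_nonneg[OF sp, of n]
        by (simp add: power2_sum)
    qed
    from mult_left_mono[OF this g0[OF sp]] show ?thesis by (simp only: algebra_simps)
  qed
  have "(\<integral>w. g w * (Q (Suc n) w)\<^sup>2 \<partial>M) \<le> (\<integral>w. g w * (Q n w)\<^sup>2 + 4 * (g w * (?I w * ?z w ^ 3 * ?y w))
      + 32 * (g w * (Q n w * r n w)) + 48 * (g w * (r n w)\<^sup>2) \<partial>M)"
    by (intro integral_mono bounded_measurable_integrable bm_intros b p2)
  also have "\<dots> = (\<integral>w. g w * (Q n w)\<^sup>2 \<partial>M) + 4 * (\<integral>w. g w * (?I w * ?z w ^ 3 * ?y w) \<partial>M)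
      + 32 * (\<integral>w. g w * (Q n w * r n w) \<partial>M) + 48 * (\<integral>w. g w * (r n w)\<^sup>2 \<partial>M)"
    by (simp only: Bochner_Integration.integral_add integral_mult_right_zero bounded_measurable_integrable bm_intros b)
  also have "(\<integral>w. g w * (?I w * ?z w ^ 3 * ?y w) \<partial>M) = 0"
    by (rule martingale_part[OF n g])
  finally show "(\<integral>w. g w * (Q (Suc n) w)\<^sup>2 \<partial>M) \<le> (\<integral>w. g w * (Q n w)\<^sup>2 \<partial>M)
        + 32 * (\<integral>w. g w * (Q n w * r n w) \<partial>M) + 48 * (\<integral>w. g w * (r n w)\<^sup>2 \<partial>M)" by simp
qed

text \<open>The scale of all noise still to come: sums of r from n onwards are at most
  \<open>2 * \<rho> n\<close> and, over a long enough range, at least a constant times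
  \<open>\<rho> n\<close>.\<close>

definition \<rho> :: "nat \<Rightarrow> 'a \<Rightarrow> real" where
  "\<rho> n w = 1 / ((real n + 3) * (growth n w)\<^sup>2)"

lemma \<rho>_pos: "w \<in> space M \<Longrightarrow> 0 < \<rho> n w"
  using growth_ge_1[of w n] by (simp add: \<rho>_def)

lemma r_le:
  assumes "w \<in> space M" "n \<le> k"
  shows "r k w \<le> \<rho> n w * ((real n + 3) / (real k + 3)\<^sup>2)"
proof -
  have "(growth n w)\<^sup>2 \<le> (growth (Suc k) w)\<^sup>2"
    using growth_mono[OF assms(1), of n "Suc k"] growth_ge_1[OF assms(1), of n] assms(2)
    by (intro power_mono) auto
  then have "r k w \<le> 1 / ((real k + 3)\<^sup>2 * (growth n w)\<^sup>2)"
    unfolding r_def using growth_ge_1[OF assms(1), of n]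
    by (intro divide_left_mono mult_left_mono mult_pos_pos) auto
  then show ?thesis by (simp add: \<rho>_def mult.commute)
qed

text \<open>The n + 3 terms with n \<le> j < 2n + 3 suffice: there \<open>real j + 3\<close> at most
  doubles and the growth gains at most exp \<Lambda>, which costs the factors 4 and exp (2
  \<Lambda>).\<close>

lemma sum_r_ge:
  assumes sp: "w \<in> space M" and k: "2 * n + 3 \<le> k"
  shows "exp (- 2 * \<Lambda>) / 4 * \<rho> n w \<le> (\<Sum>j\<in>{n..<k}. r j w)"
proof -
  have L: "0 \<le> \<Lambda>" using lam_nonneg[OF sp, of 0] lam_le[OF sp, of 0] by simp
  have g: "growth n w > 0" using growth_ge_1[OF sp, of n] by simp
  have ge: "1 / ((2 * real n + 6)\<^sup>2 * (growth n w * exp \<Lambda>)\<^sup>2) \<le> r j w" if j: "j \<in> {n..<2 * n + 3}" for j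
  proof -
    have "growth (Suc j) w = growth (n + (Suc j - n)) w" using j by simp
    also have "\<dots> \<le> growth n w * exp (real (Suc j - n) * \<Lambda> / (real n + 3))"
      by (rule growth_upper[OF sp])
    also have "\<dots> \<le> growth n w * exp \<Lambda>"
    proof (intro mult_left_mono)
      have "real (Suc j - n) * \<Lambda> \<le> (real n + 3) * \<Lambda>" using j L by (intro mult_right_mono) auto
      then show "exp (real (Suc j - n) * \<Lambda> / (real n + 3)) \<le> exp \<Lambda>" by (simp add: field_simps)
    qed (use g in simp)
    finally have "growth (Suc j) w \<le> growth n w * exp \<Lambda>" .
    moreover have "growth (Suc j) w > 0" using growth_ge_1[OF sp, of "Suc j"] by linarith
    moreover have "real j + 3 \<le> 2 * real n + 6" using j by auto
    ultimately show ?thesis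
      unfolding r_def using g
      by (intro divide_left_mono mult_mono power_mono mult_pos_pos) auto
  qed
  have "exp (- 2 * \<Lambda>) / 4 * \<rho> n w = (real n + 3) * (1 / ((2 * real n + 6)\<^sup>2 * (growth n w * exp \<Lambda>)\<^sup>2))"
  proof -
    have "(2 * real n + 6)\<^sup>2 = 4 * (real n + 3) * (real n + 3)"
      by (simp add: power2_eq_square algebra_simps)
    moreover have "exp (- 2 * \<Lambda>) = 1 / (exp \<Lambda>)\<^sup>2"
      by (simp add: exp_minus exp_double inverse_eq_divide)
    ultimately show ?thesis
      using g by (simp add: \<rho>_def power_mult_distrib)
  qed
  also have "\<dots> = (\<Sum>j\<in>{n..<2 * n + 3}. 1 / ((2 * real n + 6)\<^sup>2 * (growth n w * exp \<Lambda>)\<^sup>2))"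
    by simp
  also have "\<dots> \<le> (\<Sum>j\<in>{n..<2 * n + 3}. r j w)" by (intro sum_mono ge)
  also have "\<dots> \<le> (\<Sum>j\<in>{n..<k}. r j w)"
    using k r_pos[OF sp] by (intro sum_mono2) (auto intro: less_imp_le)
  finally show ?thesis .
qed

lemma sum_s_le:
  assumes "n \<le> k"
  shows "(\<Sum>j\<in>{n..<k}. (real n + 3) / (real j + 3)\<^sup>2) \<le> 2"
proof -
  have "(\<Sum>j\<in>{n..<k}. (real n + 3) / (real j + 3)\<^sup>2) = (real n + 3) * (\<Sum>j\<in>{n..<k}. 1 / (real j + 3)\<^sup>2)"
    by (simp add: sum_distrib_left)
  also have "\<dots> \<le> (real n + 3) * (1 / (real n + 2) - 1 / (real k + 2))"
    by (intro mult_left_mono sum_inverse_squares_le assms) auto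
  also have "\<dots> \<le> (real n + 3) * (1 / (real n + 2))"
    by (intro mult_left_mono) auto
  also have "\<dots> \<le> 2" by (simp add: field_simps)
  finally show ?thesis .
qed

text \<open>At a fixed time the growth is bounded, so \<open>\<rho> n\<close> stays away from 0. The
  bound may depend on n since it serves integrability at time n.\<close>

lemma bm_weight: "bounded_measurable (F n) (\<lambda>w. 1 / (Q n w + \<rho> n w))"
proof (rule bounded_measurableI[where K = "(real n + 3) * (exp (real n * \<Lambda> / 3))\<^sup>2"])
  note [measurable] = bounded_measurableD[OF bm_growth'] bounded_measurableD[OF bm_Q]
  show "(\<lambda>w. 1 / (Q n w + \<rho> n w)) \<in> borel_measurable (F n)"
    unfolding \<rho>_def by measurable
  fix w assume "w \<in> space (F n)"
  then have sp: "w \<in> space M" by simp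
  have p: "0 < \<rho> n w" "0 \<le> Q n w" using \<rho>_pos[OF sp] Q_nonneg[OF sp] by auto
  have "growth n w \<le> exp (real n * \<Lambda> / 3)"
    using growth_upper[OF sp, of 0 n] by (simp add: growth_def)
  then have "(growth n w)\<^sup>2 \<le> (exp (real n * \<Lambda> / 3))\<^sup>2"
    using growth_ge_1[OF sp, of n] by (intro power_mono) auto
  then have "1 / \<rho> n w \<le> (real n + 3) * (exp (real n * \<Lambda> / 3))\<^sup>2"
    by (simp add: \<rho>_def)
  moreover have "1 / (Q n w + \<rho> n w) \<le> 1 / \<rho> n w"
    using p by (intro divide_left_mono mult_pos_pos) auto
  ultimately show "\<bar>1 / (Q n w + \<rho> n w)\<bar> \<le> (real n + 3) * (exp (real n * \<Lambda> / 3))\<^sup>2"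
    using p by simp
qed

section \<open>Escape with positive conditional probability\<close>

text \<open>Both parts of the normaliser \<open>Q n + \<rho> n\<close> have to be recovered from the
  first moment of \<open>Q k\<close>: the first with factor 1, the second through
  \<open>min c 1\<close> and \<open>sum_r_ge\<close>.\<close>

definition escape :: real where "escape = min 1 (min c 1 * exp (- 2 * \<Lambda>) / 4)"

lemma escape_pos: "0 < escape"
  using c_pos by (simp add: escape_def)

text \<open>Paley--Zygmund for \<open>Q k / (Q n + \<rho> n)\<close> on A. Dividing by the current
  square plus the future noise makes the bounds independent of the position: the first moment is at
  least \<open>escape * prob A\<close>, the second at most \<open>673 * prob A\<close>. The
  requirement on k provides a full block for \<open>sum_r_ge\<close>, and 2692 = 4 * 673.\<close>

lemma away_prob:
  assumes n: "N \<le> n" and A: "A \<in> sets (F n)" and k: "2 * n + 3 \<le> k"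
  shows "escape\<^sup>2 / 2692 * prob A
    \<le> prob (A \<inter> {w \<in> space M. escape / 2 < 1 / (Q n w + \<rho> n w) * Q k w})"
proof -
  define u where "u w = indicator A w * (1 / (Q n w + \<rho> n w))" for w
  define v where "v w = indicator A w * (1 / (Q n w + \<rho> n w))\<^sup>2" for w
  define s where "s j = (real n + 3) / (real j + 3)\<^sup>2" for j
  have AM: "A \<in> events" using A F_subset by blast
  have IA: "(\<integral>w. indicator A w \<partial>M) = prob A" using AM by simp
  have wF: "bounded_measurable (F n) u" "bounded_measurable (F n) v"
    unfolding u_def v_def by (intro bm_intros A bm_weight)+
  have p: "0 < \<rho> n w" "0 \<le> Q n w" if "w \<in> space M" for w
    using \<rho>_pos[OF that] Q_nonneg[OF that] by auto
  have w0: "0 \<le> u w" "0 \<le> v w" if "w \<in> space M" for w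
    using p[OF that] by (auto simp: u_def v_def indicator_def)
  have wj: "bounded_measurable (F j) u" "bounded_measurable (F j) v" if "n \<le> j" for j
    using bm_F[OF that] wF by blast+
  note wM = bm_M[OF wF(1)] bm_M[OF wF(2)]
  note b = wM bm_M[OF bm_r] bm_M[OF bm_Q] bounded_measurable_indicator[OF AM]
  note int = bounded_measurable_integrable
  have s0: "0 \<le> s j" for j by (simp add: s_def)
  have s1: "s j \<le> 1" if "n \<le> j" for j
  proof -
    have "(real n + 3) * 1 \<le> (real j + 3) * (real j + 3)" using that by (intro mult_mono) auto
    then show ?thesis by (simp add: s_def power2_eq_square)
  qed
  have wQ: "u w * Q n w \<le> indicator A w" "u w * \<rho> n w \<le> indicator A w"
    "u w * (Q n w + \<rho> n w) = indicator A w" if "w \<in> space M" for w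
    using p[OF that] by (auto simp: u_def indicator_def)
  have wr: "u w * r j w \<le> s j * indicator A w" if "w \<in> space M" "n \<le> j" for w j
  proof -
    have "u w * r j w \<le> u w * (\<rho> n w * s j)"
      using r_le[OF that] w0[OF that(1)] unfolding s_def by (intro mult_left_mono) auto
    also have "\<dots> = s j * (u w * \<rho> n w)" by simp
    also have "\<dots> \<le> s j * indicator A w"
      using wQ(2)[OF that(1)] s0 by (intro mult_left_mono) auto
    finally show ?thesis .
  qed
  have vw: "v w * x = u w * (1 / (Q n w + \<rho> n w) * x)" for w x
    by (simp add: v_def u_def power2_eq_square)
  have vw2: "v w = u w * u w" for w
    by (simp add: v_def u_def power2_eq_square indicator_def)

  have lower: "(\<integral>w. u w * Q n w \<partial>M) + min c 1 * (\<Sum>i\<in>{n..<j}. \<integral>w. u w * r i w \<partial>M) \<le> (\<integral>w. u w * Q j w \<partial>M)"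
    if "n \<le> j" for j
    using that
  proof (induction j rule: dec_induct)
    case (step j)
    have "N \<le> j" using n step.hyps by simp
    from first_moment_lower[OF this wj(1) w0(1)] step show ?case
      by (simp add: sum.atLeastLessThan_Suc distrib_left)
  qed simp
  have upper1: "(\<integral>w. u w * Q j w \<partial>M) \<le> prob A + 4 * (\<Sum>i\<in>{n..<j}. s i) * prob A" if "n \<le> j" for j
    using that
  proof (induction j rule: dec_induct)
    case base
    have "(\<integral>w. u w * Q n w \<partial>M) \<le> (\<integral>w. indicator A w \<partial>M)"
      by (intro integral_mono int bm_intros b wQ)
    then show ?case by (simp add: IA sets.Int_space_eq2[OF AM])
  next
    case (step j)
    have "N \<le> j" using n step.hyps by simp
    have "(\<integral>w. u w * r j w \<partial>M) \<le> (\<integral>w. s j * indicator A w \<partial>M)"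
      using step.hyps by (intro integral_mono int bm_intros b wr) auto
    also have "\<dots> = s j * prob A" using AM by simp
    finally have "(\<integral>w. u w * r j w \<partial>M) \<le> s j * prob A" .
    with moment_upper(1)[OF \<open>N \<le> j\<close> wj(1) w0(1)] step show ?case
      by (simp add: sum.atLeastLessThan_Suc algebra_simps)
  qed
  \<comment> \<open>9 = 1 + 4 * 2, the 2 being the bound of \<open>sum_s_le\<close>.\<close>
  have upper1': "(\<integral>w. u w * Q j w \<partial>M) \<le> 9 * prob A" if "n \<le> j" for j
  proof -
    have "4 * (\<Sum>i\<in>{n..<j}. s i) * prob A \<le> 4 * 2 * prob A"
      using sum_s_le[OF that] unfolding s_def by (intro mult_right_mono mult_left_mono) auto
    with upper1[OF that] show ?thesis by linarith
  qed
  \<comment> \<open>336 = 32 * 9 + 48 from \<open>moment_upper\<close> and \<open>upper1'\<close>;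
    summation then gives 673 = 1 + 336 * 2.\<close>
  have upper2: "(\<integral>w. v w * (Q j w)\<^sup>2 \<partial>M) \<le> prob A + 336 * (\<Sum>i\<in>{n..<j}. s i) * prob A" if "n \<le> j" for j
    using that
  proof (induction j rule: dec_induct)
    case base
    have "v w * (Q n w)\<^sup>2 \<le> indicator A w" if "w \<in> space M" for w
    proof -
      have "v w * (Q n w)\<^sup>2 = (u w * Q n w) * (u w * Q n w)" by (simp add: vw2 power2_eq_square)
      also have "\<dots> \<le> indicator A w * indicator A w"
        using wQ(1)[OF that] w0(1)[OF that] p[OF that] by (intro mult_mono) auto
      finally show ?thesis by (cases "w \<in> A") auto
    qed
    then have "(\<integral>w. v w * (Q n w)\<^sup>2 \<partial>M) \<le> (\<integral>w. indicator A w \<partial>M)"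
      by (intro integral_mono int bm_intros b)
    then show ?case by (simp add: IA sets.Int_space_eq2[OF AM])
  next
    case (step j)
    have Nj: "N \<le> j" using n step.hyps by simp
    have "v w * (Q j w * r j w) \<le> s j * (u w * Q j w)" if "w \<in> space M" for w
    proof -
      have "v w * (Q j w * r j w) = (u w * Q j w) * (u w * r j w)" by (simp add: vw2)
      also have "\<dots> \<le> (u w * Q j w) * (s j * indicator A w)"
        using wr[OF that] step.hyps w0[OF that] Q_nonneg[OF that] by (intro mult_left_mono) auto
      also have "\<dots> = s j * (u w * Q j w)" by (simp add: u_def indicator_def)
      finally show ?thesis .
    qed
    then have "(\<integral>w. v w * (Q j w * r j w) \<partial>M) \<le> (\<integral>w. s j * (u w * Q j w) \<partial>M)"
      by (intro integral_mono int bm_intros b)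
    also have "\<dots> = s j * (\<integral>w. u w * Q j w \<partial>M)" by simp
    also have "\<dots> \<le> s j * (9 * prob A)"
      using step.hyps s0 by (intro mult_left_mono upper1') auto
    finally have 1: "(\<integral>w. v w * (Q j w * r j w) \<partial>M) \<le> s j * (9 * prob A)" .
    have "v w * (r j w)\<^sup>2 \<le> s j * indicator A w" if "w \<in> space M" for w
    proof -
      have "v w * (r j w)\<^sup>2 = (u w * r j w) * (u w * r j w)" by (simp add: vw2 power2_eq_square)
      also have "\<dots> \<le> (s j * indicator A w) * (s j * indicator A w)"
        using wr[OF that step.hyps(1)] w0[OF that] r_pos[OF that, of j] s0[of j]
        by (intro mult_mono[of "u w * r j w" _ "u w * r j w"] mult_nonneg_nonneg)
           (auto intro: less_imp_le)
      also have "\<dots> \<le> (s j * indicator A w) * 1"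
        using s1[of j] s0[of j] step.hyps by (intro mult_left_mono) (auto simp: indicator_def)
      finally show ?thesis by simp
    qed
    then have "(\<integral>w. v w * (r j w)\<^sup>2 \<partial>M) \<le> (\<integral>w. s j * indicator A w \<partial>M)"
      by (intro integral_mono int bm_intros b)
    also have "\<dots> = s j * prob A" using AM by simp
    finally have 2: "(\<integral>w. v w * (r j w)\<^sup>2 \<partial>M) \<le> s j * prob A" .
    from moment_upper(2)[OF Nj wj(2) w0(2)] 1 2 step show ?case
      by (simp add: sum.atLeastLessThan_Suc algebra_simps)
  qed
  have nk: "n \<le> k" using k by simp
  have "336 * (\<Sum>i\<in>{n..<k}. s i) * prob A \<le> 336 * 2 * prob A"
    using sum_s_le[OF nk] unfolding s_def by (intro mult_right_mono mult_left_mono) auto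
  with upper2[OF nk] have second: "(\<integral>w. v w * (Q k w)\<^sup>2 \<partial>M) \<le> 673 * prob A" by linarith

  have "escape * indicator A w \<le> u w * Q n w + min c 1 * (\<Sum>j\<in>{n..<k}. u w * r j w)"
    if sp: "w \<in> space M" for w
  proof -
    have "escape * indicator A w = u w * (escape * Q n w + escape * \<rho> n w)"
      unfolding wQ(3)[OF sp, symmetric] by (simp add: algebra_simps)
    also have "escape * Q n w \<le> 1 * Q n w"
      using p[OF sp] by (intro mult_right_mono) (auto simp: escape_def)
    also have "escape * \<rho> n w \<le> min c 1 * exp (- 2 * \<Lambda>) / 4 * \<rho> n w"
      using p[OF sp] by (intro mult_right_mono) (auto simp: escape_def)
    also have "\<dots> = min c 1 * (exp (- 2 * \<Lambda>) / 4 * \<rho> n w)" by simp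
    also have "\<dots> \<le> min c 1 * (\<Sum>j\<in>{n..<k}. r j w)"
      using c_pos by (intro mult_left_mono sum_r_ge sp k) auto
    finally have "escape * indicator A w \<le> u w * (1 * Q n w + min c 1 * (\<Sum>j\<in>{n..<k}. r j w))"
      using w0[OF sp] by (simp add: mult_left_mono)
    then show ?thesis by (simp add: distrib_left sum_distrib_left mult.left_commute)
  qed
  then have "(\<integral>w. escape * indicator A w \<partial>M) \<le> (\<integral>w. u w * Q n w + min c 1 * (\<Sum>j\<in>{n..<k}. u w * r j w) \<partial>M)"
    by (intro integral_mono int bm_intros b)
  also have "\<dots> = (\<integral>w. u w * Q n w \<partial>M) + min c 1 * (\<Sum>i\<in>{n..<k}. \<integral>w. u w * r i w \<partial>M)"
    by (simp add: Bochner_Integration.integral_add Bochner_Integration.integral_sum int bm_intros b)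
  also have "\<dots> \<le> (\<integral>w. u w * Q k w \<partial>M)" by (rule lower[OF nk])
  finally have first: "escape * prob A \<le> (\<integral>w. u w * Q k w \<partial>M)" using AM by simp

  let ?E = "A \<inter> {w \<in> space M. escape / 2 < 1 / (Q n w + \<rho> n w) * Q k w}"
  have EM: "?E \<in> events"
  proof -
    note [measurable] = AM bounded_measurableD[OF bm_M[OF bm_Q]] bounded_measurableD[OF bm_M[OF bm_weight]]
    show ?thesis by measurable
  qed
  have pt: "u w * Q k w \<le> escape / 2 * indicator A w + escape / 2692 * (v w * (Q k w)\<^sup>2) + 673 / escape * indicator ?E w"
    if sp: "w \<in> space M" for w
  proof (cases "w \<in> ?E")
    case True
    have "0 \<le> (escape / 2692) * (u w * Q k w - 1346 / escape)\<^sup>2"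
      using escape_pos by simp
    also have "\<dots> = escape / 2692 * (v w * (Q k w)\<^sup>2) - u w * Q k w + 673 / escape"
      using escape_pos by (simp add: vw2 power2_eq_square field_simps)
    finally show ?thesis using True escape_pos by simp
  next
    case False
    have "u w * Q k w \<le> escape / 2 * indicator A w"
      using False sp by (auto simp: u_def indicator_def)
    moreover have "0 \<le> escape / 2692 * (v w * (Q k w)\<^sup>2)" using escape_pos w0[OF sp] by simp
    ultimately show ?thesis using False by simp
  qed
  have "(\<integral>w. u w * Q k w \<partial>M) \<le>
      (\<integral>w. escape / 2 * indicator A w + escape / 2692 * (v w * (Q k w)\<^sup>2) + 673 / escape * indicator ?E w \<partial>M)"
    by (intro integral_mono int bm_intros b pt EM)
  also have "\<dots> = escape / 2 * prob A + escape / 2692 * (\<integral>w. v w * (Q k w)\<^sup>2 \<partial>M) + 673 / escape * prob ?E"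
  proof -
    have IE: "(\<integral>w. indicator ?E w \<partial>M) = prob ?E" using EM by simp
    have bE: "bounded_measurable M (indicator ?E)" by (intro bm_intros EM)
    show ?thesis
      by (simp only: Bochner_Integration.integral_add integral_mult_right_zero int bm_intros b bE IA IE)
  qed
  also have "escape / 2692 * (\<integral>w. v w * (Q k w)\<^sup>2 \<partial>M) \<le> escape / 2692 * (673 * prob A)"
    using escape_pos by (intro mult_left_mono second) auto
  finally have "escape * prob A \<le> escape / 2 * prob A + escape / 4 * prob A + 673 / escape * prob ?E"
    using first by linarith
  then have "escape / 4 * prob A \<le> 673 / escape * prob ?E" by linarith
  then have "(escape / 673) * (escape / 4 * prob A) \<le> (escape / 673) * (673 / escape * prob ?E)"
    using escape_pos by (intro mult_left_mono) auto
  also have "(escape / 673) * (673 / escape * prob ?E) = prob ?E" using escape_pos by simp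
  finally show ?thesis by (simp add: power2_eq_square)
qed

theorem repelled:
  "AE w in M. \<not> ((\<forall>n\<ge>N. w \<in> G n) \<and> (\<lambda>n. D n w) \<longlonglongrightarrow> 0)"
proof -
  define B where "B = {w \<in> space M. (\<forall>n\<ge>N. w \<in> G n) \<and> (\<lambda>n. D n w) \<longlonglongrightarrow> 0}"
  define d where "d = escape\<^sup>2 / 2692"
  have d: "d > 0" using escape_pos by (simp add: d_def)
  let ?S = "sigma (space M) (\<Union>n. sets (F n))"
  have Fpow: "(\<Union>n. sets (F n)) \<subseteq> Pow (space M)"
    using sets.space_closed[of "F _"] by auto
  have subS: "subalgebra ?S (F n)" for n
    using Fpow by (auto simp: subalgebra_def sets_measure_of)
  have B_sig: "B \<in> sigma_sets (space M) (\<Union>n. sets (F n))"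
  proof -
    have [measurable]: "D n \<in> borel_measurable ?S" "G n \<in> sets ?S" for n
      using measurable_from_subalg[OF subS D_meas, of n] G_meas[of n] subS[of n]
      by (auto simp: subalgebra_def)
    have eq: "B = {w \<in> space ?S. (\<forall>n\<ge>N. w \<in> G n) \<and> (\<forall>j::nat. \<exists>n0. \<forall>n\<ge>n0. \<bar>D n w\<bar> < 1 / real (Suc j))}"
      unfolding B_def tendsto_0_iff_nat by (simp add: space_measure_of Fpow)
    have "B \<in> sets ?S" unfolding eq by measurable
    then show ?thesis by (simp add: sets_measure_of Fpow)
  qed
  have "prob B = 0"
  proof (rule filtration_zero_law[OF F_sub F_mono B_sig d, of N])
    fix n A assume n: "N \<le> n" and A: "A \<in> sets (F n)"
    have "sigma_sets (space M) (\<Union>n. sets (F n)) \<subseteq> events"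
      using F_subset by (intro sets.sigma_sets_subset) auto
    then have BM [measurable]: "B \<in> events" using B_sig by auto
    have AM [measurable]: "A \<in> events" using A F_subset by blast
    note [measurable] = bounded_measurableD[OF bm_M[OF bm_Q]] bounded_measurableD[OF bm_M[OF bm_weight]]
    define E where "E k = A \<inter> {w \<in> space M. escape / 2 < 1 / (Q n w + \<rho> n w) * Q k w}" for k
    have EM [measurable]: "E k \<in> events" for k unfolding E_def by measurable
    \<comment> \<open>The part of A and B on which Q is large at some time from k on. It decreases
      to the empty set, so in the limit the escaping fraction lies outside B.\<close>
    define T where "T k = A \<inter> B \<inter> (\<Union>j\<in>{k..}. E j)" for k
    have TM [measurable]: "T k \<in> events" for k unfolding T_def by measurable
    have "(\<lambda>k. prob (T k)) \<longlonglongrightarrow> prob (\<Inter>k. T k)"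
      by (intro finite_Lim_measure_decseq) (auto simp: T_def decseq_def intro: order_trans)
    also have "(\<Inter>k. T k) = {}"
    proof safe
      fix w assume T: "w \<in> (\<Inter>k. T k)"
      then have B: "w \<in> B" by (auto simp: T_def)
      then have sp: "w \<in> space M" and st: "\<And>k. w \<in> stay k" and D0: "(\<lambda>k. D k w) \<longlonglongrightarrow> 0"
        by (auto simp: B_def stay_def)
      have "(\<lambda>k. Q k w) \<longlonglongrightarrow> 0"
      proof (rule Lim_null_comparison)
        show "(\<lambda>k. (D k w)\<^sup>2) \<longlonglongrightarrow> 0" using tendsto_power[OF D0, of 2] by simp
        show "\<forall>\<^sub>F k in sequentially. norm (Q k w) \<le> (D k w)\<^sup>2"
        proof (intro always_eventually allI)
          fix k
          have g: "1 \<le> growth k w" by (rule growth_ge_1[OF sp])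
          then have "(D k w)\<^sup>2 / (growth k w)\<^sup>2 \<le> (D k w)\<^sup>2 / 1"
            by (intro divide_left_mono) auto
          then show "norm (Q k w) \<le> (D k w)\<^sup>2" using Q_stay[OF st] by (simp add: power_divide)
        qed
      qed
      from tendsto_mult[OF tendsto_const[of "1 / (Q n w + \<rho> n w)"] this]
      have "(\<lambda>k. 1 / (Q n w + \<rho> n w) * Q k w) \<longlonglongrightarrow> 0" by simp
      from order_tendstoD(2)[OF this, of "escape / 2"] escape_pos obtain k
        where k: "\<And>j. j \<ge> k \<Longrightarrow> 1 / (Q n w + \<rho> n w) * Q j w < escape / 2"
        by (auto simp: eventually_sequentially)
      from T have "w \<in> T k" by auto
      then show "w \<in> {}" using k by (force simp: T_def E_def)
    qed
    finally have T0: "(\<lambda>k. prob (T k)) \<longlonglongrightarrow> 0" by simp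
    have "d * prob A \<le> prob (A - B) + prob (T k)" if k: "2 * n + 3 \<le> k" for k
    proof -
      have "d * prob A \<le> prob (E k)"
        unfolding d_def E_def by (rule away_prob[OF n A k])
      also have "\<dots> \<le> prob ((A - B) \<union> T k)"
      proof (intro finite_measure_mono)
        show "E k \<subseteq> A - B \<union> T k" by (auto simp: T_def) (auto simp: E_def)
      qed auto
      also have "\<dots> \<le> prob (A - B) + prob (T k)" by (intro measure_Un_le) auto
      finally show ?thesis .
    qed
    then have "eventually (\<lambda>k. d * prob A \<le> prob (A - B) + prob (T k)) sequentially"
      unfolding eventually_sequentially by blast
    from tendsto_lowerbound[OF tendsto_add[OF tendsto_const T0] this]
    have "d * prob A \<le> prob (A - B)" by simp
    moreover have "prob A = prob (A \<inter> B) + prob (A - B)"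
      by (subst finite_measure_Union[symmetric]) (auto intro: arg_cong[where f = prob])
    ultimately show "prob (A \<inter> B) \<le> (1 - d) * prob A" by (simp add: algebra_simps)
  qed
  moreover have "B \<in> events"
  proof -
    have "sigma_sets (space M) (\<Union>n. sets (F n)) \<subseteq> events"
      using F_subset by (intro sets.sigma_sets_subset) auto
    then show ?thesis using B_sig by auto
  qed
  ultimately have "AE w in M. w \<notin> B"
    by (intro AE_not_in) (simp add: null_sets_def emeasure_eq_measure)
  then show ?thesis
    using AE_space by eventually_elim (auto simp: B_def)
qed

end

subsection \<open>Transition probabilities of the star walks\<close>

locale star_system = star_walks M m \<alpha> \<epsilon> \<eta> W
  for M :: "'a measure" and m :: nat and \<alpha> \<epsilon> \<eta> :: real and W :: "nat \<Rightarrow> nat \<Rightarrow> 'a \<Rightarrow> nat" +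
  assumes two_le_m: "2 \<le> m" and alpha_pos: "0 < \<alpha>" and eps_nonneg: "0 \<le> \<epsilon>"
    and eta_gt: "real m - 1 + \<epsilon> < \<eta>"
begin

abbreviation F :: "nat \<Rightarrow> 'a measure" where "F n \<equiv> star_history M m W n"
abbreviation X :: "nat \<Rightarrow> 'a \<Rightarrow> nat \<Rightarrow> nat \<Rightarrow> real" where "X n w \<equiv> star_occupation m W n w"
abbreviation tp :: "nat \<Rightarrow> 'a \<Rightarrow> nat \<Rightarrow> nat \<Rightarrow> real" where
  "tp n w i v \<equiv> star_pi m \<alpha> \<epsilon> \<eta> (X n w) i v"
abbreviation visit :: "nat \<Rightarrow> nat \<Rightarrow> nat \<Rightarrow> 'a set" where
  "visit i n v \<equiv> {w \<in> space M. W i (n + 1) w = v}"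

lemma space_F [simp]: "space (F n) = space M"
  using subalgebra_star_history[of n] by (simp add: subalgebra_def)

lemma sets_F: "sets (F n) = sigma_sets (space M)
    {W i k -` A \<inter> space M | i k A. i \<in> {1..m} \<and> k \<in> {1..n} \<and> A \<subseteq> star_vertices i}"
  unfolding star_history_def by (rule sets_measure_of) auto

lemma F_mono: "n \<le> k \<Longrightarrow> sets (F n) \<subseteq> sets (F k)"
  unfolding sets_F
proof (rule sigma_sets_mono', rule subsetI)
  fix B assume "n \<le> k"
    and "B \<in> {W i j -` A \<inter> space M | i j A. i \<in> {1..m} \<and> j \<in> {1..n} \<and> A \<subseteq> star_vertices i}"
  then obtain i j A where "B = W i j -` A \<inter> space M" "i \<in> {1..m}" "j \<in> {1..k}" "A \<subseteq> star_vertices i"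
    by auto
  then show "B \<in> {W i j -` A \<inter> space M | i j A. i \<in> {1..m} \<and> j \<in> {1..k} \<and> A \<subseteq> star_vertices i}"
    by blast
qed

lemma F_subalg: "n \<le> k \<Longrightarrow> subalgebra (F k) (F n)"
  using F_mono[of n k] by (simp add: subalgebra_def)

lemma bm_M: "bounded_measurable (F n) g \<Longrightarrow> bounded_measurable M g"
  by (rule bounded_measurable_subalgebra[OF subalgebra_star_history])

lemma visit_sets:
  assumes "i \<in> {1..m}" "v \<in> star_vertices i"
  shows "visit i n v \<in> sets (F (Suc n))"
proof -
  have "visit i n v = W i (Suc n) -` {v} \<inter> space M" by auto
  moreover have "Suc n \<in> {1..Suc n}" "{v} \<subseteq> star_vertices i" using assms by auto
  ultimately show ?thesis
    using assms(1) unfolding sets_F by (intro sigma_sets.Basic) blast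
qed

lemma visit_events: "i \<in> {1..m} \<Longrightarrow> v \<in> star_vertices i \<Longrightarrow> visit i n v \<in> events"
  using visit_sets[of i v n] subalgebra_star_history[of "Suc n"] by (auto simp: subalgebra_def)

text \<open>Stochastic approximation form. The step is 1 / (n + 3) because this is the normalisation
  at time n + 1.\<close>

lemma X_step:
  assumes "i \<in> {1..m}" "v \<in> star_vertices i" "w \<in> space M"
  shows "X (Suc n) w i v = X n w i v + (indicator (visit i n v) w - X n w i v) / (real n + 3)"
proof -
  define T where "T = 1 + (\<Sum>k = 1..n. of_bool (W i k w = v) :: real)"
  have "X (Suc n) w i v = (T + indicator (visit i n v) w) / (real n + 3)"
    using assms by (simp add: star_occupation_def T_def indicator_def of_bool_def add_ac)
  moreover have "X n w i v = T / (real n + 2)"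
    using assms by (simp add: star_occupation_def T_def add.commute)
  moreover have "(T + b) / (real n + 3) = T / (real n + 2) + (b - T / (real n + 2)) / (real n + 3)" for b
  proof -
    have "(T + b) / (x + 1) = T / x + (b - T / x) / (x + 1)" if "0 < x" for x :: real
      using that by (simp add: divide_simps) (simp add: algebra_simps)
    from this[of "real n + 2"] show ?thesis by (simp add: add.commute add.left_commute)
  qed
  ultimately show ?thesis by simp
qed

lemma X_ge: "i \<in> {1..m} \<Longrightarrow> v \<in> star_vertices i \<Longrightarrow> 1 / (real n + 2) \<le> X n w i v"
  by (auto simp: star_occupation_def add.commute intro!: divide_right_mono sum_nonneg)

lemma X_pos: "i \<in> {1..m} \<Longrightarrow> v \<in> star_vertices i \<Longrightarrow> 0 < X n w i v"
  by (rule less_le_trans[OF _ X_ge]) auto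

lemma X_le_1:
  assumes "i \<in> {1..m}" "v \<in> star_vertices i"
  shows "X n w i v \<le> 1"
proof -
  have "(\<Sum>k = 1..n. of_bool (W i k w = v) :: real) \<le> (\<Sum>k = 1..n. 1)"
    by (intro sum_mono) auto
  then have "1 + (\<Sum>k = 1..n. of_bool (W i k w = v) :: real) \<le> 2 + real n" by simp
  then show ?thesis using assms by (simp add: star_occupation_def)
qed

lemma X_sum: "w \<in> space M \<Longrightarrow> i \<in> {1..m} \<Longrightarrow> X n w i (i + 1) = 1 - X n w i 1"
proof -
  assume "w \<in> space M" "i \<in> {1..m}"
  then have "X n w i 1 + X n w i (i + 1) = 1"
    using star_occupation_in_domain[of w n] unfolding star_domain_def by blast
  then show ?thesis by linarith
qed

lemma one_vertex: "1 \<in> star_vertices i" and succ_vertex: "i + 1 \<in> star_vertices i"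
  by (auto simp: star_vertices_def)

lemma bm_X:
  shows "bounded_measurable (F n) (\<lambda>w. X n w i v)"
proof (cases "i \<in> {1..m} \<and> v \<in> star_vertices i")
  case True
  then have i: "i \<in> {1..m}" and v: "v \<in> star_vertices i" by auto
  show ?thesis
  proof (rule bounded_measurableI[where K = 1])
    show "\<bar>X n w i v\<bar> \<le> 1" for w using X_pos[OF i v, of n w] X_le_1[OF i v, of n w] by simp
    have eq: "X n w i v = 1 / (2 + real n) * (1 + (\<Sum>k = 1..n. indicator (visit i (k - 1) v) w))"
      if "w \<in> space (F n)" for w
      using True that unfolding star_occupation_def
      by (auto simp: indicator_def of_bool_def intro!: arg_cong[where f = "\<lambda>x. (1 + x) / _"] sum.cong)
    have vis: "visit i (k - 1) v \<in> sets (F n)" if "k \<in> {1..n}" for k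
      using visit_sets[OF i v, of "k - 1"] F_mono[of "Suc (k - 1)" n] that by auto
    have "bounded_measurable (F n) (\<lambda>w. 1 / (2 + real n) * (1 + (\<Sum>k = 1..n. indicator (visit i (k - 1) v) w)))"
      by (intro bm_intros vis)
    then show "(\<lambda>w. X n w i v) \<in> borel_measurable (F n)"
      by (intro measurable_cong[THEN iffD2, OF eq] bounded_measurableD)
  qed
next
  case False
  then show ?thesis by (simp only: star_occupation_def if_False bounded_measurable_const)
qed

lemmas X_measurable [measurable] = bounded_measurableD[OF bm_X]

lemma H_nonneg: "0 \<le> star_H m \<alpha> \<epsilon> \<eta> x i v"
  by (simp add: star_H_def)

lemma tp_bounds:
  assumes "i \<in> {1..m}" "v \<in> star_vertices i"
  shows "0 \<le> tp n w i v" "tp n w i v \<le> 1"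
proof -
  have nn: "0 \<le> X n w i u * star_H m \<alpha> \<epsilon> \<eta> (X n w) i u" if "u \<in> star_vertices i" for u
    using X_pos[OF assms(1) that, of n w] H_nonneg by (intro mult_nonneg_nonneg) auto
  note n1 = nn[OF one_vertex] nn[OF succ_vertex] nn[OF assms(2)]
  then show "0 \<le> tp n w i v" by (simp add: star_pi_def)
  have "v = 1 \<or> v = i + 1" using assms by (auto simp: star_vertices_def)
  then show "tp n w i v \<le> 1"
    using n1 unfolding star_pi_def by (intro divide_le_eq_1[THEN iffD2]) auto
qed

lemma tp_measurable [measurable]: "(\<lambda>w. tp n w i v) \<in> borel_measurable (F n)"
  unfolding star_pi_def star_H_def by measurable

lemma bm_tp: "i \<in> {1..m} \<Longrightarrow> v \<in> star_vertices i \<Longrightarrow> bounded_measurable (F n) (\<lambda>w. tp n w i v)"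
  using tp_bounds by (intro bounded_measurableI[where K = 1]) (auto simp: abs_of_nonneg)

text \<open>Conditional probabilities are used only in this integrated form, tested against bounded
  functions of the past; almost sure versions need not be carried along.\<close>

lemma integral_cond:
  assumes Y: "Y \<in> events" and T: "AE w in M. real_cond_exp M (F n) (indicator Y) w = t w"
    and t: "bounded_measurable (F n) t" and g: "bounded_measurable (F n) g"
  shows "(\<integral>w. g w * indicator Y w \<partial>M) = (\<integral>w. g w * t w \<partial>M)"
proof -
  interpret S: finite_measure_subalgebra M "F n"
    by unfold_locales (rule subalgebra_star_history)
  have int: "integrable M (\<lambda>w. g w * indicator Y w)"
    by (intro bounded_measurable_integrable bm_intros bm_M[OF g] Y)
  have "(\<integral>w. g w * indicator Y w \<partial>M) = (\<integral>w. g w * real_cond_exp M (F n) (indicator Y) w \<partial>M)"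
    using S.real_cond_exp_intg(2)[OF int bounded_measurableD[OF g]] Y by simp
  also have "\<dots> = (\<integral>w. g w * t w \<partial>M)"
  proof (rule integral_cong_AE)
    show "(\<lambda>w. g w * t w) \<in> borel_measurable M"
      by (intro bounded_measurableD bm_intros bm_M[OF g] bm_M[OF t])
    show "(\<lambda>w. g w * real_cond_exp M (F n) (indicator Y) w) \<in> borel_measurable M"
      using bounded_measurableD[OF bm_M[OF g]] by simp
    show "AE w in M. g w * real_cond_exp M (F n) (indicator Y) w = g w * t w"
      using T by eventually_elim simp
  qed
  finally show ?thesis .
qed

lemma integral_visit:
  assumes "i \<in> {1..m}" "v \<in> star_vertices i" "bounded_measurable (F n) g"
  shows "(\<integral>w. g w * indicator (visit i n v) w \<partial>M) = (\<integral>w. g w * tp n w i v \<partial>M)"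
  by (rule integral_cond[OF visit_events[OF assms(1,2)] walk_transition[OF assms(1,2)] bm_tp[OF assms(1,2)] assms(3)])

text \<open>Conditional independence of the walks enters here, for the pair {i, j}; it makes the
  mixed term of the noise variance factor.\<close>

lemma integral_visit_visit:
  assumes i: "i \<in> {1..m}" and j: "j \<in> {1..m}" and ij: "i \<noteq> j" and g: "bounded_measurable (F n) g"
  shows "(\<integral>w. g w * (indicator (visit i n 1) w * indicator (visit j n 1) w) \<partial>M)
    = (\<integral>w. g w * (tp n w i 1 * tp n w j 1) \<partial>M)"
proof -
  have vim: "W k (n + 1) -` {1} \<inter> space M = visit k n 1" for k by auto
  have "AE w in M. real_cond_exp M (F n) (indicator (\<Inter>k\<in>{i, j}. W k (n + 1) -` {1} \<inter> space M)) w =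
           (\<Prod>k\<in>{i, j}. real_cond_exp M (F n) (indicator (W k (n + 1) -` {1} \<inter> space M)) w)"
    using walk_cond_indep[of n] i j one_vertex unfolding cond_indep_vars_def
    by (elim conjE allE[of _ "{i, j}"] allE[of _ "\<lambda>_. {1}"]) auto
  then have "AE w in M. real_cond_exp M (F n) (indicator (visit i n 1 \<inter> visit j n 1)) w =
           real_cond_exp M (F n) (indicator (visit i n 1)) w * real_cond_exp M (F n) (indicator (visit j n 1)) w"
    using ij unfolding vim by simp
  then have "AE w in M. real_cond_exp M (F n) (indicator (visit i n 1 \<inter> visit j n 1)) w = tp n w i 1 * tp n w j 1"
    using walk_transition[OF i one_vertex, of n] walk_transition[OF j one_vertex, of n]
    by eventually_elim simp
  from integral_cond[OF _ this _ g]
  have "(\<integral>w. g w * indicator (visit i n 1 \<inter> visit j n 1) w \<partial>M) = (\<integral>w. g w * (tp n w i 1 * tp n w j 1) \<partial>M)"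
    using visit_events i j one_vertex by (simp add: bm_intros bm_tp)
  then show ?thesis by (simp add: indicator_inter_arith)
qed

subsection \<open>The Lyapunov function\<close>

definition S :: "nat \<Rightarrow> 'a \<Rightarrow> real" where "S n w = (\<Sum>j\<in>{1..m}. X n w j 1)"

definition G :: "nat \<Rightarrow> nat \<Rightarrow> 'a \<Rightarrow> real" where
  "G i n w = \<epsilon> - S n w + (1 - 2 * \<epsilon>) * X n w i 1"

definition baseA :: "real \<Rightarrow> real \<Rightarrow> real" where "baseA x s = \<eta> - s + (1 - \<epsilon>) * x"
definition baseB :: "real \<Rightarrow> real" where "baseB x = \<eta> - \<epsilon> * (1 - x)"

text \<open>In terms of a walk's own frequency x and the total s, all walks share this single
  transition function; i is visible only through x.\<close>

definition prob1 :: "real \<Rightarrow> real \<Rightarrow> real" where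
  "prob1 x s = x * baseA x s powr \<alpha> / (x * baseA x s powr \<alpha> + (1 - x) * baseB x powr \<alpha>)"

lemma H_eq:
  assumes "i \<in> {1..m}" "w \<in> space M"
  shows "star_H m \<alpha> \<epsilon> \<eta> (X n w) i 1 = baseA (X n w i 1) (S n w) powr \<alpha>"
    "star_H m \<alpha> \<epsilon> \<eta> (X n w) i (i + 1) = baseB (X n w i 1) powr \<alpha>"
proof -
  have "(\<Sum>j\<in>{1..m} - {i}. X n w j 1) = S n w - X n w i 1"
    unfolding S_def using assms by (simp add: sum_diff1 del: One_nat_def)
  then show "star_H m \<alpha> \<epsilon> \<eta> (X n w) i 1 = baseA (X n w i 1) (S n w) powr \<alpha>"
  proof -
    assume *: "(\<Sum>j\<in>{1..m} - {i}. X n w j 1) = S n w - X n w i 1"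
    have "\<eta> - \<epsilon> * X n w i 1 - (\<Sum>j\<in>{1..m} - {i}. X n w j 1) = baseA (X n w i 1) (S n w)"
      unfolding * baseA_def by (simp add: algebra_simps)
    then show ?thesis by (simp only: star_H_def if_True simp_thms)
  qed
  show "star_H m \<alpha> \<epsilon> \<eta> (X n w) i (i + 1) = baseB (X n w i 1) powr \<alpha>"
    using assms X_sum[OF assms(2,1), of n] by (simp add: star_H_def baseB_def)
qed

lemma tp_eq:
  assumes "i \<in> {1..m}" "w \<in> space M"
  shows "tp n w i 1 = prob1 (X n w i 1) (S n w)"
  unfolding star_pi_def prob1_def H_eq[OF assms] X_sum[OF assms(2,1)] ..

lemma base_diff: "baseA x s - baseB x = \<epsilon> - s + (1 - 2 * \<epsilon>) * x"
  by (simp add: baseA_def baseB_def algebra_simps)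

lemma S_bounds:
  assumes "i \<in> {1..m}"
  shows "X n w i 1 \<le> S n w" "S n w \<le> real m - 1 + X n w i 1"
proof -
  have eq: "S n w = X n w i 1 + (\<Sum>j\<in>{1..m} - {i}. X n w j 1)"
    unfolding S_def using assms by (subst sum.remove[of _ i]) auto
  have "(\<Sum>j\<in>{1..m} - {i}. X n w j 1) \<le> (\<Sum>j\<in>{1..m} - {i}. 1)"
    using X_le_1[OF _ one_vertex] by (intro sum_mono) auto
  also have "\<dots> = real m - 1" using assms by (simp add: of_nat_diff)
  finally show "S n w \<le> real m - 1 + X n w i 1" using eq by simp
  have "0 \<le> (\<Sum>j\<in>{1..m} - {i}. X n w j 1)"
    using X_pos[OF _ one_vertex] by (intro sum_nonneg) (auto intro: less_imp_le)
  then show "X n w i 1 \<le> S n w" using eq by simp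
qed

text \<open>By \<open>eta_gt\<close> the lower end is positive, so both bases range over a compact
  interval of positive numbers and their powers are bounded above and away from 0.\<close>

lemma base_bounds:
  assumes x: "0 \<le> x" "x \<le> 1" and s: "x \<le> s" "s \<le> real m - 1 + x"
  shows "baseA x s \<in> {\<eta> - (real m - 1) - \<epsilon>..\<eta>}" "baseB x \<in> {\<eta> - (real m - 1) - \<epsilon>..\<eta>}"
proof -
  have "0 \<le> \<epsilon> * x" "\<epsilon> * x \<le> \<epsilon>" using x eps_nonneg mult_left_le[of x \<epsilon>] by auto
  then show "baseA x s \<in> {\<eta> - (real m - 1) - \<epsilon>..\<eta>}" "baseB x \<in> {\<eta> - (real m - 1) - \<epsilon>..\<eta>}"
    using s two_le_m by (auto simp: baseA_def baseB_def algebra_simps)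
qed

lemma lyapunov_rate:
  obtains c where "0 < c"
    "\<And>x s. 0 \<le> x \<Longrightarrow> x \<le> 1 \<Longrightarrow> x \<le> s \<Longrightarrow> s \<le> real m - 1 + x \<Longrightarrow>
      c * (x * (1 - x) * (\<epsilon> - s + (1 - 2 * \<epsilon>) * x)\<^sup>2) \<le> (prob1 x s - x) * (\<epsilon> - s + (1 - 2 * \<epsilon>) * x)"
proof -
  define l where "l = \<eta> - (real m - 1) - \<epsilon>"
  have l: "0 < l" using eta_gt by (simp add: l_def)
  have le: "l \<le> \<eta>" using two_le_m eps_nonneg by (simp add: l_def)
  define \<kappa> where "\<kappa> = \<alpha> * min (l powr (\<alpha> - 1)) (\<eta> powr (\<alpha> - 1))"
  have \<kappa>: "0 < \<kappa>" using alpha_pos l le by (simp add: \<kappa>_def)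
  have e: "0 < \<eta> powr \<alpha>" using l le by simp
  show ?thesis
  proof (rule that[of "\<kappa> / \<eta> powr \<alpha>"])
    show "0 < \<kappa> / \<eta> powr \<alpha>" using \<kappa> e by simp
    fix x s :: real assume x: "0 \<le> x" "x \<le> 1" and s: "x \<le> s" "s \<le> real m - 1 + x"
    define a b where "a = baseA x s" and "b = baseB x"
    have ab: "a \<in> {l..\<eta>}" "b \<in> {l..\<eta>}" using base_bounds[OF x s] by (auto simp: a_def b_def l_def)
    define u v where "u = a powr \<alpha>" and "v = b powr \<alpha>"
    have uv: "0 < u" "0 < v" "u \<le> \<eta> powr \<alpha>" "v \<le> \<eta> powr \<alpha>"
      using ab l alpha_pos by (auto simp: u_def v_def intro!: powr_mono2)
    define N where "N = x * u + (1 - x) * v"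
    have N: "0 < N"
    proof (cases "x = 0")
      case False
      then show ?thesis using x uv unfolding N_def by (intro add_pos_nonneg) auto
    qed (use uv in \<open>simp add: N_def\<close>)
    have "N \<le> x * \<eta> powr \<alpha> + (1 - x) * \<eta> powr \<alpha>"
      unfolding N_def using x uv by (intro add_mono mult_left_mono) auto
    then have Ne: "N \<le> \<eta> powr \<alpha>" by (simp add: algebra_simps)
    have d: "a - b = \<epsilon> - s + (1 - 2 * \<epsilon>) * x" unfolding a_def b_def by (rule base_diff)
    have pr: "prob1 x s - x = x * (1 - x) * (u - v) / N"
      using N unfolding prob1_def a_def[symmetric] b_def[symmetric] u_def[symmetric] v_def[symmetric] N_def[symmetric]
      by (simp add: field_simps) (simp add: N_def algebra_simps)
    have ge: "\<kappa> * (a - b)\<^sup>2 \<le> (u - v) * (a - b)"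
      unfolding \<kappa>_def u_def v_def using powr_diff_mult_diff_ge[OF l alpha_pos ab] .
    have "\<kappa> / \<eta> powr \<alpha> * (x * (1 - x) * (a - b)\<^sup>2) = x * (1 - x) * (\<kappa> * (a - b)\<^sup>2) / \<eta> powr \<alpha>" by simp
    also have "\<dots> \<le> x * (1 - x) * ((u - v) * (a - b)) / \<eta> powr \<alpha>"
      using x e ge by (intro divide_right_mono mult_left_mono) auto
    also have "\<dots> \<le> x * (1 - x) * ((u - v) * (a - b)) / N"
    proof (rule divide_left_mono[OF Ne])
      have "0 \<le> (u - v) * (a - b)" using ge \<kappa> by (smt (verit) mult_nonneg_nonneg zero_le_power2)
      then show "0 \<le> x * (1 - x) * ((u - v) * (a - b))" using x by simp
    qed (use N e in simp)
    also have "\<dots> = (prob1 x s - x) * (a - b)" unfolding pr by simp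
    finally show "\<kappa> / \<eta> powr \<alpha> * (x * (1 - x) * (\<epsilon> - s + (1 - 2 * \<epsilon>) * x)\<^sup>2)
        \<le> (prob1 x s - x) * (\<epsilon> - s + (1 - 2 * \<epsilon>) * x)" unfolding d .
  qed
qed

definition L :: "nat \<Rightarrow> 'a \<Rightarrow> real" where
  "L n w = \<epsilon> * S n w - (S n w)\<^sup>2 / 2 + (1 / 2 - \<epsilon>) * (\<Sum>j\<in>{1..m}. (X n w j 1)\<^sup>2)"

definition \<Psi> :: "nat \<Rightarrow> nat \<Rightarrow> 'a \<Rightarrow> real" where
  "\<Psi> i n w = X n w i 1 * (1 - X n w i 1) * (G i n w)\<^sup>2"

definition h :: "nat \<Rightarrow> nat \<Rightarrow> 'a \<Rightarrow> real" where
  "h i n w = (indicator (visit i n 1) w - X n w i 1) / (real n + 3)"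

lemma h_bound: "i \<in> {1..m} \<Longrightarrow> \<bar>h i n w\<bar> \<le> 1 / (real n + 3)"
  using X_pos[OF _ one_vertex, of i n w] X_le_1[OF _ one_vertex, of i n w]
  by (auto simp: h_def abs_divide indicator_def intro!: divide_right_mono)

lemma X1_step: "i \<in> {1..m} \<Longrightarrow> w \<in> space M \<Longrightarrow> X (Suc n) w i 1 = X n w i 1 + h i n w"
  unfolding h_def by (rule X_step[OF _ one_vertex])

lemma S_step: "w \<in> space M \<Longrightarrow> S (Suc n) w = S n w + (\<Sum>j\<in>{1..m}. h j n w)"
  unfolding S_def by (simp add: X1_step sum.distrib[symmetric] del: One_nat_def)

lemma sum_h_bound: "\<bar>\<Sum>j\<in>{1..m}. h j n w\<bar> \<le> real m / (real n + 3)"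
proof -
  have "\<bar>\<Sum>j\<in>{1..m}. h j n w\<bar> \<le> (\<Sum>j\<in>{1..m}. 1 / (real n + 3))"
    by (intro order_trans[OF sum_abs] sum_mono h_bound)
  then show ?thesis by simp
qed

definition C :: real where "C = (real m)\<^sup>2 / 2 + \<bar>1 / 2 - \<epsilon>\<bar> * real m"

text \<open>L is quadratic with gradient G, so its expansion stops at second order. The remainder
  consists of squares of steps of size at most 1 / (n + 3), and C collects their
  coefficients.\<close>

lemma L_step:
  assumes "w \<in> space M"
  shows "(\<Sum>j\<in>{1..m}. h j n w * G j n w) - C / (real n + 3)\<^sup>2 \<le> L (Suc n) w - L n w"
proof -
  let ?H = "\<Sum>j\<in>{1..m}. h j n w" and ?H2 = "\<Sum>j\<in>{1..m}. (h j n w)\<^sup>2"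
  let ?t = "1 / (real n + 3)\<^sup>2"
  have sq: "(\<Sum>j\<in>{1..m}. (X (Suc n) w j 1)\<^sup>2)
      = (\<Sum>j\<in>{1..m}. (X n w j 1)\<^sup>2) + 2 * (\<Sum>j\<in>{1..m}. X n w j 1 * h j n w) + ?H2"
    using assms by (simp add: X1_step power2_sum sum.distrib sum_distrib_left mult.assoc algebra_simps del: One_nat_def)
  have hG: "(\<Sum>j\<in>{1..m}. h j n w * G j n w)
      = (\<epsilon> - S n w) * ?H + (1 - 2 * \<epsilon>) * (\<Sum>j\<in>{1..m}. X n w j 1 * h j n w)"
    by (simp add: G_def sum_distrib_left sum.distrib[symmetric] algebra_simps del: One_nat_def)
  define q d z where "q = (1 / 2 - \<epsilon>) * ?H2" and "d = \<bar>1 / 2 - \<epsilon>\<bar> * (real m * ?t)"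
    and "z = (real m)\<^sup>2 * ?t"
  have eq: "L (Suc n) w - L n w = (\<Sum>j\<in>{1..m}. h j n w * G j n w) - ?H\<^sup>2 / 2 + q"
    unfolding L_def sq S_step[OF assms] hG q_def by (simp add: power2_eq_square field_simps)
  have "\<bar>?H\<bar>\<^sup>2 \<le> (real m / (real n + 3))\<^sup>2" by (intro power_mono sum_h_bound) auto
  then have 1: "?H\<^sup>2 \<le> z" by (simp add: power_divide z_def)
  have "(h j n w)\<^sup>2 \<le> ?t" if "j \<in> {1..m}" for j
    using power_mono[OF h_bound[OF that, of n w], of 2] by (simp add: power_divide)
  then have "?H2 \<le> (\<Sum>j\<in>{1..m}. ?t)" by (intro sum_mono)
  then have 2: "\<bar>?H2\<bar> \<le> real m * ?t" by (simp add: sum_nonneg)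
  have "\<bar>q\<bar> \<le> d"
    unfolding q_def d_def abs_mult by (intro mult_left_mono 2) auto
  moreover have "C / (real n + 3)\<^sup>2 = z / 2 + d"
    by (simp add: C_def add_divide_distrib z_def d_def)
  ultimately show ?thesis unfolding eq using 1 by linarith
qed

lemma bm_S: "bounded_measurable (F n) (S n)"
  unfolding S_def[abs_def] by (intro bm_intros bm_X)

lemma bm_G: "bounded_measurable (F n) (G i n)"
  unfolding G_def[abs_def] by (intro bm_intros bm_X bm_S)

lemma bm_Psi: "bounded_measurable (F n) (\<Psi> i n)"
  unfolding \<Psi>_def[abs_def] by (intro bm_intros bm_X bm_G)

lemma bm_L: "bounded_measurable (F n) (L n)"
  unfolding L_def[abs_def] by (intro bm_intros bm_X bm_S)

lemma X1_range: "i \<in> {1..m} \<Longrightarrow> 0 \<le> X n w i 1" "i \<in> {1..m} \<Longrightarrow> X n w i 1 \<le> 1"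
  using X_pos[OF _ one_vertex] X_le_1[OF _ one_vertex] by (auto intro: less_imp_le)

lemma Psi_nonneg: "i \<in> {1..m} \<Longrightarrow> 0 \<le> \<Psi> i n w"
  using X1_range[of i n w] by (simp add: \<Psi>_def)

lemma S_range: "0 \<le> S n w" "S n w \<le> real m"
proof -
  show "0 \<le> S n w" unfolding S_def by (intro sum_nonneg X1_range)
  have "S n w \<le> (\<Sum>j\<in>{1..m}. 1)" unfolding S_def by (intro sum_mono X1_range)
  then show "S n w \<le> real m" by simp
qed

lemma L_bound: "\<bar>L n w\<bar> \<le> \<epsilon> * real m + (real m)\<^sup>2 / 2 + \<bar>1 / 2 - \<epsilon>\<bar> * real m"
proof -
  have "(S n w)\<^sup>2 \<le> (real m)\<^sup>2" using S_range by (intro power_mono) auto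
  moreover have "\<epsilon> * S n w \<le> \<epsilon> * real m" "0 \<le> \<epsilon> * S n w"
    using S_range eps_nonneg by (auto intro: mult_left_mono)
  moreover have "(\<Sum>j\<in>{1..m}. (X n w j 1)\<^sup>2) \<le> (\<Sum>j\<in>{1..m}. 1)"
    using X1_range by (intro sum_mono) (auto simp: power_le_one)
  then have "\<bar>\<Sum>j\<in>{1..m}. (X n w j 1)\<^sup>2\<bar> \<le> real m" by (simp add: sum_nonneg)
  then have "\<bar>(1 / 2 - \<epsilon>) * (\<Sum>j\<in>{1..m}. (X n w j 1)\<^sup>2)\<bar> \<le> \<bar>1 / 2 - \<epsilon>\<bar> * real m"
    unfolding abs_mult by (intro mult_left_mono) auto
  moreover have "0 \<le> (S n w)\<^sup>2" by simp
  ultimately show ?thesis unfolding L_def abs_le_iff by linarith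
qed

text \<open>The expected increment of L dominates the dissipation up to a summable error, and L is
  bounded; telescoping leaves a bound independent of n.\<close>

lemma sum_expectation_Psi_bounded:
  obtains K where "\<And>i n. i \<in> {1..m} \<Longrightarrow> (\<Sum>k<n. \<integral>w. \<Psi> i k w / (real k + 3) \<partial>M) \<le> K"
proof -
  obtain c where c: "0 < c" and rate: "\<And>x s. 0 \<le> x \<Longrightarrow> x \<le> 1 \<Longrightarrow> x \<le> s \<Longrightarrow> s \<le> real m - 1 + x \<Longrightarrow>
      c * (x * (1 - x) * (\<epsilon> - s + (1 - 2 * \<epsilon>) * x)\<^sup>2) \<le> (prob1 x s - x) * (\<epsilon> - s + (1 - 2 * \<epsilon>) * x)"
    by (rule lyapunov_rate) blast
  define B where "B = \<epsilon> * real m + (real m)\<^sup>2 / 2 + \<bar>1 / 2 - \<epsilon>\<bar> * real m"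
  note int = bounded_measurable_integrable
  define E where "E k = (\<Sum>i\<in>{1..m}. \<integral>w. \<Psi> i k w / (real k + 3) \<partial>M)" for k
  have step: "c * E n \<le> (\<integral>w. L (Suc n) w \<partial>M) - (\<integral>w. L n w \<partial>M) + C / (real n + 3)\<^sup>2" for n
  proof -
    have visM: "bounded_measurable M (indicator (visit i n 1))" if "i \<in> {1..m}" for i
      by (intro bm_intros visit_events that one_vertex)
    have hM: "bounded_measurable M (h i n)" if "i \<in> {1..m}" for i
      unfolding h_def[abs_def] by (intro bm_intros visM that bm_M[OF bm_X])
    have hG: "(\<integral>w. h i n w * G i n w \<partial>M) \<ge> c * (\<integral>w. \<Psi> i n w / (real n + 3) \<partial>M)" if i: "i \<in> {1..m}" for i
    proof -
      \<comment> \<open>G and the step size depend on the past only, so their product is an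
        admissible weight for \<open>integral_visit\<close>.\<close>
      define d where "d w = G i n w / (real n + 3)" for w
      have dF: "bounded_measurable (F n) d" unfolding d_def by (intro bm_intros bm_G)
      note b = bm_M[OF dF] visM[OF i] bm_M[OF bm_X] bm_M[OF bm_tp[OF i one_vertex]]
      have "(\<integral>w. h i n w * G i n w \<partial>M) = (\<integral>w. d w * indicator (visit i n 1) w - d w * X n w i 1 \<partial>M)"
        by (intro Bochner_Integration.integral_cong)
          (simp_all add: d_def h_def diff_divide_distrib right_diff_distrib mult.commute)
      also have "\<dots> = (\<integral>w. d w * tp n w i 1 \<partial>M) - (\<integral>w. d w * X n w i 1 \<partial>M)"
        by (simp only: Bochner_Integration.integral_diff int bm_intros b integral_visit[OF i one_vertex dF])
      also have "\<dots> = (\<integral>w. d w * tp n w i 1 - d w * X n w i 1 \<partial>M)"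
        by (simp only: Bochner_Integration.integral_diff int bm_intros b)
      finally have eq: "(\<integral>w. h i n w * G i n w \<partial>M) = \<dots>" .
      have "(\<integral>w. c * (\<Psi> i n w / (real n + 3)) \<partial>M) \<le> (\<integral>w. d w * tp n w i 1 - d w * X n w i 1 \<partial>M)"
      proof (intro integral_mono int bm_intros b bm_M[OF bm_Psi])
        fix w assume sp: "w \<in> space M"
        have "c * \<Psi> i n w / (real n + 3) \<le> ((tp n w i 1 - X n w i 1) * G i n w) / (real n + 3)"
          unfolding \<Psi>_def G_def tp_eq[OF i sp]
          using rate[OF X1_range[OF i] S_bounds[OF i], of n w] by (intro divide_right_mono) auto
        then show "c * (\<Psi> i n w / (real n + 3)) \<le> d w * tp n w i 1 - d w * X n w i 1"
          by (simp add: d_def algebra_simps diff_divide_distrib)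
      qed
      then show ?thesis unfolding eq by simp
    qed
    have "c * E n = (\<Sum>i\<in>{1..m}. c * (\<integral>w. \<Psi> i n w / (real n + 3) \<partial>M))"
      unfolding E_def by (rule sum_distrib_left)
    also have "\<dots> \<le> (\<Sum>i\<in>{1..m}. \<integral>w. h i n w * G i n w \<partial>M)" by (intro sum_mono hG)
    also have "\<dots> = (\<integral>w. (\<Sum>i\<in>{1..m}. h i n w * G i n w) \<partial>M)"
      by (intro Bochner_Integration.integral_sum[symmetric] int bm_intros hM bm_M[OF bm_G])
    also have "\<dots> \<le> (\<integral>w. L (Suc n) w - L n w + C / (real n + 3)\<^sup>2 \<partial>M)"
    proof (intro integral_mono int bm_intros hM bm_M[OF bm_G] bm_M[OF bm_L])
      fix w assume "w \<in> space M"
      from L_step[OF this, of n] show "(\<Sum>i\<in>{1..m}. h i n w * G i n w) \<le> L (Suc n) w - L n w + C / (real n + 3)\<^sup>2"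
        by linarith
    qed
    also have "\<dots> = (\<integral>w. L (Suc n) w \<partial>M) - (\<integral>w. L n w \<partial>M) + C / (real n + 3)\<^sup>2"
      using int[OF bm_M[OF bm_L]] by (simp add: prob_space)
    finally show ?thesis .
  qed
  have C0: "0 \<le> C" by (simp add: C_def)
  have tele: "c * (\<Sum>k<n. E k) \<le> (\<integral>w. L n w \<partial>M) - (\<integral>w. L 0 w \<partial>M) + C * (\<Sum>k\<in>{0..<n}. 1 / (real k + 3)\<^sup>2)" for n
  proof (induction n)
    case (Suc n)
    then show ?case using step[of n] by (simp add: distrib_left)
  qed simp
  have EL: "\<bar>\<integral>w. L n w \<partial>M\<bar> \<le> B" for n
  proof -
    have "\<bar>\<integral>w. L n w \<partial>M\<bar> \<le> (\<integral>w. \<bar>L n w\<bar> \<partial>M)" by (rule integral_abs_bound)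
    also have "\<dots> \<le> (\<integral>w. B \<partial>M)"
      using int[OF bm_M[OF bm_L]] by (intro integral_mono) (auto simp: B_def L_bound)
    finally show ?thesis by (simp add: prob_space)
  qed
  have tot: "c * (\<Sum>k<n. E k) \<le> 2 * B + C" for n
  proof -
    have "(\<Sum>k\<in>{0..<n}. 1 / (real k + 3)\<^sup>2) \<le> 1 / 2 - 1 / (real n + 2)"
      using sum_inverse_squares_le[of 0 n] by simp
    also have "\<dots> \<le> 1" by (simp add: algebra_simps)
    finally have "C * (\<Sum>k\<in>{0..<n}. 1 / (real k + 3)\<^sup>2) \<le> C * 1" using C0 by (intro mult_left_mono)
    then show ?thesis using tele[of n] EL[of n] EL[of 0] by linarith
  qed
  show ?thesis
  proof (rule that[of "(2 * B + C) / c"])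
    fix i n assume i: "i \<in> {1..m}"
    have nn: "0 \<le> (\<integral>w. \<Psi> j k w / (real k + 3) \<partial>M)" if "j \<in> {1..m}" for j k
      using Psi_nonneg[OF that] by (intro integral_nonneg_AE) auto
    have "(\<Sum>k<n. \<integral>w. \<Psi> i k w / (real k + 3) \<partial>M) \<le> (\<Sum>k<n. E k)"
      unfolding E_def using i nn by (intro sum_mono member_le_sum) auto
    also have "\<dots> \<le> (2 * B + C) / c" using tot[of n] c by (simp add: field_simps)
    finally show "(\<Sum>k<n. \<integral>w. \<Psi> i k w / (real k + 3) \<partial>M) \<le> (2 * B + C) / c" .
  qed
qed

lemma Psi_slow:
  assumes i: "i \<in> {1..m}" and sp: "w \<in> space M"
  defines "g \<equiv> \<epsilon> + real m + \<bar>1 - 2 * \<epsilon>\<bar>"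
  shows "\<bar>\<Psi> i (Suc n) w - \<Psi> i n w\<bar> \<le> (3 * g\<^sup>2) / (real n + 3)"
proof -
  define t where "t = 1 / (real n + 3)"
  define x x' a a' where "x = X n w i 1" and "x' = X (Suc n) w i 1" and "a = G i n w" and "a' = G i (Suc n) w"
  have x: "0 \<le> x" "x \<le> 1" "0 \<le> x'" "x' \<le> 1" using X1_range[OF i] by (auto simp: x_def x'_def)
  have dx: "\<bar>x' - x\<bar> \<le> t" using X1_step[OF i sp, of n] h_bound[OF i, of n w] by (simp add: x_def x'_def t_def)
  have Gb: "\<bar>G i k w\<bar> \<le> g" for k
  proof -
    define q d where "q = (1 - 2 * \<epsilon>) * X k w i 1" and "d = \<bar>1 - 2 * \<epsilon>\<bar>"
    have "\<bar>q\<bar> \<le> d * 1"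
      unfolding q_def d_def abs_mult using X1_range[OF i, of k w] by (intro mult_left_mono) auto
    then show ?thesis
      unfolding G_def g_def q_def[symmetric] d_def[symmetric] using S_range[of k w] eps_nonneg by linarith
  qed
  have t0: "0 \<le> t" by (simp add: t_def)
  have g0: "0 \<le> g" using eps_nonneg by (simp add: g_def)
  have "\<bar>(1 - 2 * \<epsilon>) * (x' - x)\<bar> \<le> \<bar>1 - 2 * \<epsilon>\<bar> * t" unfolding abs_mult using dx by (intro mult_left_mono) auto
  moreover have "\<bar>S (Suc n) w - S n w\<bar> \<le> real m * t"
    using S_step[OF sp, of n] sum_h_bound[of n w] by (simp add: t_def)
  moreover have "a' - a = - (S (Suc n) w - S n w) + (1 - 2 * \<epsilon>) * (x' - x)"
    by (simp add: a_def a'_def G_def x_def x'_def algebra_simps)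
  ultimately have "\<bar>a' - a\<bar> \<le> real m * t + \<bar>1 - 2 * \<epsilon>\<bar> * t" by linarith
  also have "\<dots> \<le> g * t" using t0 eps_nonneg by (simp add: g_def algebra_simps)
  finally have da: "\<bar>a' - a\<bar> \<le> g * t" .
  have "x' * (1 - x') - x * (1 - x) = (x' - x) * (1 - x - x')" by (simp add: algebra_simps)
  then have "\<bar>x' * (1 - x') - x * (1 - x)\<bar> \<le> t * 1"
    unfolding abs_mult by (simp only: abs_mult) (use dx x t0 in \<open>intro mult_mono; auto\<close>)
  then have du: "\<bar>(x' * (1 - x') - x * (1 - x)) * a'\<^sup>2\<bar> \<le> t * g\<^sup>2"
    unfolding abs_mult using Gb[of "Suc n"] abs_le_square_iff[of a' g] g0 t0
    by (intro mult_mono) (auto simp: a'_def)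
  have u1: "\<bar>x * (1 - x)\<bar> \<le> 1" using x by (simp add: abs_mult mult_le_one)
  have "\<bar>a' + a\<bar> \<le> 2 * g" using Gb[of n] Gb[of "Suc n"] by (simp add: a_def a'_def)
  then have "\<bar>(a' - a) * (a' + a)\<bar> \<le> (g * t) * (2 * g)" unfolding abs_mult using da g0 t0 by (intro mult_mono) auto
  then have dv: "\<bar>x * (1 - x) * ((a' - a) * (a' + a))\<bar> \<le> 1 * ((g * t) * (2 * g))"
    unfolding abs_mult[of "x * (1 - x)"] using u1 by (intro mult_mono) auto
  have "\<Psi> i (Suc n) w - \<Psi> i n w = (x' * (1 - x') - x * (1 - x)) * a'\<^sup>2 + x * (1 - x) * ((a' - a) * (a' + a))"
    by (simp add: \<Psi>_def x_def x'_def a_def a'_def algebra_simps power2_eq_square)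
  then have "\<bar>\<Psi> i (Suc n) w - \<Psi> i n w\<bar> \<le> t * g\<^sup>2 + (g * t) * (2 * g)" using du dv by linarith
  then show ?thesis by (simp add: t_def power2_eq_square algebra_simps add_divide_distrib)
qed

theorem Psi_tendsto_0: "AE w in M. \<forall>i\<in>{1..m}. (\<lambda>n. \<Psi> i n w) \<longlonglongrightarrow> 0"
proof -
  obtain K where K: "\<And>i n. i \<in> {1..m} \<Longrightarrow> (\<Sum>k<n. \<integral>w. \<Psi> i k w / (real k + 3) \<partial>M) \<le> K"
    by (rule sum_expectation_Psi_bounded) blast
  have "AE w in M. (\<lambda>n. \<Psi> i n w) \<longlonglongrightarrow> 0" if i: "i \<in> {1..m}" for i
  proof -
    have b: "bounded_measurable M (\<lambda>w. \<Psi> i n w / (real n + 3))" for n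
      by (intro bm_intros bm_M[OF bm_Psi])
    have "AE w in M. summable (\<lambda>n. \<Psi> i n w / (real n + 3))"
      using Psi_nonneg[OF i] by (intro summable_AE_of_integral_bounded[of _ K] K i bounded_measurableD[OF b]
        bounded_measurable_integrable b) auto
    then show ?thesis
      using AE_space
      by eventually_elim (rule summable_slow_imp_tendsto_0[OF Psi_nonneg[OF i] Psi_slow[OF i]])
  qed
  then show ?thesis by (subst AE_finite_all[of "{1..m}"]) auto
qed

subsection \<open>Unstable boundary points\<close>

text \<open>With Z the number of visits plus one, a growth factor larger than one makes
  (n + 2) / (Z - (1 - c)) a nonnegative supermartingale; it tends to infinity if the frequency tends
  to zero. The shift 1 - c compensates for the discreteness of the increments of Z.\<close>

lemma not_tendsto_0_if_expanding_bounded: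
  assumes i: "i \<in> {1..m}" and v: "v \<in> star_vertices i" and c: "0 < c" "c \<le> 1"
  shows "AE w in M. \<not> ((\<forall>n\<ge>N. (1 + c) * X n w i v \<le> tp n w i v) \<and> (\<lambda>n. X n w i v) \<longlonglongrightarrow> 0)"
proof -
  \<comment> \<open>\<open>(real n + 2) * X n w i v\<close> is the count Z \<ge> 1, so Y is at least
    c.\<close>
  define Y where "Y n w = (real n + 2) * X n w i v - (1 - c)" for n w
  \<comment> \<open>The range stops before n, so \<open>stay (Suc n)\<close> belongs to F n and can
    be part of the weight at time n.\<close>
  define stay where "stay n = {w \<in> space M. \<forall>k\<in>{N..<n}. (1 + c) * X k w i v \<le> tp k w i v}" for n
  define f where "f n w = indicator (stay n) w * ((real n + 2) * (1 / Y n w))" for n w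
  have Y: "c \<le> Y n w" for n w
    using X_ge[OF i v, of n w] by (simp add: Y_def field_simps)
  have Ypos: "0 < Y n w" for n w using Y[of n w] c by linarith
  have bmY: "bounded_measurable (F n) (Y n)" for n
    unfolding Y_def[abs_def] by (intro bm_intros bm_X)
  have inv: "bounded_measurable (F n) (\<lambda>w. 1 / (Y n w + a))" if "0 \<le> a" for n a
  proof (rule bounded_measurableI[where K = "1 / c"])
    show "(\<lambda>w. 1 / (Y n w + a)) \<in> borel_measurable (F n)"
      using bounded_measurableD[OF bmY] by measurable
    show "\<bar>1 / (Y n w + a)\<bar> \<le> 1 / c" for w
      using Y[of n w] c that by (simp add: frac_le)
  qed
  have stay_meas: "stay (Suc n) \<in> sets (F n)" for n
  proof -
    have [measurable]: "(\<lambda>w. X k w i v) \<in> borel_measurable (F n)" "(\<lambda>w. tp k w i v) \<in> borel_measurable (F n)"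
      if "k \<in> {N..<Suc n}" for k
      using measurable_from_subalg[OF F_subalg X_measurable, of k n]
        measurable_from_subalg[OF F_subalg tp_measurable, of k n] that by auto
    have "stay (Suc n) = {w \<in> space (F n). \<forall>k\<in>{N..<Suc n}. (1 + c) * X k w i v \<le> tp k w i v}"
      by (simp add: stay_def)
    also have "\<dots> \<in> sets (F n)" by measurable
    finally show ?thesis .
  qed
  have stay_meas': "stay n \<in> sets (F n)" for n
  proof (cases n)
    case 0
    then have "stay n = space (F n)" by (simp add: stay_def)
    then show ?thesis using sets.top[of "F n"] by simp
  next
    case (Suc k)
    then show ?thesis using stay_meas[of k] F_mono[of k n] by auto
  qed
  have bmf: "bounded_measurable (F n) (f n)" for n
    unfolding f_def[abs_def] using inv[of 0 n] by (intro bm_intros stay_meas') simp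
  note int = bounded_measurable_integrable
  have step: "(\<integral>w. f (Suc n) w \<partial>M) \<le> (\<integral>w. f n w \<partial>M)" if n: "N \<le> n" for n
  proof -
    define g where "g w = indicator (stay (Suc n)) w * ((real n + 3) * (1 / (Y n w + 0)))" for w
    define g' where "g' w = g w * (1 / (Y n w + 1))" for w
    have bg: "bounded_measurable (F n) g" "bounded_measurable (F n) g'"
      unfolding g_def[abs_def] g'_def[abs_def] by (intro bm_intros stay_meas inv; simp)+
    have vM: "bounded_measurable M (indicator (visit i n v))" by (intro bm_intros visit_events i v)
    note b = bm_M[OF bg(1)] bm_M[OF bg(2)] vM bm_M[OF bm_tp[OF i v]] bm_M[OF bmf]
    \<comment> \<open>Since the visit indicator b is 0 or 1, the reciprocal 1 / (Y + b) is affine in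
      b, and \<open>integral_visit\<close> can replace the indicator by its probability.\<close>
    have eq: "f (Suc n) w = g w - g' w * indicator (visit i n v) w" if sp: "w \<in> space M" for w
    proof -
      define b :: real where "b = indicator (visit i n v) w"
      have "Y (Suc n) w = Y n w + b"
        using X_step[OF i v sp, of n] unfolding Y_def b_def[symmetric] by (simp add: field_simps)
      moreover have "b = 0 \<or> b = 1" by (auto simp: b_def indicator_def)
      ultimately have "1 / Y (Suc n) w = 1 / Y n w - 1 / Y n w * (1 / (Y n w + 1)) * b"
      proof -
        have "1 / (y + 1) = 1 / y - 1 / y * (1 / (y + 1))" if "0 < y" for y :: real
        proof -
          have "y \<noteq> 0" "y + 1 \<noteq> 0" using that by auto
          then show ?thesis by (simp add: divide_simps)
        qed
        note inv = this[OF Ypos[of n w]]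
        from \<open>b = 0 \<or> b = 1\<close> show ?thesis
        proof
          assume "b = 0"
          then show ?thesis using \<open>Y (Suc n) w = Y n w + b\<close> by simp
        next
          assume b1: "b = 1"
          show ?thesis unfolding \<open>Y (Suc n) w = Y n w + b\<close> b1 mult_1_right by (rule inv)
        qed
      qed
      moreover have "f (Suc n) w = indicator (stay (Suc n)) w * ((real n + 3) * (1 / Y (Suc n) w))"
        by (simp add: f_def add.commute)
      moreover have "I * (k * (u - u * a * b)) = I * (k * u) - I * (k * u) * a * b" for I k u a :: real
        by (simp add: algebra_simps)
      ultimately show ?thesis
        unfolding g'_def g_def b_def[symmetric] by (simp only: add_0_right)
    qed
    have "(\<integral>w. f (Suc n) w \<partial>M) = (\<integral>w. g w - g' w * indicator (visit i n v) w \<partial>M)"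
      by (rule Bochner_Integration.integral_cong[OF refl eq])
    also have "\<dots> = (\<integral>w. g w \<partial>M) - (\<integral>w. g' w * tp n w i v \<partial>M)"
      by (simp only: Bochner_Integration.integral_diff int bm_intros b integral_visit[OF i v bg(2)])
    also have "\<dots> = (\<integral>w. g w - g' w * tp n w i v \<partial>M)"
      by (simp only: Bochner_Integration.integral_diff int bm_intros b)
    also have "\<dots> \<le> (\<integral>w. f n w \<partial>M)"
    proof (intro integral_mono int bm_intros b)
      fix w assume sp: "w \<in> space M"
      show "g w - g' w * tp n w i v \<le> f n w"
      proof (cases "w \<in> stay (Suc n)")
        case True
        then have st: "w \<in> stay n" and ge: "(1 + c) * X n w i v \<le> tp n w i v"
          using n by (auto simp: stay_def)
        define x where "x = real n + 2"
        define y where "y = Y n w"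
        define t where "t = tp n w i v"
        have x: "2 \<le> x" by (simp add: x_def)
        have y: "0 < y" "c \<le> y" using Ypos Y by (auto simp: y_def)
        have Xy: "x * X n w i v = y + 1 - c" by (simp add: y_def x_def Y_def)
        \<comment> \<open>The two sides differ by c (y - c). The shift of Z by 1 - c is chosen so
          that this is nonnegative down to the least value y = c.\<close>
        have "y + 1 \<le> (1 + c) * (y + 1 - c)"
        proof -
          have "0 \<le> c * (y - c)" using c y by simp
          then show ?thesis by (simp add: algebra_simps)
        qed
        also have "\<dots> = x * ((1 + c) * X n w i v)" unfolding Xy[symmetric] by simp
        also have "\<dots> \<le> x * t" using ge x by (intro mult_left_mono) (auto simp: t_def)
        finally have "y + 1 \<le> x * t" .
        then have "1 / x \<le> t / (y + 1)" using x y by (simp add: field_simps)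
        then have "(x + 1) / y * (1 - t / (y + 1)) \<le> (x + 1) / y * (1 - 1 / x)"
          using x y by (intro mult_left_mono) auto
        also have "\<dots> = (x - 1 / x) / y" using x y by (simp add: field_simps)
        also have "\<dots> \<le> x / y" using x y by (intro divide_right_mono) auto
        finally have "(x + 1) / y * (1 - t / (y + 1)) \<le> x / y" .
        moreover have "g w - g' w * tp n w i v = (x + 1) / y * (1 - t / (y + 1))"
          using True by (simp add: g_def g'_def x_def y_def t_def algebra_simps add_divide_distrib)
        moreover have "f n w = x / y" using st by (simp add: f_def x_def y_def)
        ultimately show ?thesis by simp
      next
        case False
        then show ?thesis using Ypos[of n w] by (simp add: g_def g'_def f_def)
      qed
    qed
    finally show ?thesis .
  qed
  have bound: "(\<integral>w. f n w \<partial>M) \<le> (\<integral>w. f N w \<partial>M)" if "N \<le> n" for n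
    using that
  proof (induction n rule: dec_induct)
    case (step n)
    then show ?case using \<open>\<And>n. N \<le> n \<Longrightarrow> (\<integral>w. f (Suc n) w \<partial>M) \<le> (\<integral>w. f n w \<partial>M)\<close>[of n] by simp
  qed simp
  have "AE w in M. \<not> filterlim (\<lambda>n. f n w) at_top sequentially"
    using Ypos by (intro AE_not_tendsto_at_top[OF _ _ _ bound] bounded_measurableD[OF bm_M[OF bmf]]
        int bm_M[OF bmf]) (auto simp: f_def intro!: divide_nonneg_pos)
  then show ?thesis
    using AE_space
  proof eventually_elim
    case (elim w)
    show ?case
    proof safe
      assume ge: "\<forall>n\<ge>N. (1 + c) * X n w i v \<le> tp n w i v" and lim: "(\<lambda>n. X n w i v) \<longlonglongrightarrow> 0"
      have "filterlim (\<lambda>n. inverse (X n w i v)) at_top sequentially"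
        using lim X_pos[OF i v] by (intro filterlim_inverse_at_top) auto
      then have "filterlim (\<lambda>n. f n w) at_top sequentially"
      proof (rule filterlim_at_top_mono, intro always_eventually allI)
        fix n
        have "f n w = (real n + 2) / Y n w" using ge elim by (simp add: f_def stay_def)
        moreover have "(real n + 2) / ((real n + 2) * X n w i v) \<le> (real n + 2) / Y n w"
          using c Ypos[of n w] X_pos[OF i v, of n w] by (intro divide_left_mono mult_pos_pos) (auto simp: Y_def)
        ultimately show "inverse (X n w i v) \<le> f n w" by (simp add: inverse_eq_divide)
      qed
      with elim show False by blast
    qed
  qed
qed

text \<open>The random starting time and the real margin c are reduced to countably many pairs (N, 1
  / (j + 1)), so one null set serves for all.\<close>

lemma not_tendsto_0_if_expanding:
  "AE w in M. \<forall>i\<in>{1..m}. \<forall>v\<in>star_vertices i. \<forall>c>0.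
    eventually (\<lambda>n. (1 + c) * X n w i v \<le> tp n w i v) sequentially \<longrightarrow> \<not> (\<lambda>n. X n w i v) \<longlonglongrightarrow> 0"
proof -
  have "AE w in M. \<forall>j N. \<not> ((\<forall>n\<ge>N. (1 + 1 / real (Suc j)) * X n w i v \<le> tp n w i v) \<and> (\<lambda>n. X n w i v) \<longlonglongrightarrow> 0)"
    if "i \<in> {1..m}" "v \<in> star_vertices i" for i v
    unfolding AE_all_countable using that by (intro allI not_tendsto_0_if_expanding_bounded) auto
  then have "AE w in M. \<forall>i\<in>{1..m}. \<forall>v\<in>star_vertices i. \<forall>j N.
      \<not> ((\<forall>n\<ge>N. (1 + 1 / real (Suc j)) * X n w i v \<le> tp n w i v) \<and> (\<lambda>n. X n w i v) \<longlonglongrightarrow> 0)"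
    by (intro AE_finite_allI) (auto simp: star_vertices_def)
  then show ?thesis
  proof eventually_elim
    case (elim w)
    show ?case
    proof (intro ballI allI impI notI)
      fix i v and c :: real
      assume i: "i \<in> {1..m}" and v: "v \<in> star_vertices i" and c: "0 < c"
        and ev: "eventually (\<lambda>n. (1 + c) * X n w i v \<le> tp n w i v) sequentially"
        and lim: "(\<lambda>n. X n w i v) \<longlonglongrightarrow> 0"
      obtain j where j: "1 / real (Suc j) < c" using c by (rule nat_approx_posE)
      obtain N where N: "\<And>n. n \<ge> N \<Longrightarrow> (1 + c) * X n w i v \<le> tp n w i v"
        using ev by (auto simp: eventually_sequentially)
      have "(1 + 1 / real (Suc j)) * X n w i v \<le> tp n w i v" if "n \<ge> N" for n
        using N[OF that] j X_pos[OF i v, of n w]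
          mult_right_mono[of "1 + 1 / real (Suc j)" "1 + c" "X n w i v"] by linarith
      then show False using elim i v lim by blast
    qed
  qed
qed

subsection \<open>The unstable interior point\<close>

definition dprob1 :: "real \<Rightarrow> real \<Rightarrow> real" where
  "dprob1 x s = baseA x s powr \<alpha> * baseB x powr \<alpha> /
     (x * baseA x s powr \<alpha> + (1 - x) * baseB x powr \<alpha>)\<^sup>2 *
     (1 + x * (1 - x) * (\<alpha> * ((1 - \<epsilon>) / baseA x s - \<epsilon> / baseB x)))"

lemma prob1_deriv:
  assumes x: "0 < x" "x < 1" and A: "0 < baseA x s" and B: "0 < baseB x"
  shows "((\<lambda>x. prob1 x s) has_real_derivative dprob1 x s) (at x)"
proof -
  define u v where "u = baseA x s powr \<alpha>" and "v = baseB x powr \<alpha>"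
  define u' v' where "u' = u * (\<alpha> * (1 - \<epsilon>) / baseA x s)" and "v' = v * (\<alpha> * \<epsilon> / baseB x)"
  define N where "N = x * u + (1 - x) * v"
  have uv: "0 < u" "0 < v" using A B by (auto simp: u_def v_def)
  have N: "0 < N" using x uv by (simp add: N_def add_pos_pos)
  have da: "((\<lambda>x. baseA x s) has_real_derivative (1 - \<epsilon>)) (at x)"
    unfolding baseA_def by (auto intro!: derivative_eq_intros)
  have db: "(baseB has_real_derivative \<epsilon>) (at x)"
    unfolding baseB_def[abs_def] by (auto intro!: derivative_eq_intros)
  have du: "((\<lambda>x. baseA x s powr \<alpha>) has_real_derivative u') (at x)"
    using DERIV_powr[OF da A DERIV_const[of \<alpha>]] by (simp add: u'_def u_def mult_ac)
  have dv: "((\<lambda>x. baseB x powr \<alpha>) has_real_derivative v') (at x)"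
    using DERIV_powr[OF db B DERIV_const[of \<alpha>]] by (simp add: v'_def v_def mult_ac)
  have num: "((\<lambda>x. x * baseA x s powr \<alpha>) has_real_derivative u + x * u') (at x)"
    by (rule DERIV_cong[OF DERIV_mult[OF DERIV_ident du]]) (simp add: u_def mult.commute)
  have "((\<lambda>x. (1 - x) * baseB x powr \<alpha>) has_real_derivative - v + (1 - x) * v') (at x)"
    by (rule DERIV_cong[OF DERIV_mult[OF DERIV_diff[OF DERIV_const DERIV_ident] dv]])
      (simp add: v_def mult.commute)
  from DERIV_add[OF num this]
  have den: "((\<lambda>x. x * baseA x s powr \<alpha> + (1 - x) * baseB x powr \<alpha>) has_real_derivative
      u + x * u' - v + (1 - x) * v') (at x)" by (simp add: algebra_simps)
  have "((\<lambda>x. prob1 x s) has_real_derivative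
      ((u + x * u') * N - x * u * (u + x * u' - v + (1 - x) * v')) / (N * N)) (at x)"
    unfolding prob1_def N_def u_def v_def
    using DERIV_divide[OF num den] N by (simp only: N_def u_def v_def)
  moreover have "((u + x * u') * N - x * u * (u + x * u' - v + (1 - x) * v')) / (N * N) = dprob1 x s"
  proof -
    have "(u + x * u') * N - x * u * (u + x * u' - v + (1 - x) * v')
        = u * v + x * (1 - x) * (u' * v - u * v')"
      by (simp add: N_def algebra_simps)
    also have "u' * v - u * v' = u * v * (\<alpha> * ((1 - \<epsilon>) / baseA x s - \<epsilon> / baseB x))"
      by (simp add: u'_def v'_def algebra_simps)
    finally have "(u + x * u') * N - x * u * (u + x * u' - v + (1 - x) * v')
        = u * v * (1 + x * (1 - x) * (\<alpha> * ((1 - \<epsilon>) / baseA x s - \<epsilon> / baseB x)))"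
      by (simp add: algebra_simps)
    then show ?thesis
      unfolding dprob1_def u_def[symmetric] v_def[symmetric] N_def[symmetric] by (simp add: power2_eq_square)
  qed
  ultimately show ?thesis by simp
qed

text \<open>At the equilibrium the derivative of \<open>prob1\<close> is 1 + p (1 - p) \<alpha> (1 -
  2 \<epsilon>) / b > 1, where b is the common base. By continuity in (x, s) it stays above 1
  nearby, and the mean value theorem turns this into nonnegative bounded slopes of the drift. The
  bounds on \<open>prob1\<close> keep the noise nondegenerate.\<close>

lemma repelling_neighbourhood:
  assumes \<epsilon>: "\<epsilon> < 1 / 2" and p: "0 < p" "p < 1" and eq: "baseA p s = baseB p" and B: "0 < baseB p"
  obtains \<delta> c \<Lambda> where "0 < \<delta>" "0 < c"
    "\<And>x t. \<bar>x - p\<bar> < \<delta> \<Longrightarrow> \<bar>t - s\<bar> < \<delta> \<Longrightarrow> c \<le> prob1 x t \<and> prob1 x t \<le> 1 - c"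
    "\<And>x y t. \<bar>x - p\<bar> < \<delta> \<Longrightarrow> \<bar>y - p\<bar> < \<delta> \<Longrightarrow> \<bar>t - s\<bar> < \<delta> \<Longrightarrow> x \<noteq> y \<Longrightarrow>
      ((prob1 x t - x) - (prob1 y t - y)) / (x - y) \<in> {0..\<Lambda>}"
proof -
  define b where "b = baseB p"
  define dd where "dd z = dprob1 (fst z) (snd z)" for z
  define pp where "pp z = prob1 (fst z) (snd z)" for z
  have b: "0 < b powr \<alpha>" using B by (simp add: b_def)
  have N: "p * b powr \<alpha> + (1 - p) * b powr \<alpha> = b powr \<alpha>" by (simp add: algebra_simps)
  have pp: "pp (p, s) = p" using b by (simp add: pp_def prob1_def eq b_def[symmetric] N)
  have "dd (p, s) = 1 + p * (1 - p) * (\<alpha> * ((1 - 2 * \<epsilon>) / b))"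
    using b by (simp add: dd_def dprob1_def eq b_def[symmetric] N power2_eq_square diff_divide_distrib[symmetric])
  moreover have "0 < p * (1 - p) * (\<alpha> * ((1 - 2 * \<epsilon>) / b))"
    using p \<epsilon> alpha_pos B by (intro mult_pos_pos divide_pos_pos) (auto simp: b_def)
  ultimately have dd: "1 < dd (p, s)" by simp
  have cA: "isCont (\<lambda>z. baseA (fst z) (snd z)) (p, s)" unfolding baseA_def by (intro continuous_intros)
  have cB: "isCont (\<lambda>z. baseB (fst z)) (p, s)" unfolding baseB_def by (intro continuous_intros)
  have cAp: "isCont (\<lambda>z. baseA (fst z) (snd z) powr \<alpha>) (p, s)"
    using B eq using cA unfolding isCont_def by (intro tendsto_powr tendsto_const) auto
  have cBp: "isCont (\<lambda>z. baseB (fst z) powr \<alpha>) (p, s)"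
    using B using cB unfolding isCont_def by (intro tendsto_powr tendsto_const) auto
  have cN: "isCont (\<lambda>z. fst z * baseA (fst z) (snd z) powr \<alpha> + (1 - fst z) * baseB (fst z) powr \<alpha>) (p, s)"
    by (intro continuous_intros cAp cBp)
  have N0: "fst (p, s) * baseA (fst (p, s)) (snd (p, s)) powr \<alpha> + (1 - fst (p, s)) * baseB (fst (p, s)) powr \<alpha> \<noteq> 0"
    using b by (simp add: eq b_def[symmetric] N)
  have cpp: "isCont pp (p, s)"
    unfolding pp_def prob1_def by (intro isCont_divide cN N0 continuous_intros cAp)
  have cdd: "isCont dd (p, s)"
    unfolding dd_def dprob1_def using N0 B eq
    by (intro isCont_divide cN continuous_intros cAp cBp isCont_power cA cB) auto
  note lim = cpp[unfolded isCont_def] cdd[unfolded isCont_def] cA[unfolded isCont_def] cB[unfolded isCont_def]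
  have ev: "eventually P (nhds (p, s))" if "eventually P (at (p, s))" "P (p, s)" for P
    using that by (simp add: eventually_nhds_conv_at)
  \<comment> \<open>The halving places p strictly between c and 1 - c.\<close>
  define c where "c = min p (1 - p) / 2"
  have c: "0 < c" "c < p" "p < 1 - c" using p by (auto simp: c_def min_def field_simps)
  have "eventually (\<lambda>z. c < pp z) (nhds (p, s))" "eventually (\<lambda>z. pp z < 1 - c) (nhds (p, s))"
    "eventually (\<lambda>z. 1 < dd z) (nhds (p, s))" "eventually (\<lambda>z. dd z < dd (p, s) + 1) (nhds (p, s))"
    "eventually (\<lambda>z. 0 < baseA (fst z) (snd z)) (nhds (p, s))" "eventually (\<lambda>z. 0 < baseB (fst z)) (nhds (p, s))"
    using c pp dd B eq
    by (intro ev order_tendstoD(1)[OF lim(1)] order_tendstoD(2)[OF lim(1)] order_tendstoD(1)[OF lim(2)]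
        order_tendstoD(2)[OF lim(2)] order_tendstoD(1)[OF lim(3)] order_tendstoD(1)[OF lim(4)]; simp)+
  then have "eventually (\<lambda>z. c < pp z \<and> pp z < 1 - c \<and> 1 < dd z \<and> dd z < dd (p, s) + 1 \<and>
      0 < baseA (fst z) (snd z) \<and> 0 < baseB (fst z)) (nhds (p, s))"
    by eventually_elim auto
  then obtain d where d: "0 < d" and near: "\<And>z. dist z (p, s) < d \<Longrightarrow> c < pp z \<and> pp z < 1 - c \<and> 1 < dd z \<and>
      dd z < dd (p, s) + 1 \<and> 0 < baseA (fst z) (snd z) \<and> 0 < baseB (fst z)"
    unfolding eventually_nhds_metric by blast
  \<comment> \<open>Two deviations below d / 2 remain in the ball of radius d, and a deviation below
    c keeps x inside (0,1).\<close>
  define \<delta> where "\<delta> = min (d / 2) c"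
  have nd: "dist (x, t) (p, s) < d" if "\<bar>x - p\<bar> < \<delta>" "\<bar>t - s\<bar> < \<delta>" for x t
  proof -
    have "dist (x, t) (p, s) \<le> \<bar>x - p\<bar> + \<bar>t - s\<bar>"
      unfolding dist_Pair_Pair dist_real_def by (rule sqrt_sum_squares_le_sum) auto
    then show ?thesis using that by (simp add: \<delta>_def)
  qed
  have der: "((\<lambda>x. prob1 x t - x) has_real_derivative dprob1 x t - 1) (at x)"
    "0 \<le> dprob1 x t - 1" "dprob1 x t - 1 \<le> dd (p, s)" if "\<bar>x - p\<bar> < \<delta>" "\<bar>t - s\<bar> < \<delta>" for x t
  proof -
    have "0 < x" "x < 1" using that c by (auto simp: \<delta>_def)
    then show "((\<lambda>x. prob1 x t - x) has_real_derivative dprob1 x t - 1) (at x)"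
      using near[OF nd[OF that]] by (intro DERIV_diff prob1_deriv DERIV_ident) auto
    show "0 \<le> dprob1 x t - 1" "dprob1 x t - 1 \<le> dd (p, s)"
      using near[OF nd[OF that]] by (auto simp: dd_def)
  qed
  have slope: "((prob1 x t - x) - (prob1 y t - y)) / (x - y) \<in> {0..dd (p, s)}"
    if x: "\<bar>x - p\<bar> < \<delta>" and y: "\<bar>y - p\<bar> < \<delta>" and t: "\<bar>t - s\<bar> < \<delta>" and yx: "y < x" for x y t
  proof -
    have in_nb: "\<bar>z - p\<bar> < \<delta>" if "y \<le> z" "z \<le> x" for z using that x y by linarith
    obtain z where z: "y < z" "z < x"
      and eqz: "(prob1 x t - x) - (prob1 y t - y) = (x - y) * (dprob1 z t - 1)"
      using MVT2[OF yx, of "\<lambda>x. prob1 x t - x" "\<lambda>z. dprob1 z t - 1"] der(1)[OF in_nb t] by blast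
    have "((prob1 x t - x) - (prob1 y t - y)) / (x - y) = dprob1 z t - 1" unfolding eqz using yx by simp
    then show ?thesis using der(2,3)[OF in_nb t, of z] z by simp
  qed
  show ?thesis
  proof (rule that[of \<delta> c "dd (p, s)"])
    show "0 < \<delta>" "0 < c" using d c by (auto simp: \<delta>_def)
    show "c \<le> prob1 x t \<and> prob1 x t \<le> 1 - c" if "\<bar>x - p\<bar> < \<delta>" "\<bar>t - s\<bar> < \<delta>" for x t
      using near[OF nd[OF that]] by (simp add: pp_def)
    fix x y t assume *: "\<bar>x - p\<bar> < \<delta>" "\<bar>y - p\<bar> < \<delta>" "\<bar>t - s\<bar> < \<delta>" "x \<noteq> y"
    consider "y < x" | "x < y" using *(4) by linarith
    then show "((prob1 x t - x) - (prob1 y t - y)) / (x - y) \<in> {0..dd (p, s)}"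
    proof cases
      case 1
      then show ?thesis using slope * by blast
    next
      case 2
      have "((prob1 x t - x) - (prob1 y t - y)) / (x - y) = ((prob1 y t - y) - (prob1 x t - x)) / (y - x)"
        by (metis minus_diff_eq minus_divide_divide)
      then show ?thesis using slope[OF *(2,1,3) 2] by simp
    qed
  qed
qed

text \<open>If the three limits held, the path would eventually stay in the neighbourhood
  \<open>Gd\<close> with D tending to 0, which \<open>repelled\<close> forbids for each entrance
  time N, hence for all of them at once.\<close>

lemma not_tendsto_interior:
  assumes \<epsilon>: "\<epsilon> < 1 / 2" and p: "0 < p" "p < 1" and eq: "baseA p s = baseB p" and B: "0 < baseB p"
  shows "AE w in M. \<not> ((\<lambda>n. X n w 1 1) \<longlonglongrightarrow> p \<and> (\<lambda>n. X n w 2 1) \<longlonglongrightarrow> p \<and> (\<lambda>n. S n w) \<longlonglongrightarrow> s)"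
proof -
  obtain \<delta> c \<Lambda> where \<delta>: "0 < \<delta>" and c: "0 < c"
    and pr: "\<And>x t. \<bar>x - p\<bar> < \<delta> \<Longrightarrow> \<bar>t - s\<bar> < \<delta> \<Longrightarrow> c \<le> prob1 x t \<and> prob1 x t \<le> 1 - c"
    and slope: "\<And>x y t. \<bar>x - p\<bar> < \<delta> \<Longrightarrow> \<bar>y - p\<bar> < \<delta> \<Longrightarrow> \<bar>t - s\<bar> < \<delta> \<Longrightarrow> x \<noteq> y \<Longrightarrow>
      ((prob1 x t - x) - (prob1 y t - y)) / (x - y) \<in> {0..\<Lambda>}"
    by (rule repelling_neighbourhood[OF \<epsilon> p eq B]) (rule that; assumption)
  have i1: "(1::nat) \<in> {1..m}" and i2: "(2::nat) \<in> {1..m}" using two_le_m by auto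
  define D where "D n w = X n w 1 1 - X n w 2 1" for n w
  define P where "P i n w = tp n w i 1" for i n w
  define b where "b i n = (indicator (visit i n 1) :: 'a \<Rightarrow> real)" for i n
  define e where "e n w = b 1 n w - b 2 n w - (P 1 n w - P 2 n w)" for n w
  define Gd where "Gd n = {w \<in> space M. \<bar>X n w 1 1 - p\<bar> < \<delta> \<and> \<bar>X n w 2 1 - p\<bar> < \<delta> \<and> \<bar>S n w - s\<bar> < \<delta>}" for n
  \<comment> \<open>The slope of the drift between the two frequencies. Division by zero gives 0
    when they agree; both drifts agree then as well, so the recursion for D remains true. The
    indicator makes the bounds on lam global.\<close>
  define lam where "lam n w = indicator (Gd n) w * (((P 1 n w - X n w 1 1) - (P 2 n w - X n w 2 1)) / D n w)" for n w
  have Peq: "P i n w = prob1 (X n w i 1) (S n w)" if "i \<in> {1..m}" "w \<in> space M" for i n w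
    unfolding P_def by (rule tp_eq[OF that])
  have Pm: "bounded_measurable (F n) (P i n)" if "i \<in> {1..m}" for i n
    unfolding P_def[abs_def] by (rule bm_tp[OF that one_vertex])
  note [measurable] = bounded_measurableD[OF bm_S] bounded_measurableD[OF Pm[OF i1]] bounded_measurableD[OF Pm[OF i2]]
  have Dm [measurable]: "D n \<in> borel_measurable (F n)" for n unfolding D_def[abs_def] by measurable
  have Gm: "Gd n \<in> sets (F n)" for n
  proof -
    have "Gd n = {w \<in> space (F n). \<bar>X n w 1 1 - p\<bar> < \<delta> \<and> \<bar>X n w 2 1 - p\<bar> < \<delta> \<and> \<bar>S n w - s\<bar> < \<delta>}"
      by (simp add: Gd_def)
    also have "\<dots> \<in> sets (F n)" by measurable
    finally show ?thesis .
  qed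
  have GE: "Gd n \<in> events" for n
    using Gm[of n] subalgebra_star_history[of n] by (auto simp: subalgebra_def)
  note [measurable] = Gm
  \<comment> \<open>The interval of slopes is nonempty because it contains an actual slope, at p and
    p + \<delta> / 2.\<close>
  have \<Lambda>: "0 \<le> \<Lambda>" using slope[of p "p + \<delta> / 2" s] \<delta> by (simp add: abs_if)
  have lam01: "lam n w \<in> {0..\<Lambda>}" if sp: "w \<in> space M" for n w
  proof (cases "w \<in> Gd n \<and> D n w \<noteq> 0")
    case True
    then show ?thesis
      using slope[of "X n w 1 1" "X n w 2 1" "S n w"] Peq[OF i1 sp] Peq[OF i2 sp]
      by (simp add: lam_def D_def Gd_def)
  next
    case False
    then have "lam n w = 0" by (auto simp: lam_def)
    then show ?thesis using \<Lambda> by simp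
  qed
  have bM: "bounded_measurable M (b i n)" if "i \<in> {1..m}" for i n
    unfolding b_def by (intro bm_intros visit_events that one_vertex)
  have eM: "bounded_measurable M (e n)" for n
    unfolding e_def[abs_def] by (intro bm_intros bM bm_M[OF Pm] i1 i2)
  note int = bounded_measurable_integrable
  have IG: "bounded_measurable (F n) (indicator (Gd n))" for n by (intro bm_intros Gm)
  note bms = bM[OF i1] bM[OF i2] bm_M[OF Pm[OF i1]] bm_M[OF Pm[OF i2]] Pm[OF i1] Pm[OF i2]
  have E1: "(\<integral>w. g w * b i n w \<partial>M) = (\<integral>w. g w * P i n w \<partial>M)"
    if "i \<in> {1..m}" "bounded_measurable (F n) g" for i n g
    unfolding b_def P_def by (rule integral_visit[OF that(1) one_vertex that(2)])
  have E2: "(\<integral>w. g w * (b 1 n w * b 2 n w) \<partial>M) = (\<integral>w. g w * (P 1 n w * P 2 n w) \<partial>M)"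
    if "bounded_measurable (F n) g" for n g
    unfolding b_def P_def by (rule integral_visit_visit[OF i1 i2 _ that]) simp
  have mean: "(\<integral>w. g w * e n w \<partial>M) = 0" if g: "bounded_measurable (F n) g" for n g
  proof -
    have gM: "bounded_measurable M g" by (rule bm_M[OF g])
    have "(\<integral>w. g w * e n w \<partial>M)
        = (\<integral>w. (g w * b 1 n w - g w * b 2 n w) - (g w * P 1 n w - g w * P 2 n w) \<partial>M)"
      by (intro Bochner_Integration.integral_cong) (auto simp: e_def algebra_simps)
    also have "\<dots> = ((\<integral>w. g w * b 1 n w \<partial>M) - (\<integral>w. g w * b 2 n w \<partial>M))
        - ((\<integral>w. g w * P 1 n w \<partial>M) - (\<integral>w. g w * P 2 n w \<partial>M))"
      by (simp only: Bochner_Integration.integral_diff int bm_intros gM bms)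
    also have "\<dots> = 0" using E1[OF i1 g] E1[OF i2 g] by simp
    finally show ?thesis .
  qed
  \<comment> \<open>The conditional variance of a difference of two independent indicators is the
    sum of their variances. Expanding the square leaves only terms covered by \<open>E1\<close> and
    \<open>E2\<close>.\<close>
  have second: "(\<integral>w. g w * (e n w)\<^sup>2 \<partial>M)
      = (\<integral>w. g w * (P 1 n w * (1 - P 1 n w) + P 2 n w * (1 - P 2 n w)) \<partial>M)"
    if g: "bounded_measurable (F n) g" for n g
  proof -
    have gM: "bounded_measurable M g" by (rule bm_M[OF g])
    define d where "d w = P 1 n w - P 2 n w" for w
    have dF: "bounded_measurable (F n) d" unfolding d_def[abs_def] by (intro bm_intros bms)
    define g1 g2 where "g1 w = g w * (1 - 2 * d w)" and "g2 w = g w * (1 + 2 * d w)" for w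
    define g3 where "g3 w = g w * (d w)\<^sup>2" for w
    have gF: "bounded_measurable (F n) g1" "bounded_measurable (F n) g2" "bounded_measurable (F n) g3"
      unfolding g1_def[abs_def] g2_def[abs_def] g3_def[abs_def] by (intro bm_intros g dF)+
    note gMs = gM bm_M[OF gF(1)] bm_M[OF gF(2)] bm_M[OF gF(3)]
    have bb: "b i n w * b i n w = b i n w" for i w by (simp add: b_def indicator_def)
    have "(\<integral>w. g w * (e n w)\<^sup>2 \<partial>M)
        = (\<integral>w. g1 w * b 1 n w + g2 w * b 2 n w - 2 * (g w * (b 1 n w * b 2 n w)) + g3 w \<partial>M)"
    proof (intro Bochner_Integration.integral_cong refl)
      fix w
      have "(e n w)\<^sup>2 = b 1 n w * b 1 n w + b 2 n w * b 2 n w - 2 * (b 1 n w * b 2 n w)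
          - 2 * d w * b 1 n w + 2 * d w * b 2 n w + (d w)\<^sup>2"
      proof -
        have "e n w = b 1 n w - b 2 n w - d w" by (simp add: e_def d_def)
        then show ?thesis unfolding power2_eq_square by (simp only:) (simp add: algebra_simps)
      qed
      then have sq: "(e n w)\<^sup>2 = (1 - 2 * d w) * b 1 n w + (1 + 2 * d w) * b 2 n w - 2 * (b 1 n w * b 2 n w) + (d w)\<^sup>2"
        unfolding bb by (simp add: algebra_simps)
      then show "g w * (e n w)\<^sup>2 = g1 w * b 1 n w + g2 w * b 2 n w - 2 * (g w * (b 1 n w * b 2 n w)) + g3 w"
        unfolding sq g1_def g2_def g3_def by (simp add: algebra_simps)
    qed
    also have "\<dots> = (\<integral>w. g1 w * b 1 n w \<partial>M) + (\<integral>w. g2 w * b 2 n w \<partial>M)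
        - 2 * (\<integral>w. g w * (b 1 n w * b 2 n w) \<partial>M) + (\<integral>w. g3 w \<partial>M)"
      by (simp only: Bochner_Integration.integral_diff Bochner_Integration.integral_add integral_mult_right_zero
          int bm_intros gMs bms)
    also have "\<dots> = (\<integral>w. g1 w * P 1 n w \<partial>M) + (\<integral>w. g2 w * P 2 n w \<partial>M)
        - 2 * (\<integral>w. g w * (P 1 n w * P 2 n w) \<partial>M) + (\<integral>w. g3 w \<partial>M)"
      by (simp only: E1[OF i1 gF(1)] E1[OF i2 gF(2)] E2[OF g])
    also have "\<dots> = (\<integral>w. g1 w * P 1 n w + g2 w * P 2 n w - 2 * (g w * (P 1 n w * P 2 n w)) + g3 w \<partial>M)"
      by (simp only: Bochner_Integration.integral_diff Bochner_Integration.integral_add integral_mult_right_zero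
          int bm_intros gMs bms)
    also have "\<dots> = (\<integral>w. g w * (P 1 n w * (1 - P 1 n w) + P 2 n w * (1 - P 2 n w)) \<partial>M)"
      by (intro Bochner_Integration.integral_cong)
        (auto simp: g1_def g2_def g3_def d_def power2_eq_square algebra_simps)
    finally show ?thesis .
  qed
  have rep: "AE w in M. \<not> ((\<forall>n\<ge>N. w \<in> Gd n) \<and> (\<lambda>n. D n w) \<longlonglongrightarrow> 0)" for N
  proof -
    interpret R: repelling_noise M F D lam e Gd N "c\<^sup>2" \<Lambda>
    proof unfold_locales
      show "subalgebra M (F n)" for n by (rule subalgebra_star_history)
      show "n \<le> k \<Longrightarrow> sets (F n) \<subseteq> sets (F k)" for n k by (rule F_mono)
      show "D n \<in> borel_measurable (F n)" for n by (rule Dm)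
      show "\<bar>D n w\<bar> \<le> 1" for n w
        using X1_range[OF i1, of n w] X1_range[OF i2, of n w] unfolding D_def by linarith
      show "lam n \<in> borel_measurable (F n)" for n unfolding lam_def[abs_def] by measurable
      show "0 \<le> lam n w" "lam n w \<le> \<Lambda>" if "w \<in> space M" for n w using lam01[OF that, of n] by auto
      show "e n \<in> borel_measurable M" for n by (rule bounded_measurableD[OF eM])
      show "\<bar>e n w\<bar> \<le> 2" for n w
      proof -
        have "\<bar>b 1 n w - b 2 n w\<bar> \<le> 1" by (auto simp: b_def indicator_def)
        moreover have "\<bar>P 1 n w - P 2 n w\<bar> \<le> 1"
          using tp_bounds[OF i1 one_vertex, of n w] tp_bounds[OF i2 one_vertex, of n w]
          unfolding P_def by linarith
        ultimately show ?thesis unfolding e_def by linarith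
      qed
      show "Gd n \<in> sets (F n)" for n by (rule Gm)
      show "D (Suc n) w = D n w * (1 + lam n w / (real n + 3)) + e n w / (real n + 3)"
        if "N \<le> n" "w \<in> Gd n" for n w
      proof -
        have sp: "w \<in> space M" using that by (simp add: Gd_def)
        have lD: "D n w * lam n w = (P 1 n w - X n w 1 1) - (P 2 n w - X n w 2 1)"
        proof (cases "D n w = 0")
          case True
          then have "X n w 1 1 = X n w 2 1" by (simp add: D_def)
          then show ?thesis using True Peq[OF i1 sp, of n] Peq[OF i2 sp, of n] by simp
        next
          case False
          then show ?thesis using that by (simp add: lam_def)
        qed
        have st: "X (Suc n) w i 1 = X n w i 1 + (b i n w - X n w i 1) / (real n + 3)" if "i \<in> {1..m}" for i
          unfolding b_def by (rule X_step[OF that one_vertex sp])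
        have "D (Suc n) w = D n w + ((b 1 n w - b 2 n w) - (X n w 1 1 - X n w 2 1)) / (real n + 3)"
          unfolding D_def st[OF i1] st[OF i2] by (simp add: diff_divide_distrib)
        also have "(b 1 n w - b 2 n w) - (X n w 1 1 - X n w 2 1) = D n w * lam n w + e n w"
          unfolding lD by (simp add: e_def)
        finally show ?thesis by (simp add: add_divide_distrib distrib_left)
      qed
      show "(\<integral>w. g w * indicator (Gd n) w * e n w \<partial>M) = 0"
        if "N \<le> n" "bounded_measurable (F n) g" for n g
        by (intro mean bm_intros that IG)
      show "c\<^sup>2 * (\<integral>w. g w * indicator (Gd n) w \<partial>M) \<le> (\<integral>w. g w * indicator (Gd n) w * (e n w)\<^sup>2 \<partial>M)"
        if "N \<le> n" and g: "bounded_measurable (F n) g" and g0: "\<And>w. w \<in> space M \<Longrightarrow> 0 \<le> g w" for n g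
      proof -
        have "c\<^sup>2 * (\<integral>w. g w * indicator (Gd n) w \<partial>M) = (\<integral>w. c\<^sup>2 * (g w * indicator (Gd n) w) \<partial>M)" by simp
        also have "\<dots> \<le> (\<integral>w. g w * indicator (Gd n) w * (P 1 n w * (1 - P 1 n w) + P 2 n w * (1 - P 2 n w)) \<partial>M)"
        proof (intro integral_mono int bm_intros bms bm_M[OF g] GE)
          fix w assume sp: "w \<in> space M"
          show "c\<^sup>2 * (g w * indicator (Gd n) w)
              \<le> g w * indicator (Gd n) w * (P 1 n w * (1 - P 1 n w) + P 2 n w * (1 - P 2 n w))"
          proof (cases "w \<in> Gd n")
            case True
            have "c\<^sup>2 \<le> P i n w * (1 - P i n w)" if i: "i = 1 \<or> i = 2" for i
            proof -
              have im: "i \<in> {1..m}" using i i1 i2 by auto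
              have "c \<le> P i n w" "c \<le> 1 - P i n w"
                using pr[of "X n w i 1" "S n w"] True i Peq[OF im sp, of n] by (auto simp: Gd_def)
              then show ?thesis unfolding power2_eq_square using c by (intro mult_mono) auto
            qed
            from this[of 1] this[of 2] have "c\<^sup>2 \<le> P 1 n w * (1 - P 1 n w) + P 2 n w * (1 - P 2 n w)"
              using zero_le_power2[of c] by linarith
            from mult_left_mono[OF this g0[OF sp]] True show ?thesis by (simp add: mult.commute)
          qed simp
        qed
        also have "\<dots> = (\<integral>w. g w * indicator (Gd n) w * (e n w)\<^sup>2 \<partial>M)"
          by (intro second[symmetric] bm_intros g IG)
        finally show ?thesis .
      qed
      show "0 < c\<^sup>2" using c by simp
    qed
    show ?thesis by (rule R.repelled)
  qed
  then have "AE w in M. \<forall>N. \<not> ((\<forall>n\<ge>N. w \<in> Gd n) \<and> (\<lambda>n. D n w) \<longlonglongrightarrow> 0)"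
    by (simp only: AE_all_countable) blast
  then show ?thesis
    using AE_space
  proof eventually_elim
    case (elim w)
    show ?case
    proof safe
      assume 1: "(\<lambda>n. X n w 1 1) \<longlonglongrightarrow> p" and 2: "(\<lambda>n. X n w 2 1) \<longlonglongrightarrow> p" and 3: "(\<lambda>n. S n w) \<longlonglongrightarrow> s"
      have D0: "(\<lambda>n. D n w) \<longlonglongrightarrow> 0" using tendsto_diff[OF 1 2] by (simp add: D_def)
      have "eventually (\<lambda>n. \<bar>X n w 1 1 - p\<bar> < \<delta>) sequentially" "eventually (\<lambda>n. \<bar>X n w 2 1 - p\<bar> < \<delta>) sequentially"
        "eventually (\<lambda>n. \<bar>S n w - s\<bar> < \<delta>) sequentially"
        using tendstoD[OF 1 \<delta>] tendstoD[OF 2 \<delta>] tendstoD[OF 3 \<delta>] by (auto simp: dist_real_def)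
      then have "eventually (\<lambda>n. w \<in> Gd n) sequentially"
        by eventually_elim (use elim in \<open>auto simp: Gd_def\<close>)
      then obtain N where "\<forall>n\<ge>N. w \<in> Gd n" by (auto simp: eventually_sequentially)
      with elim D0 show False by blast
    qed
  qed
qed

subsection \<open>Identification of the limit\<close>

lemma X_slow:
  assumes "i \<in> {1..m}" "w \<in> space M"
  shows "(\<lambda>n. X (Suc n) w i 1 - X n w i 1) \<longlonglongrightarrow> 0"
proof (rule Lim_null_comparison)
  show "\<forall>\<^sub>F n in sequentially. norm (X (Suc n) w i 1 - X n w i 1) \<le> 1 / real (n + 3)"
    using h_bound[OF assms(1), of _ w] X1_step[OF assms] by (intro always_eventually) (simp add: add.commute)
  show "(\<lambda>n. 1 / real (n + 3)) \<longlonglongrightarrow> 0"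
    using LIMSEQ_ignore_initial_segment[OF lim_1_over_n, of 3] by simp
qed

definition den :: "nat \<Rightarrow> nat \<Rightarrow> 'a \<Rightarrow> real" where
  "den i n w = X n w i 1 * star_H m \<alpha> \<epsilon> \<eta> (X n w) i 1 + X n w i (i + 1) * star_H m \<alpha> \<epsilon> \<eta> (X n w) i (i + 1)"

text \<open>The ratio of transition probability to frequency is H / den, so separated eventual
  bounds on H and den give the margin R / r - 1. Bounds rather than limits are assumed because for
  \<epsilon> = 0 convergence of the other walks is not established.\<close>

lemma expanding_if_H_ge:
  assumes i: "i \<in> {1..m}" and v: "v \<in> star_vertices i" and rR: "0 < r" "r < R"
    and H: "eventually (\<lambda>n. R \<le> star_H m \<alpha> \<epsilon> \<eta> (X n w) i v) sequentially"
    and N: "eventually (\<lambda>n. den i n w \<le> r) sequentially"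
  shows "\<exists>c>0. eventually (\<lambda>n. (1 + c) * X n w i v \<le> tp n w i v) sequentially"
proof (intro exI conjI)
  show "0 < R / r - 1" using rR by simp
  show "eventually (\<lambda>n. (1 + (R / r - 1)) * X n w i v \<le> tp n w i v) sequentially"
    using H N
  proof eventually_elim
    case (elim n)
    let ?a = "X n w i v * star_H m \<alpha> \<epsilon> \<eta> (X n w) i v"
    have "0 < ?a" using elim rR X_pos[OF i v, of n w] by (intro mult_pos_pos) auto
    moreover have "?a \<le> den i n w"
    proof -
      have "0 \<le> X n w i u * star_H m \<alpha> \<epsilon> \<eta> (X n w) i u" if "u \<in> star_vertices i" for u
        using X_pos[OF i that, of n w] H_nonneg by (intro mult_nonneg_nonneg) auto
      from this[OF one_vertex] this[OF succ_vertex] v show ?thesis by (auto simp: den_def star_vertices_def)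
    qed
    ultimately have d: "0 < den i n w" by linarith
    have "(1 + (R / r - 1)) * X n w i v = X n w i v * R / r" by simp
    also have "\<dots> \<le> X n w i v * R / den i n w"
      using d elim rR X_pos[OF i v, of n w] by (intro divide_left_mono mult_nonneg_nonneg mult_pos_pos) auto
    also have "\<dots> \<le> ?a / den i n w"
      using d elim X_pos[OF i v, of n w] by (intro divide_right_mono mult_left_mono) auto
    also have "\<dots> = tp n w i v" by (simp add: star_pi_def den_def)
    finally show ?case .
  qed
qed

lemma expanding_if_limits:
  assumes i: "i \<in> {1..m}" and v: "v \<in> star_vertices i" and ba: "0 < b" "b < a"
    and H: "(\<lambda>n. star_H m \<alpha> \<epsilon> \<eta> (X n w) i v) \<longlonglongrightarrow> a" and N: "(\<lambda>n. den i n w) \<longlonglongrightarrow> b"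
  shows "\<exists>c>0. eventually (\<lambda>n. (1 + c) * X n w i v \<le> tp n w i v) sequentially"
proof (rule expanding_if_H_ge[OF i v])
  \<comment> \<open>The two points dividing the interval from b to a into thirds.\<close>
  define r R where "r = (2 * b + a) / 3" and "R = (b + 2 * a) / 3"
  show "0 < r" "r < R" using ba by (auto simp: r_def R_def)
  show "eventually (\<lambda>n. R \<le> star_H m \<alpha> \<epsilon> \<eta> (X n w) i v) sequentially"
    using order_tendstoD(1)[OF H, of R] ba by (auto simp: R_def elim: eventually_mono)
  show "eventually (\<lambda>n. den i n w \<le> r) sequentially"
    using order_tendstoD(2)[OF N, of r] ba by (auto simp: r_def elim: eventually_mono)
qed

text \<open>For \<epsilon> = 0, -G k is the sum of the other frequencies and dominates each of them,
  so the vanishing of \<Psi> yields x k (1 - x k) x k' \<rightarrow> 0 for k \<noteq> k'. Using this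
  for both orders, y = x i x j satisfies y (1 - y) \<rightarrow> 0 and, being slow, tends to 0 or 1.
  The limit 1 would make walk i desert its leaf although the leaf is favoured.\<close>

lemma products_tendsto_0:
  assumes \<epsilon>: "\<epsilon> = 0"
  shows "AE w in M. \<forall>i\<in>{1..m}. \<forall>j\<in>{1..m}. i \<noteq> j \<longrightarrow> (\<lambda>n. X n w i 1 * X n w j 1) \<longlonglongrightarrow> 0"
  using Psi_tendsto_0 not_tendsto_0_if_expanding AE_space
proof eventually_elim
  case (elim w)
  show ?case
  proof (intro ballI impI)
    fix i j assume i: "i \<in> {1..m}" and j: "j \<in> {1..m}" and ij: "i \<noteq> j"
    let ?x = "\<lambda>k n. X n w k 1"
    have x01: "0 \<le> ?x k n" "?x k n \<le> 1" if "k \<in> {1..m}" for k n using X1_range[OF that] by auto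
    have others: "?x k' n \<le> S n w - ?x k n" if k: "k \<in> {1..m}" "k' \<in> {1..m}" "k \<noteq> k'" for k k' n
    proof -
      have "S n w = ?x k n + (\<Sum>u\<in>{1..m} - {k}. ?x u n)"
        unfolding S_def using k by (intro sum.remove) auto
      moreover have "?x k' n \<le> (\<Sum>u\<in>{1..m} - {k}. ?x u n)"
        using k x01 by (intro member_le_sum) auto
      ultimately show ?thesis by simp
    qed
    have u0: "(\<lambda>n. ?x k n * (1 - ?x k n) * ?x k' n) \<longlonglongrightarrow> 0" if k: "k \<in> {1..m}" "k' \<in> {1..m}" "k \<noteq> k'" for k k'
    proof (rule Lim_null_comparison)
      show "(\<lambda>n. sqrt (\<Psi> k n w)) \<longlonglongrightarrow> 0"
        using tendsto_real_sqrt[of "\<lambda>n. \<Psi> k n w" 0] elim(1) k by simp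
      show "\<forall>\<^sub>F n in sequentially. norm (?x k n * (1 - ?x k n) * ?x k' n) \<le> sqrt (\<Psi> k n w)"
      proof (intro always_eventually allI)
        fix n
        let ?u = "?x k n * (1 - ?x k n)"
        have u: "0 \<le> ?u" "?u \<le> 1" using x01[OF k(1), of n] by (auto intro: mult_le_one)
        have "(?x k' n)\<^sup>2 \<le> (S n w - ?x k n)\<^sup>2"
          using others[OF k, of n] x01[OF k(2), of n] by (intro power_mono) auto
        also have "\<dots> = (G k n w)\<^sup>2" unfolding G_def using \<epsilon> by (simp add: power2_commute)
        finally have "?u * (?x k' n)\<^sup>2 \<le> \<Psi> k n w" unfolding \<Psi>_def using u by (intro mult_left_mono)
        \<comment> \<open>\<Psi> contains ?u to the first power only; as ?u \<le> 1, squaring it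
          only decreases the product.\<close>
        moreover have "(?u * ?x k' n)\<^sup>2 \<le> ?u * (?x k' n)\<^sup>2"
        proof -
          have "(?u * ?x k' n)\<^sup>2 = ?u * (?u * (?x k' n)\<^sup>2)" by (simp add: power2_eq_square)
          also have "\<dots> \<le> 1 * (?u * (?x k' n)\<^sup>2)" using u by (intro mult_right_mono) auto
          finally show ?thesis by simp
        qed
        ultimately have "sqrt ((?u * ?x k' n)\<^sup>2) \<le> sqrt (\<Psi> k n w)" by (intro real_sqrt_le_mono) linarith
        then show "norm (?u * ?x k' n) \<le> sqrt (\<Psi> k n w)" by simp
      qed
    qed
    define y where "y n = ?x i n * ?x j n" for n
    have y01: "0 \<le> y n" "y n \<le> 1" "y n \<le> ?x i n" "y n \<le> ?x j n" for n
      using x01[OF i, of n] x01[OF j, of n]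
      by (auto simp: y_def mult_le_one intro: mult_left_le mult_left_le_one_le mult_right_le_one_le)
    have "\<exists>c\<in>{0, 1}. y \<longlonglongrightarrow> c"
    proof (rule slow_tendsto_finite)
      have "(\<lambda>n. y n * (y n - 1)) \<longlonglongrightarrow> 0"
      proof (rule Lim_null_comparison)
        let ?b = "\<lambda>n. ?x i n * (1 - ?x i n) * ?x j n + ?x j n * (1 - ?x j n) * ?x i n"
        show "?b \<longlonglongrightarrow> 0"
          using tendsto_add[OF u0[OF i j ij] u0[OF j i]] ij by simp
        show "\<forall>\<^sub>F n in sequentially. norm (y n * (y n - 1)) \<le> ?b n"
        proof (intro always_eventually allI)
          fix n
          let ?w = "?x j n * (1 - ?x j n) * ?x i n"
          have w0: "0 \<le> ?w" using x01[OF i, of n] x01[OF j, of n] by simp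
          have "norm (y n * (y n - 1)) = y n * (1 - y n)" using y01[of n] by (simp add: abs_mult)
          also have "\<dots> = ?x i n * (1 - ?x i n) * ?x j n + ?x i n * ?w"
            by (simp add: y_def algebra_simps)
          also have "?x i n * ?w \<le> 1 * ?w" using x01[OF i, of n] w0 by (intro mult_right_mono) auto
          finally show "norm (y n * (y n - 1)) \<le> ?b n" by simp
        qed
      qed
      then show "(\<lambda>n. \<Prod>c\<in>{0, 1}. y n - c) \<longlonglongrightarrow> 0" by simp
      show "(\<lambda>n. y (Suc n) - y n) \<longlonglongrightarrow> 0"
      proof (rule Lim_null_comparison)
        show "(\<lambda>n. \<bar>?x i (Suc n) - ?x i n\<bar> + \<bar>?x j (Suc n) - ?x j n\<bar>) \<longlonglongrightarrow> 0"
          using tendsto_add[OF tendsto_rabs[OF X_slow[OF i elim(3)]] tendsto_rabs[OF X_slow[OF j elim(3)]]] by simp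
        show "\<forall>\<^sub>F n in sequentially. norm (y (Suc n) - y n) \<le> \<bar>?x i (Suc n) - ?x i n\<bar> + \<bar>?x j (Suc n) - ?x j n\<bar>"
        proof (intro always_eventually allI)
          fix n
          have "y (Suc n) - y n = (?x i (Suc n) - ?x i n) * ?x j (Suc n) + ?x i n * (?x j (Suc n) - ?x j n)"
            by (simp add: y_def algebra_simps)
          then have "\<bar>y (Suc n) - y n\<bar>
              \<le> \<bar>?x i (Suc n) - ?x i n\<bar> * \<bar>?x j (Suc n)\<bar> + \<bar>?x i n\<bar> * \<bar>?x j (Suc n) - ?x j n\<bar>"
            by (metis abs_mult abs_triangle_ineq)
          also have "\<dots> \<le> \<bar>?x i (Suc n) - ?x i n\<bar> * 1 + 1 * \<bar>?x j (Suc n) - ?x j n\<bar>"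
            using x01[OF i, of n] x01[OF j, of "Suc n"] by (intro add_mono mult_left_mono mult_right_mono) auto
          finally show "norm (y (Suc n) - y n) \<le> \<bar>?x i (Suc n) - ?x i n\<bar> + \<bar>?x j (Suc n) - ?x j n\<bar>" by simp
        qed
      qed
    qed simp
    moreover have "\<not> y \<longlonglongrightarrow> 1"
    proof
      assume y1: "y \<longlonglongrightarrow> 1"
      have to1: "(\<lambda>n. ?x k n) \<longlonglongrightarrow> 1" if k: "k = i \<or> k = j" for k
      proof (rule tendsto_sandwich[OF _ _ y1 tendsto_const])
        show "\<forall>\<^sub>F n in sequentially. y n \<le> ?x k n" using y01 k by (intro always_eventually) auto
        show "\<forall>\<^sub>F n in sequentially. ?x k n \<le> 1" using x01 k i j by (intro always_eventually) auto
      qed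
      have q0: "(\<lambda>n. X n w i (i + 1)) \<longlonglongrightarrow> 0"
        using tendsto_diff[OF tendsto_const[of 1] to1[of i]] X_sum[OF elim(3) i] by simp
      have eta: "1 < \<eta>" "0 < \<eta>" using eta_gt \<epsilon> two_le_m by auto
      \<comment> \<open>Once x j > 1/2, the base at the centre is at most \<eta> - 1/2, while the
        base at the leaf is \<eta>.\<close>
      define a b where "a = \<eta> powr \<alpha>" and "b = (\<eta> - 1 / 2) powr \<alpha>"
      have b: "0 < b" "b < a"
        unfolding a_def b_def using eta alpha_pos by (auto intro: powr_less_mono2)
      have H2: "star_H m \<alpha> \<epsilon> \<eta> (X n w) i (i + 1) = a" for n
        unfolding H_eq(2)[OF i elim(3)] baseB_def a_def using \<epsilon> by simp
      have "\<exists>c>0. eventually (\<lambda>n. (1 + c) * X n w i (i + 1) \<le> tp n w i (i + 1)) sequentially"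
      proof (rule expanding_if_H_ge[OF i succ_vertex])
        show "0 < (a + b) / 2" "(a + b) / 2 < a" using b by auto
        show "eventually (\<lambda>n. a \<le> star_H m \<alpha> \<epsilon> \<eta> (X n w) i (i + 1)) sequentially" using H2 by simp
        have "(\<lambda>n. b + X n w i (i + 1) * a) \<longlonglongrightarrow> b + 0 * a" by (intro tendsto_intros q0)
        then have "eventually (\<lambda>n. b + X n w i (i + 1) * a < (a + b) / 2) sequentially"
          using b by (intro order_tendstoD(2)) auto
        moreover have "eventually (\<lambda>n. ?x j n > 1 / 2) sequentially"
          using to1[of j] by (intro order_tendstoD(1)) auto
        ultimately show "eventually (\<lambda>n. den i n w \<le> (a + b) / 2) sequentially"
        proof eventually_elim
          case (elim n)
          have "star_H m \<alpha> \<epsilon> \<eta> (X n w) i 1 = baseA (?x i n) (S n w) powr \<alpha>"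
            by (rule H_eq(1)[OF i \<open>w \<in> space M\<close>])
          also have "\<dots> \<le> b"
            unfolding b_def
          proof (rule powr_mono2)
            show "0 \<le> baseA (?x i n) (S n w)"
              using base_bounds(1)[OF x01[OF i] S_bounds[OF i], of n] eta_gt by simp
            show "baseA (?x i n) (S n w) \<le> \<eta> - 1 / 2"
              unfolding baseA_def using others[OF i j ij, of n] elim \<epsilon> by simp
          qed (use alpha_pos in simp)
          finally have "?x i n * star_H m \<alpha> \<epsilon> \<eta> (X n w) i 1 \<le> 1 * b"
            using x01[OF i, of n] H_nonneg by (intro mult_mono) auto
          then show ?case using elim unfolding den_def H2 by simp
        qed
      qed
      then show False using elim(2) i succ_vertex q0 by blast
    qed
    ultimately show "(\<lambda>n. X n w i 1 * X n w j 1) \<longlonglongrightarrow> 0" by (auto simp: y_def[abs_def])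
  qed
qed

text \<open>The vanishing of \<Psi> forces every joint subsequential limit to solve the equilibrium
  equations, so each coordinate can accumulate only at finitely many values and converges. The
  instability of boundary values then restricts the support K of the limit.\<close>

lemma AE_converges:
  assumes \<epsilon>: "0 < \<epsilon>" "\<epsilon> < 1" "\<epsilon> \<noteq> 1 / 2"
  shows "AE w in M. \<exists>l K. K \<noteq> {} \<and> K \<subseteq> {1..m} \<and> (\<forall>i\<in>{1..m}. (\<lambda>n. X n w i 1) \<longlonglongrightarrow> l i) \<and>
    (\<forall>i\<in>K. l i = \<epsilon> / (real (card K) + 2 * \<epsilon> - 1)) \<and> (\<forall>i\<in>{1..m} - K. l i = 0) \<and>
    (1 / 2 < \<epsilon> \<longrightarrow> K = {1..m})"
  using Psi_tendsto_0 not_tendsto_0_if_expanding AE_space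
proof eventually_elim
  case (elim w)
  let ?x = "\<lambda>k n. X n w k 1"
  let ?eq = "\<lambda>l i. l i * (1 - l i) * (\<epsilon> - (\<Sum>j\<in>{1..m}. l j) + (1 - 2 * \<epsilon>) * l i)\<^sup>2"
  have x01: "?x k n \<in> {0..1}" if "k \<in> {1..m}" for k n using X1_range[OF that] by auto
  have lim_eq: "?eq l i = 0" and lim01: "0 \<le> l i" "l i \<le> 1"
    if r: "strict_mono r" and l: "\<And>j. j \<in> {1..m} \<Longrightarrow> (\<lambda>n. ?x j (r n)) \<longlonglongrightarrow> l j" and i: "i \<in> {1..m}"
    for r :: "nat \<Rightarrow> nat" and l i
  proof -
    have "(\<lambda>n. \<Psi> i (r n) w) \<longlonglongrightarrow> ?eq l i"
      unfolding \<Psi>_def G_def S_def by (intro tendsto_intros l i)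
    moreover have "(\<lambda>n. \<Psi> i (r n) w) \<longlonglongrightarrow> 0"
      using LIMSEQ_subseq_LIMSEQ[of "\<lambda>n. \<Psi> i n w" 0 r] elim(1) i r by (simp add: o_def)
    ultimately show "?eq l i = 0" by (rule LIMSEQ_unique)
    show "0 \<le> l i" "l i \<le> 1"
      using x01[OF i] by (auto intro!: LIMSEQ_le_const[OF l[OF i]] LIMSEQ_le_const2[OF l[OF i]])
  qed
  \<comment> \<open>The two boundary values and the common interior value for each support size up
    to m.\<close>
  define V where "V = {0, 1} \<union> (\<lambda>k. \<epsilon> / (real k + 2 * \<epsilon> - 1)) ` {..m}"
  have finV: "finite V" by (simp add: V_def)
  have "\<exists>c\<in>V. (\<lambda>n. ?x i n) \<longlonglongrightarrow> c" if i: "i \<in> {1..m}" for i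
  proof (rule slow_tendsto_finite[OF finV _ X_slow[OF i elim(3)]])
    show "(\<lambda>n. \<Prod>c\<in>V. ?x i n - c) \<longlonglongrightarrow> 0"
    proof (rule LIMSEQ_if_subseq)
      fix r :: "nat \<Rightarrow> nat" assume r: "strict_mono r"
      have "\<exists>s. strict_mono s \<and> (\<exists>l. \<forall>k\<in>{1..m}. ((\<lambda>n. ?x k (r n)) \<circ> s) \<longlonglongrightarrow> l k)"
        by (rule finite_bounded_imp_convergent_subsequence[where a = 0 and b = 1]) (use x01 in auto)
      then obtain s l where s: "strict_mono s" and l: "\<forall>k\<in>{1..m}. ((\<lambda>n. ?x k (r n)) \<circ> s) \<longlonglongrightarrow> l k"
        by (elim exE conjE) rule
      have l': "(\<lambda>n. ?x k ((r \<circ> s) n)) \<longlonglongrightarrow> l k" if "k \<in> {1..m}" for k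
        using l that by (simp add: o_def)
      note rs = strict_mono_o[OF r s]
      have "l i \<in> V"
      proof (cases "0 < l i \<and> l i < 1")
        case True
        let ?K = "{j \<in> {1..m}. l j \<noteq> 0}"
        have "l i = \<epsilon> / (real (card ?K) + 2 * \<epsilon> - 1)"
          using equilibrium_interior(1)[OF \<epsilon> lim01[OF rs l'] lim_eq[OF rs l'] i] True i by auto
        moreover have "card ?K \<le> card {1..m}" by (rule card_mono) auto
        then have "card ?K \<le> m" by simp
        ultimately show ?thesis unfolding V_def by auto
      next
        case False
        then show ?thesis using lim01[OF rs l' i] by (auto simp: V_def)
      qed
      then have "(\<Prod>c\<in>V. l i - c) = 0" using finV by (subst prod_zero_iff) auto
      moreover have "(\<lambda>n. \<Prod>c\<in>V. ?x i (r (s n)) - c) \<longlonglongrightarrow> (\<Prod>c\<in>V. l i - c)"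
        using l'[OF i] by (intro tendsto_prod tendsto_diff tendsto_const) simp
      ultimately show "\<exists>s. strict_mono s \<and> (\<lambda>n. \<Prod>c\<in>V. ?x i (r (s n)) - c) \<longlonglongrightarrow> 0" using s by auto
    qed
  qed
  then obtain l where l: "\<And>i. i \<in> {1..m} \<Longrightarrow> (\<lambda>n. ?x i n) \<longlonglongrightarrow> l i" by metis
  have id_mono: "strict_mono (\<lambda>n :: nat. n)" by (simp add: strict_mono_def)
  have L: "?eq l i = 0" if "i \<in> {1..m}" for i by (rule lim_eq[OF id_mono l that])
  have "0 \<le> l i" if "i \<in> {1..m}" for i by (rule lim01(1)[OF id_mono l that])
  moreover have "l i \<le> 1" if "i \<in> {1..m}" for i by (rule lim01(2)[OF id_mono l that])
  ultimately have L01: "0 \<le> l i" "l i \<le> 1" if "i \<in> {1..m}" for i using that by auto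
  define s where "s = (\<Sum>j\<in>{1..m}. l j)"
  have Ss: "(\<lambda>n. S n w) \<longlonglongrightarrow> s" unfolding S_def s_def by (intro tendsto_sum l)
  have s_bounds: "l i \<le> s" "s \<le> real m - 1 + l i" if i: "i \<in> {1..m}" for i
    using S_bounds[OF i] by (auto intro!: LIMSEQ_le[OF l[OF i] Ss] LIMSEQ_le[OF Ss tendsto_add[OF tendsto_const l[OF i]]])
  have bpos: "0 < baseA (l i) s" "0 < baseB (l i)" if i: "i \<in> {1..m}" for i
    using base_bounds[OF L01[OF i] s_bounds[OF i]] eta_gt by auto
  have HA: "(\<lambda>n. star_H m \<alpha> \<epsilon> \<eta> (X n w) i 1) \<longlonglongrightarrow> baseA (l i) s powr \<alpha>"
    and HB: "(\<lambda>n. star_H m \<alpha> \<epsilon> \<eta> (X n w) i (i + 1)) \<longlonglongrightarrow> baseB (l i) powr \<alpha>" if i: "i \<in> {1..m}" for i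
  proof -
    have "(\<lambda>n. baseA (?x i n) (S n w)) \<longlonglongrightarrow> baseA (l i) s"
      unfolding baseA_def by (intro tendsto_intros l i Ss)
    then show "(\<lambda>n. star_H m \<alpha> \<epsilon> \<eta> (X n w) i 1) \<longlonglongrightarrow> baseA (l i) s powr \<alpha>"
      unfolding H_eq(1)[OF i elim(3)] using bpos[OF i] by (intro tendsto_powr tendsto_const) auto
    have "(\<lambda>n. baseB (?x i n)) \<longlonglongrightarrow> baseB (l i)"
      unfolding baseB_def by (intro tendsto_intros l i)
    then show "(\<lambda>n. star_H m \<alpha> \<epsilon> \<eta> (X n w) i (i + 1)) \<longlonglongrightarrow> baseB (l i) powr \<alpha>"
      unfolding H_eq(2)[OF i elim(3)] using bpos[OF i] by (intro tendsto_powr tendsto_const) auto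
  qed
  have denl: "(\<lambda>n. den i n w) \<longlonglongrightarrow> l i * baseA (l i) s powr \<alpha> + (1 - l i) * baseB (l i) powr \<alpha>"
    if i: "i \<in> {1..m}" for i
    unfolding den_def X_sum[OF elim(3) i] by (intro tendsto_intros l i HA HB)
  \<comment> \<open>At l i = 1 the total s is at least 1, so G = 1 - \<epsilon> - s \<le> -
    \<epsilon> < 0 and the leaf, whose frequency tends to 0, would be visited too often.\<close>
  have not1: "l i \<noteq> 1" if i: "i \<in> {1..m}" for i
  proof
    assume li: "l i = 1"
    have "baseA (l i) s - baseB (l i) < 0" using s_bounds[OF i] \<epsilon> unfolding base_diff li by simp
    then have lt: "baseA (l i) s powr \<alpha> < baseB (l i) powr \<alpha>"
      using bpos[OF i] alpha_pos by (intro powr_less_mono2) auto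
    have q0: "(\<lambda>n. X n w i (i + 1)) \<longlonglongrightarrow> 0"
      using tendsto_diff[OF tendsto_const[of 1] l[OF i]] X_sum[OF elim(3) i] li by simp
    have "(\<lambda>n. den i n w) \<longlonglongrightarrow> baseA (l i) s powr \<alpha>" using denl[OF i] li by simp
    from expanding_if_limits[OF i succ_vertex _ lt HB[OF i] this] bpos[OF i] elim(2) i succ_vertex q0
    show False by fastforce
  qed
  \<comment> \<open>At l i = 0 the value of G is \<epsilon> - s; if positive, the centre would
    attract walk i.\<close>
  have not0: "\<epsilon> - s \<le> 0" if i: "i \<in> {1..m}" "l i = 0" for i
  proof (rule ccontr)
    assume "\<not> \<epsilon> - s \<le> 0"
    then have "0 < baseA (l i) s - baseB (l i)" unfolding base_diff that(2) by simp
    then have lt: "baseB (l i) powr \<alpha> < baseA (l i) s powr \<alpha>"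
      using bpos[OF i(1)] alpha_pos by (intro powr_less_mono2) auto
    have q0: "(\<lambda>n. ?x i n) \<longlonglongrightarrow> 0" using l[OF i(1)] i(2) by simp
    have "(\<lambda>n. den i n w) \<longlonglongrightarrow> baseB (l i) powr \<alpha>" using denl[OF i(1)] i(2) by simp
    from expanding_if_limits[OF i(1) one_vertex _ lt HA[OF i(1)] this] bpos[OF i(1)] elim(2) i(1) one_vertex q0
    show False by fastforce
  qed
  define K where "K = {j \<in> {1..m}. l j \<noteq> 0}"
  have Kne: "K \<noteq> {}"
  proof
    assume "K = {}"
    then have z: "l j = 0" if "j \<in> {1..m}" for j using that by (auto simp: K_def)
    then have "s = 0" by (simp add: s_def)
    then show False using not0[of 1] z[of 1] \<epsilon> two_le_m by simp
  qed
  then obtain i where i: "i \<in> {1..m}" "l i \<noteq> 0" by (auto simp: K_def)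
  have i01: "0 < l i" "l i < 1" using i L01[OF i(1)] not1[OF i(1)] by auto
  note E = equilibrium_interior[OF \<epsilon> L01 L i(1) i01, folded K_def, folded s_def]
  \<comment> \<open>For \<epsilon> > 1/2 the total s = |K| \<epsilon> / (|K| + 2 \<epsilon> - 1) is
    below \<epsilon>, so \<open>not0\<close> admits no zero coordinate.\<close>
  have "K = {1..m}" if e: "1 / 2 < \<epsilon>"
  proof (rule ccontr)
    assume "K \<noteq> {1..m}"
    then obtain j where j: "j \<in> {1..m}" "l j = 0" unfolding K_def by blast
    from not0[OF j] have "\<epsilon> \<le> real (card K) * (\<epsilon> / (real (card K) + 2 * \<epsilon> - 1))" using E(3) by simp
    then have "\<epsilon> * (real (card K) + 2 * \<epsilon> - 1) \<le> real (card K) * \<epsilon>"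
      using E(2) by (simp add: field_simps)
    then have "\<epsilon> * (2 * \<epsilon> - 1) \<le> 0" by (simp add: algebra_simps)
    moreover have "0 < \<epsilon> * (2 * \<epsilon> - 1)" using e \<epsilon> by (intro mult_pos_pos) auto
    ultimately show False by simp
  qed
  then show ?case
    using Kne E(1) l by (intro exI[of _ l] exI[of _ K]) (auto simp: K_def)
qed

section \<open>The three limit statements\<close>

lemma tendsto_point:
  assumes w: "w \<in> space M" and l: "\<And>i. i \<in> {1..m} \<Longrightarrow> (\<lambda>n. X n w i 1) \<longlonglongrightarrow> l i"
  defines "P \<equiv> \<lambda>i v. if i \<in> {1..m} \<and> v \<in> star_vertices i then if v = 1 then l i else 1 - l i else 0"
  shows "(\<lambda>n. X n w) \<longlonglongrightarrow> P" "P \<in> star_domain m"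
proof -
  have "(\<lambda>n. X n w k v) \<longlonglongrightarrow> P k v" for k v
  proof (cases "k \<in> {1..m} \<and> v \<in> star_vertices k")
    case True
    then have k: "k \<in> {1..m}" and v: "v = 1 \<or> v = k + 1" by (auto simp: star_vertices_def)
    show ?thesis
    proof (cases "v = 1")
      case False
      then have "v = k + 1" using v by simp
      then show ?thesis using True False tendsto_diff[OF tendsto_const[of 1] l[OF k]]
        by (simp add: P_def X_sum[OF w k, unfolded Suc_eq_plus1[symmetric]])
    qed (use True l[OF k] in \<open>simp add: P_def\<close>)
  next
    case False
    then show ?thesis by (simp only: P_def star_occupation_def if_False tendsto_const)
  qed
  then show lim: "(\<lambda>n. X n w) \<longlonglongrightarrow> P" by (simp add: tendsto_function2_iff)
  show "P \<in> star_domain m"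
    using star_occupation_in_domain[OF w]
    by (intro Lim_in_closed_set[OF closed_star_domain _ sequentially_bot lim] always_eventually) auto
qed

lemma limit_set_S1:
  assumes \<epsilon>: "\<epsilon> = 0"
  shows "prob {w \<in> space M. limit_set (\<lambda>n. X n w) \<subseteq> star_S1 m} = 1"
proof -
  let ?P = "\<lambda>w. \<forall>i\<in>{1..m}. \<forall>j\<in>{1..m}. i \<noteq> j \<longrightarrow> (\<lambda>n. X n w i 1 * X n w j 1) \<longlonglongrightarrow> 0"
  have [measurable]: "(\<lambda>w. X n w i v) \<in> borel_measurable M" for n i v
    by (rule bounded_measurableD[OF bm_M[OF bm_X]])
  \<comment> \<open>\<open>measure\<close> is 0 outside the sigma-algebra, so measurability is part
    of the claim. It is visible for the products and carried over by
    \<open>limit_set_subset_S1_iff\<close>.\<close>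
  have "{w \<in> space M. ?P w} \<in> events" unfolding tendsto_0_iff_nat by measurable
  then have "prob {w \<in> space M. ?P w} = 1" using products_tendsto_0[OF \<epsilon>] by (intro prob_Collect_eq_1[THEN iffD2])
  moreover have "limit_set (\<lambda>n. X n w) \<subseteq> star_S1 m \<longleftrightarrow> ?P w" if "w \<in> space M" for w
    by (rule limit_set_subset_S1_iff[OF star_occupation_in_domain[OF that]]) (use two_le_m in simp)
  then have "{w \<in> space M. limit_set (\<lambda>n. X n w) \<subseteq> star_S1 m} = {w \<in> space M. ?P w}"
    by blast
  ultimately show ?thesis by simp
qed

text \<open>Full support would mean that every coordinate tends to q. Since m \<ge> 2, walks 1 and 2
  then contradict \<open>not_tendsto_interior\<close>.\<close>

lemma converges_to_S2:
  assumes \<epsilon>: "0 < \<epsilon>" "\<epsilon> < 1 / 2"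
  shows "AE w in M. \<exists>p\<in>star_S2 m \<epsilon>. (\<lambda>n. X n w) \<longlonglongrightarrow> p"
proof -
  have e': "\<epsilon> < 1" "\<epsilon> \<noteq> 1 / 2" using \<epsilon> by auto
  define q where "q = \<epsilon> / (real m + 2 * \<epsilon> - 1)"
  have pos: "0 < real m + 2 * \<epsilon> - 1" using two_le_m \<epsilon> by simp
  have q: "0 < q" "q < 1" using pos \<epsilon> two_le_m by (auto simp: q_def)
  \<comment> \<open>This is G = 0 at the symmetric point, where s = m q.\<close>
  have "q * (real m + 2 * \<epsilon> - 1) = \<epsilon>" using pos by (simp add: q_def)
  then have eq: "baseA q (real m * q) = baseB q" by (simp add: baseA_def baseB_def algebra_simps)
  have "\<epsilon> * (1 - q) \<le> \<epsilon> * 1" using q \<epsilon> by (intro mult_left_mono) auto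
  then have B: "0 < baseB q" using eta_gt two_le_m by (simp add: baseB_def)
  show ?thesis
    using AE_converges[OF \<epsilon>(1) e'] not_tendsto_interior[OF \<epsilon>(2) q eq B] AE_space
  proof eventually_elim
    case (elim w)
    from elim(1) obtain l K where K: "K \<noteq> {}" "K \<subseteq> {1..m}"
      and lim: "\<forall>i\<in>{1..m}. (\<lambda>n. X n w i 1) \<longlonglongrightarrow> l i"
      and lK: "\<forall>i\<in>K. l i = \<epsilon> / (real (card K) + 2 * \<epsilon> - 1)" "\<forall>i\<in>{1..m} - K. l i = 0"
      by (elim exE conjE) rule
    have l: "(\<lambda>n. X n w i 1) \<longlonglongrightarrow> l i" if "i \<in> {1..m}" for i using lim that by blast
    have "K \<noteq> {1..m}"
    proof
      assume Km: "K = {1..m}"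
      then have lq: "l i = q" if "i \<in> {1..m}" for i using lK(1) that by (simp add: q_def)
      have "(\<lambda>n. S n w) \<longlonglongrightarrow> (\<Sum>j\<in>{1..m}. l j)" unfolding S_def by (intro tendsto_sum l)
      moreover have "(\<Sum>j\<in>{1..m}. l j) = real m * q" using lq by simp
      moreover have "1 \<in> {1..m}" "2 \<in> {1..m}" using two_le_m by auto
      ultimately show False using elim(2) l[of 1] l[of 2] lq[of 1] lq[of 2] by simp
    qed
    then have Km: "K \<subset> {1..m}" using K by blast
    define P where "P = (\<lambda>i v. if i \<in> {1..m} \<and> v \<in> star_vertices i then if v = 1 then l i else 1 - l i else 0)"
    have P1: "P i 1 = l i" if "i \<in> {1..m}" for i using that by (simp add: P_def star_vertices_def)
    have dom: "P \<in> star_domain m" unfolding P_def by (rule tendsto_point(2)[OF elim(3) l])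
    have "(\<lambda>n. X n w) \<longlonglongrightarrow> P" unfolding P_def by (rule tendsto_point(1)[OF elim(3) l])
    moreover have "P \<in> star_S2 m \<epsilon>"
      unfolding star_S2_def mem_Collect_eq
    proof (intro conjI exI[of _ K] ballI)
      show "P i 1 = \<epsilon> / (real (card K) + 2 * \<epsilon> - 1)" if "i \<in> K" for i
        using P1[of i] lK(1) K(2) that by auto
      show "P j 1 = 0" if "j \<in> {1..m} - K" for j
        using P1[of j] lK(2) that by auto
    qed (use dom K Km in auto)
    ultimately show ?case by blast
  qed
qed

lemma converges_to_interior:
  assumes \<epsilon>: "1 / 2 < \<epsilon>" "\<epsilon> < 1"
  shows "\<exists>p\<in>star_domain m. (\<forall>i\<in>{1..m}. p i 1 = \<epsilon> / (real m + 2 * \<epsilon> - 1) \<and>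
      p i (i + 1) = 1 - \<epsilon> / (real m + 2 * \<epsilon> - 1)) \<and> (AE w in M. (\<lambda>n. X n w) \<longlonglongrightarrow> p)"
proof -
  define q where "q = \<epsilon> / (real m + 2 * \<epsilon> - 1)"
  \<comment> \<open>The limit is deterministic: the claim places p outside the almost-sure
    quantifier.\<close>
  define P where "P i v = (if i \<in> {1..m} \<and> v \<in> star_vertices i then if v = 1 then q else 1 - q else 0)" for i v
  have q: "0 \<le> q" "q \<le> 1" using \<epsilon> two_le_m by (auto simp: q_def)
  have Pd: "P \<in> star_domain m"
    using q by (auto simp: star_domain_def P_def star_vertices_def)
  have e': "0 < \<epsilon>" "\<epsilon> \<noteq> 1 / 2" using \<epsilon> by auto
  have "AE w in M. (\<lambda>n. X n w) \<longlonglongrightarrow> P"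
    using AE_converges[OF e'(1) \<epsilon>(2) e'(2)] AE_space
  proof eventually_elim
    case (elim w)
    from elim(1) obtain l K where l: "\<forall>i\<in>{1..m}. (\<lambda>n. X n w i 1) \<longlonglongrightarrow> l i"
      and lK: "\<forall>i\<in>K. l i = \<epsilon> / (real (card K) + 2 * \<epsilon> - 1)" and K: "1 / 2 < \<epsilon> \<longrightarrow> K = {1..m}"
      by (elim exE conjE) rule
    have "(\<lambda>n. X n w i 1) \<longlonglongrightarrow> q" if "i \<in> {1..m}" for i
      using l lK K \<epsilon>(1) that by (simp add: q_def)
    from tendsto_point(1)[OF elim(2) this] show ?case unfolding P_def .
  qed
  with Pd show ?thesis
    by (intro bexI[of _ P]) (auto simp: P_def star_vertices_def q_def)
qed

end

theorem theorem6:
  fixes M :: "'a measure" and m :: nat and \<alpha> \<epsilon> \<eta> :: real and W :: "nat \<Rightarrow> nat \<Rightarrow> 'a \<Rightarrow> nat"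
  assumes "m \<ge> 2" and "\<alpha> > 0" and "\<epsilon> \<ge> 0" and "\<eta> > real m - 1 + \<epsilon>"
    and "star_walks M m \<alpha> \<epsilon> \<eta> W"
  shows "(\<epsilon> = 0 \<longrightarrow>
            measure M {\<omega> \<in> space M. limit_set (\<lambda>n. star_occupation m W n \<omega>) \<subseteq> star_S1 m} = 1) \<and>
         (0 < \<epsilon> \<and> \<epsilon> < 1 / 2 \<longrightarrow>
            (AE \<omega> in M. \<exists>p\<in>star_S2 m \<epsilon>. (\<lambda>n. star_occupation m W n \<omega>) \<longlonglongrightarrow> p)) \<and>
         (1 / 2 < \<epsilon> \<and> \<epsilon> < 1 \<longrightarrow>
            (\<exists>p\<in>star_domain m.
               (\<forall>i\<in>{1..m}. p i 1 = \<epsilon> / (real m + 2 * \<epsilon> - 1) \<and>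
                           p i (i + 1) = 1 - \<epsilon> / (real m + 2 * \<epsilon> - 1)) \<and>
               (AE \<omega> in M. (\<lambda>n. star_occupation m W n \<omega>) \<longlonglongrightarrow> p)))"
proof -
  interpret star_walks M m \<alpha> \<epsilon> \<eta> W by fact
  interpret star_system M m \<alpha> \<epsilon> \<eta> W by unfold_locales (use assms in auto)
  show ?thesis
  proof (intro conjI impI)
    assume "\<epsilon> = 0"
    then show "measure M {\<omega> \<in> space M. limit_set (\<lambda>n. star_occupation m W n \<omega>) \<subseteq> star_S1 m} = 1"
      by (rule limit_set_S1)
  next
    assume "0 < \<epsilon> \<and> \<epsilon> < 1 / 2"
    then show "AE \<omega> in M. \<exists>p\<in>star_S2 m \<epsilon>. (\<lambda>n. star_occupation m W n \<omega>) \<longlonglongrightarrow> p"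
      by (elim conjE) (rule converges_to_S2)
  next
    assume "1 / 2 < \<epsilon> \<and> \<epsilon> < 1"
    then show "\<exists>p\<in>star_domain m.
        (\<forall>i\<in>{1..m}. p i 1 = \<epsilon> / (real m + 2 * \<epsilon> - 1) \<and>
          p i (i + 1) = 1 - \<epsilon> / (real m + 2 * \<epsilon> - 1)) \<and>
        (AE \<omega> in M. (\<lambda>n. star_occupation m W n \<omega>) \<longlonglongrightarrow> p)"
      by (elim conjE) (rule converges_to_interior)
  qed
qed

end
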